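(* Let $(M,\nabla,g)$ be a trivial statistical manifold of constant curvature $k$ and let $(\tilde M,\tilde\nabla,\tilde g)$ be a Hessian manifold of constant Hessian curvature $\tilde c$. If there is a statistical immersion $f:M\rightarrow\tilde M$ of codimension one, then $2k+\tilde c\geq 0$. Moreover, when $\tilde c>0$, the Riemannian shape operator $S$ of $f:M\rightarrow\tilde M$ is given by $S=\pm\frac{1}{2}\sqrt{2k+\tilde c}\,I$, where $I$ is the identity $(1,1)$-tensor on $M$.
   Context: A statistical manifold $(M,\nabla,g)$ is a smooth manifold $M$ with a Riemannian metric $g$ and a torsion-free affine connection $\nabla$ such that $(\nabla_{X}g)(Y,Z)=(\nabla_{Y}g)(X,Z)$ for all vector fields $X,Y,Z$ on $M$. It is trivial (Riemannian) if $\nabla$ is the Levi-Civita connection of $g$. It is of constant curvature $k\in\mathbf{R}$ if the curvature tensor $R$ of $\nabla$ satisfies $R(X,Y)Z=k\{g(Y,Z)X-g(X,Z)Y\}$ for all $X,Y,Z$. A Hessian manifold $(\tilde M,\tilde\nabla,\tilde g)$ is a statistical manifold of constant curvature $0$ (i.e. $\tilde\nabla$ is flat). With $\tilde\nabla^{\circ}$ the Levi-Civita connection of $\tilde g$ and $\tilde K(X,Y)=\tilde\nabla_{X}Y-\tilde\nabla^{\circ}_{X}Y$, it is of constant Hessian curvature $\tilde c\in\mathbf{R}$ if $(\tilde\nabla_{X}\tilde K)(Y,Z)=-\frac{\tilde c}{2}\{\tilde g(X,Y)Z+\tilde g(X,Z)Y\}$ for all vector fields $X,Y,Z$ on $\tilde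 M$. An immersion $f:M\to\tilde M$ between statistical manifolds $(M,\nabla,g)$ and $(\tilde M,\tilde\nabla,\tilde g)$ is a statistical immersion if $g=f^{*}\tilde g$ and $g(\nabla_{X}Y,Z)=\tilde g(\tilde\nabla_{X}f_{*}Y,f_{*}Z)$ for all vector fields $X,Y,Z$ on $M$. For $f$ of codimension one with unit normal vector field $\xi$, the Riemannian shape operator is the $(1,1)$-tensor $S$ on $M$ defined by $\tilde\nabla^{\circ}_{X}\xi=-f_{*}SX$.
   Formalization: The formal theorem assumes dim M ≥ 2, and c̃ ≠ 0 if dim M = 2. Otherwise the claim fails: in dimension 1 every k is admissible (a line in flat R², k = -1, c̃ = 0), and the pseudosphere (k = -1) in flat Euclidean R³ (c̃ = 0) has 2k + c̃ < 0. *)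

theory Defs
  imports "HOL-Analysis.Analysis" "HOL-Library.Function_Algebras"
begin

section \<open>Smooth functions between open subsets of Euclidean spaces\<close>

text \<open>
  Meaningful for open \<open>S\<close> only: \<open>C^k\<close> in terms of iterated directional derivatives.
\<close>

fun Ck_on :: "nat \<Rightarrow> 'm::euclidean_space set \<Rightarrow> ('m \<Rightarrow> 'e::real_normed_vector) \<Rightarrow> bool" where
  "Ck_on 0 S f \<longleftrightarrow> continuous_on S f"
| "Ck_on (Suc k) S f \<longleftrightarrow>
     (\<forall>x\<in>S. f differentiable (at x)) \<and>
     (\<forall>v. Ck_on k S (\<lambda>x. frechet_derivative f (at x) v))"

definition smooth_on :: "'m::euclidean_space set \<Rightarrow> ('m \<Rightarrow> 'e::real_normed_vector) \<Rightarrow> bool" where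
  "smooth_on S f \<longleftrightarrow> (\<forall>k. Ck_on k S f)"


section \<open>Smooth manifolds\<close>

text \<open>
  The underlying space of a manifold is a whole type \<open>'a\<close>, which the theorem requires to be
  Hausdorff and second countable; the dimension is \<open>DIM('m)\<close>.  The smooth structure is given by
  an atlas, which need not be maximal.
\<close>

type_synonym ('a, 'm) chart = "'a set \<times> ('a \<Rightarrow> 'm)"

abbreviation cdom :: "('a, 'm) chart \<Rightarrow> 'a set" where
  "cdom c \<equiv> fst c"

abbreviation cmap :: "('a, 'm) chart \<Rightarrow> 'a \<Rightarrow> 'm" where
  "cmap c \<equiv> snd c"

definition cinv :: "('a, 'm) chart \<Rightarrow> 'm \<Rightarrow> 'a" where
  "cinv c = inv_into (cdom c) (cmap c)"

definition is_chart :: "('a::topological_space, 'm::euclidean_space) chart \<Rightarrow> bool" where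
  "is_chart c \<longleftrightarrow> open (cdom c) \<and> open (cmap c ` cdom c) \<and>
     homeomorphism (cdom c) (cmap c ` cdom c) (cmap c) (cinv c)"

definition smooth_atlas :: "('a::topological_space, 'm::euclidean_space) chart set \<Rightarrow> bool" where
  "smooth_atlas A \<longleftrightarrow>
     (\<forall>c\<in>A. is_chart c) \<and> (\<Union>c\<in>A. cdom c) = UNIV \<and>
     (\<forall>c\<in>A. \<forall>d\<in>A. smooth_on (cmap c ` (cdom c \<inter> cdom d)) (cmap d \<circ> cinv c))"

text \<open>Some chart around a point, for notions that do not depend on the choice.\<close>

definition chart_at :: "('a, 'm) chart set \<Rightarrow> 'a \<Rightarrow> ('a, 'm) chart" where
  "chart_at A p = (SOME c. c \<in> A \<and> p \<in> cdom c)"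


section \<open>Tangent vectors and vector fields\<close>

text \<open>
  A tangent vector at \<open>p\<close> assigns to every chart around \<open>p\<close> its coordinate vector; the coordinate
  vectors are related by the Jacobians of the transition maps.  The value at all other charts is
  \<open>0\<close>, so that equality of tangent vectors is equality of functions.  Addition and subtraction
  are the pointwise ones on functions.
\<close>

type_synonym ('a, 'm) tvec = "('a, 'm) chart \<Rightarrow> 'm"

definition vscale :: "real \<Rightarrow> ('a, 'm::real_vector) tvec \<Rightarrow> ('a, 'm) tvec"
    (infixr "*\<^sub>T" 75) where
  "a *\<^sub>T v = (\<lambda>c. a *\<^sub>R v c)"

definition tangent_space ::
    "('a, 'm::euclidean_space) chart set \<Rightarrow> 'a \<Rightarrow> ('a, 'm) tvec set" where
  "tangent_space A p = {v.
     (\<forall>c\<in>A. \<forall>d\<in>A. p \<in> cdom c \<inter> cdom d \<longrightarrow>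
        v d = frechet_derivative (cmap d \<circ> cinv c) (at (cmap c p)) (v c)) \<and>
     (\<forall>c. \<not> (c \<in> A \<and> p \<in> cdom c) \<longrightarrow> v c = 0)}"

definition smooth_fun ::
    "('a, 'm::euclidean_space) chart set \<Rightarrow> 'a set \<Rightarrow> ('a \<Rightarrow> real) \<Rightarrow> bool" where
  "smooth_fun A U h \<longleftrightarrow> (\<forall>c\<in>A. smooth_on (cmap c ` (U \<inter> cdom c)) (h \<circ> cinv c))"

text \<open>
  Smooth vector fields on an open set \<open>U\<close>.  As functions they are total; values outside \<open>U\<close> are
  irrelevant.
\<close>

type_synonym ('a, 'm) vfield = "'a \<Rightarrow> ('a, 'm) tvec"

definition vector_fields ::
    "('a, 'm::euclidean_space) chart set \<Rightarrow> 'a set \<Rightarrow> ('a, 'm) vfield set" where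
  "vector_fields A U = {X.
     (\<forall>p\<in>U. X p \<in> tangent_space A p) \<and>
     (\<forall>c\<in>A. smooth_on (cmap c ` (U \<inter> cdom c)) (\<lambda>x. X (cinv c x) c))}"

text \<open>The derivative \<open>v h\<close> of a real function \<open>h\<close> along a tangent vector \<open>v\<close> at \<open>p\<close>.\<close>

definition dderiv ::
    "('a, 'm::euclidean_space) chart set \<Rightarrow> 'a \<Rightarrow> ('a, 'm) tvec \<Rightarrow> ('a \<Rightarrow> real) \<Rightarrow> real" where
  "dderiv A p v h =
     (let c = chart_at A p in frechet_derivative (h \<circ> cinv c) (at (cmap c p)) (v c))"

definition lie_bracket ::
    "('a, 'm::euclidean_space) chart set \<Rightarrow> ('a, 'm) vfield \<Rightarrow> ('a, 'm) vfield \<Rightarrow> ('a, 'm) vfield"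
  where
  "lie_bracket A X Y = (\<lambda>p c. if c \<in> A \<and> p \<in> cdom c
     then frechet_derivative (\<lambda>x. Y (cinv c x) c) (at (cmap c p)) (X p c)
        - frechet_derivative (\<lambda>x. X (cinv c x) c) (at (cmap c p)) (Y p c)
     else 0)"

text \<open>For \<open>c \<in> A\<close>, the vector field \<open>coord_field A c b\<close> on \<open>cdom c\<close> has constant coordinates \<open>b\<close>
  in the chart \<open>c\<close>.\<close>

definition coord_field ::
    "('a, 'm::euclidean_space) chart set \<Rightarrow> ('a, 'm) chart \<Rightarrow> 'm \<Rightarrow> ('a, 'm) vfield" where
  "coord_field A c b = (\<lambda>p d. if d \<in> A \<and> p \<in> cdom d \<and> p \<in> cdom c
     then frechet_derivative (cmap d \<circ> cinv c) (at (cmap c p)) b else 0)"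


section \<open>Metrics and connections\<close>

type_synonym ('a, 'm) metric = "'a \<Rightarrow> ('a, 'm) tvec \<Rightarrow> ('a, 'm) tvec \<Rightarrow> real"

definition riemannian_metric ::
    "('a::topological_space, 'm::euclidean_space) chart set \<Rightarrow> ('a, 'm) metric \<Rightarrow> bool" where
  "riemannian_metric A g \<longleftrightarrow>
     (\<forall>p. \<forall>u\<in>tangent_space A p. \<forall>v\<in>tangent_space A p. \<forall>w\<in>tangent_space A p. \<forall>a.
        g p u v = g p v u \<and>
        g p (u + v) w = g p u w + g p v w \<and>
        g p (a *\<^sub>T u) v = a * g p u v \<and>
        (u \<noteq> 0 \<longrightarrow> g p u u > 0)) \<and>
     (\<forall>U. open U \<longrightarrow> (\<forall>X\<in>vector_fields A U. \<forall>Y\<in>vector_fields A U.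
        smooth_fun A U (\<lambda>p. g p (X p) (Y p))))"

text \<open>
  A connection \<open>D\<close> gives the derivative \<open>D p v Y\<close> at \<open>p\<close> of a vector field \<open>Y\<close>, defined and smooth
  on some open neighbourhood of \<open>p\<close>, along \<open>v\<close> in the tangent space at \<open>p\<close>.
\<close>

type_synonym ('a, 'm) conn = "'a \<Rightarrow> ('a, 'm) tvec \<Rightarrow> ('a, 'm) vfield \<Rightarrow> ('a, 'm) tvec"

definition cov :: "('a, 'm) conn \<Rightarrow> ('a, 'm) vfield \<Rightarrow> ('a, 'm) vfield \<Rightarrow> ('a, 'm) vfield" where
  "cov D X Y = (\<lambda>p. D p (X p) Y)"

text \<open>
  The clause before the last says that \<open>D p v Y\<close> depends only on \<open>Y\<close> as a vector field on an
  arbitrarily small neighbourhood \<open>U\<close> of \<open>p\<close>.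
\<close>

definition affine_connection ::
    "('a::topological_space, 'm::euclidean_space) chart set \<Rightarrow> ('a, 'm) conn \<Rightarrow> bool" where
  "affine_connection A D \<longleftrightarrow> (\<forall>U. open U \<longrightarrow>
     (\<forall>p\<in>U. \<forall>v\<in>tangent_space A p. \<forall>w\<in>tangent_space A p.
      \<forall>Y\<in>vector_fields A U. \<forall>Z\<in>vector_fields A U.
        D p v Y \<in> tangent_space A p \<and>
        D p (v + w) Y = D p v Y + D p w Y \<and>
        (\<forall>a. D p (a *\<^sub>T v) Y = a *\<^sub>T D p v Y) \<and>
        D p v (Y + Z) = D p v Y + D p v Z \<and>
        (\<forall>h. smooth_fun A U h \<longrightarrow>
           D p v (\<lambda>q. h q *\<^sub>T Y q) = dderiv A p v h *\<^sub>T Y p + h p *\<^sub>T D p v Y) \<and>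
        ((\<forall>q\<in>U. Y q = Z q) \<longrightarrow> D p v Y = D p v Z)) \<and>
     (\<forall>X\<in>vector_fields A U. \<forall>Y\<in>vector_fields A U. cov D X Y \<in> vector_fields A U))"

definition torsion_free ::
    "('a::topological_space, 'm::euclidean_space) chart set \<Rightarrow> ('a, 'm) conn \<Rightarrow> bool" where
  "torsion_free A D \<longleftrightarrow> (\<forall>U. open U \<longrightarrow>
     (\<forall>X\<in>vector_fields A U. \<forall>Y\<in>vector_fields A U. \<forall>p\<in>U.
        cov D X Y p - cov D Y X p = lie_bracket A X Y p))"

text \<open>\<open>cov_metric A D g X Y Z p\<close> is the value of $(\nabla_X g)(Y,Z)$ at \<open>p\<close>.\<close>

definition cov_metric ::
    "('a, 'm::euclidean_space) chart set \<Rightarrow> ('a, 'm) conn \<Rightarrow> ('a, 'm) metric \<Rightarrow>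
     ('a, 'm) vfield \<Rightarrow> ('a, 'm) vfield \<Rightarrow> ('a, 'm) vfield \<Rightarrow> 'a \<Rightarrow> real" where
  "cov_metric A D g X Y Z p =
     dderiv A p (X p) (\<lambda>q. g q (Y q) (Z q)) - g p (cov D X Y p) (Z p) - g p (Y p) (cov D X Z p)"

definition curvature ::
    "('a, 'm::euclidean_space) chart set \<Rightarrow> ('a, 'm) conn \<Rightarrow>
     ('a, 'm) vfield \<Rightarrow> ('a, 'm) vfield \<Rightarrow> ('a, 'm) vfield \<Rightarrow> ('a, 'm) vfield" where
  "curvature A D X Y Z =
     cov D X (cov D Y Z) - cov D Y (cov D X Z) - cov D (lie_bracket A X Y) Z"

text \<open>By the fundamental theorem of Riemannian geometry, there is exactly one such \<open>D\<close> (up to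
  irrelevant values).\<close>

definition levi_civita ::
    "('a::topological_space, 'm::euclidean_space) chart set \<Rightarrow> ('a, 'm) metric \<Rightarrow>
     ('a, 'm) conn \<Rightarrow> bool" where
  "levi_civita A g D \<longleftrightarrow> affine_connection A D \<and> torsion_free A D \<and>
     (\<forall>U. open U \<longrightarrow>
        (\<forall>X\<in>vector_fields A U. \<forall>Y\<in>vector_fields A U. \<forall>Z\<in>vector_fields A U. \<forall>p\<in>U.
           cov_metric A D g X Y Z p = 0))"


section \<open>Statistical and Hessian manifolds\<close>

definition statistical_manifold ::
    "('a::topological_space, 'm::euclidean_space) chart set \<Rightarrow> ('a, 'm) conn \<Rightarrow>
     ('a, 'm) metric \<Rightarrow> bool" where
  "statistical_manifold A D g \<longleftrightarrow>
     smooth_atlas A \<and> riemannian_metric A g \<and> affine_connection A D \<and> torsion_free A D \<and>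
     (\<forall>U. open U \<longrightarrow>
        (\<forall>X\<in>vector_fields A U. \<forall>Y\<in>vector_fields A U. \<forall>Z\<in>vector_fields A U. \<forall>p\<in>U.
           cov_metric A D g X Y Z p = cov_metric A D g Y X Z p))"

definition trivial_statistical_manifold ::
    "('a::topological_space, 'm::euclidean_space) chart set \<Rightarrow> ('a, 'm) conn \<Rightarrow>
     ('a, 'm) metric \<Rightarrow> bool" where
  "trivial_statistical_manifold A D g \<longleftrightarrow> statistical_manifold A D g \<and> levi_civita A g D"

definition constant_curvature ::
    "('a::topological_space, 'm::euclidean_space) chart set \<Rightarrow> ('a, 'm) conn \<Rightarrow>
     ('a, 'm) metric \<Rightarrow> real \<Rightarrow> bool" where
  "constant_curvature A D g k \<longleftrightarrow> (\<forall>U. open U \<longrightarrow>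
     (\<forall>X\<in>vector_fields A U. \<forall>Y\<in>vector_fields A U. \<forall>Z\<in>vector_fields A U. \<forall>p\<in>U.
        curvature A D X Y Z p =
          k *\<^sub>T (g p (Y p) (Z p) *\<^sub>T X p - g p (X p) (Z p) *\<^sub>T Y p)))"

definition hessian_manifold ::
    "('a::topological_space, 'm::euclidean_space) chart set \<Rightarrow> ('a, 'm) conn \<Rightarrow>
     ('a, 'm) metric \<Rightarrow> bool" where
  "hessian_manifold A D g \<longleftrightarrow> statistical_manifold A D g \<and> constant_curvature A D g 0"

definition difference_tensor ::
    "('a, 'm::euclidean_space) conn \<Rightarrow> ('a, 'm) conn \<Rightarrow>
     ('a, 'm) vfield \<Rightarrow> ('a, 'm) vfield \<Rightarrow> ('a, 'm) vfield" where
  "difference_tensor D D0 X Y = cov D X Y - cov D0 X Y"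

text \<open>\<open>D0\<close> is meant to be the Levi-Civita connection of \<open>g\<close>.\<close>

definition constant_hessian_curvature ::
    "('a::topological_space, 'm::euclidean_space) chart set \<Rightarrow> ('a, 'm) conn \<Rightarrow> ('a, 'm) conn \<Rightarrow>
     ('a, 'm) metric \<Rightarrow> real \<Rightarrow> bool" where
  "constant_hessian_curvature A D D0 g c \<longleftrightarrow> (let K = difference_tensor D D0 in
     \<forall>U. open U \<longrightarrow>
     (\<forall>X\<in>vector_fields A U. \<forall>Y\<in>vector_fields A U. \<forall>Z\<in>vector_fields A U. \<forall>p\<in>U.
        (cov D X (K Y Z) - K (cov D X Y) Z - K Y (cov D X Z)) p =
          (- (c / 2)) *\<^sub>T (g p (X p) (Y p) *\<^sub>T Z p + g p (X p) (Z p) *\<^sub>T Y p)))"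


section \<open>Statistical immersions and the shape operator\<close>

definition smooth_map ::
    "('a::topological_space, 'm::euclidean_space) chart set \<Rightarrow>
     ('b::topological_space, 'n::euclidean_space) chart set \<Rightarrow> ('a \<Rightarrow> 'b) \<Rightarrow> bool" where
  "smooth_map A B f \<longleftrightarrow> continuous_on UNIV f \<and>
     (\<forall>c\<in>A. \<forall>d\<in>B. smooth_on (cmap c ` (cdom c \<inter> f -` cdom d)) (cmap d \<circ> f \<circ> cinv c))"

definition pushforward ::
    "('a, 'm::euclidean_space) chart set \<Rightarrow> ('b, 'n::euclidean_space) chart set \<Rightarrow> ('a \<Rightarrow> 'b) \<Rightarrow>
     'a \<Rightarrow> ('a, 'm) tvec \<Rightarrow> ('b, 'n) tvec" where
  "pushforward A B f p v = (let c = chart_at A p in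
     (\<lambda>d. if d \<in> B \<and> f p \<in> cdom d
          then frechet_derivative (cmap d \<circ> f \<circ> cinv c) (at (cmap c p)) (v c) else 0))"

definition immersion ::
    "('a::topological_space, 'm::euclidean_space) chart set \<Rightarrow>
     ('b::topological_space, 'n::euclidean_space) chart set \<Rightarrow> ('a \<Rightarrow> 'b) \<Rightarrow> bool" where
  "immersion A B f \<longleftrightarrow> smooth_map A B f \<and>
     (\<forall>p. inj_on (pushforward A B f p) (tangent_space A p))"

text \<open>Smooth vector fields along \<open>f\<close> on an open set \<open>U\<close> of the domain.\<close>

definition fields_along ::
    "('a, 'm::euclidean_space) chart set \<Rightarrow> ('b, 'n::euclidean_space) chart set \<Rightarrow> ('a \<Rightarrow> 'b) \<Rightarrow>
     'a set \<Rightarrow> ('a \<Rightarrow> ('b, 'n) tvec) set" where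
  "fields_along A B f U = {W.
     (\<forall>p\<in>U. W p \<in> tangent_space B (f p)) \<and>
     (\<forall>c\<in>A. \<forall>d\<in>B. smooth_on (cmap c ` (U \<inter> cdom c \<inter> f -` cdom d)) (\<lambda>x. W (cinv c x) d))}"

text \<open>
  The connection along \<open>f\<close> (pullback connection) induced by a connection \<open>D\<close> on the target, applied
  to a vector field \<open>W\<close> along \<open>f\<close> and a tangent vector \<open>v\<close> at \<open>p\<close>.  Near \<open>p\<close> we have
  $W = \sum_b W^b\, (\partial_b \circ f)$ with the coordinate fields $\partial_b$ of a chart around
  \<open>f p\<close>, so that the derivative is
  $\sum_b (v W^b)\, \partial_b + W^b\, \nabla_{f_* v} \partial_b$.
\<close>

definition pullback_conn ::
    "('a, 'm::euclidean_space) chart set \<Rightarrow> ('b, 'n::euclidean_space) chart set \<Rightarrow> ('a \<Rightarrow> 'b) \<Rightarrow>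
     ('b, 'n) conn \<Rightarrow> 'a \<Rightarrow> ('a, 'm) tvec \<Rightarrow> ('a \<Rightarrow> ('b, 'n) tvec) \<Rightarrow> ('b, 'n) tvec" where
  "pullback_conn A B f D p v W = (let d = chart_at B (f p) in
     \<Sum>b\<in>Basis. dderiv A p v (\<lambda>q. W q d \<bullet> b) *\<^sub>T coord_field B d b (f p)
             + (W p d \<bullet> b) *\<^sub>T D (f p) (pushforward A B f p v) (coord_field B d b))"

definition statistical_immersion ::
    "('a::topological_space, 'm::euclidean_space) chart set \<Rightarrow> ('a, 'm) conn \<Rightarrow> ('a, 'm) metric \<Rightarrow>
     ('b::topological_space, 'n::euclidean_space) chart set \<Rightarrow> ('b, 'n) conn \<Rightarrow> ('b, 'n) metric \<Rightarrow>
     ('a \<Rightarrow> 'b) \<Rightarrow> bool" where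
  "statistical_immersion A D g B D' g' f \<longleftrightarrow> immersion A B f \<and>
     (\<forall>p. \<forall>u\<in>tangent_space A p. \<forall>v\<in>tangent_space A p.
        g p u v = g' (f p) (pushforward A B f p u) (pushforward A B f p v)) \<and>
     (\<forall>U. open U \<longrightarrow>
       (\<forall>X\<in>vector_fields A U. \<forall>Y\<in>vector_fields A U. \<forall>Z\<in>vector_fields A U. \<forall>p\<in>U.
          g p (cov D X Y p) (Z p) =
          g' (f p) (pullback_conn A B f D' p (X p) (\<lambda>q. pushforward A B f q (Y q)))
                   (pushforward A B f p (Z p))))"

definition unit_normal_field ::
    "('a, 'm::euclidean_space) chart set \<Rightarrow> ('b, 'n::euclidean_space) chart set \<Rightarrow>
     ('b, 'n) metric \<Rightarrow> ('a \<Rightarrow> 'b) \<Rightarrow> 'a set \<Rightarrow> ('a \<Rightarrow> ('b, 'n) tvec) \<Rightarrow> bool" where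
  "unit_normal_field A B g' f U \<xi> \<longleftrightarrow> \<xi> \<in> fields_along A B f U \<and>
     (\<forall>p\<in>U. g' (f p) (\<xi> p) (\<xi> p) = 1 \<and>
        (\<forall>v\<in>tangent_space A p. g' (f p) (\<xi> p) (pushforward A B f p v) = 0))"

text \<open>\<open>D0\<close> is meant to be the Levi-Civita connection of the target, \<open>\<xi>\<close> a unit normal field.\<close>

definition shape_operator ::
    "('a, 'm::euclidean_space) chart set \<Rightarrow> ('b, 'n::euclidean_space) chart set \<Rightarrow>
     ('b, 'n) conn \<Rightarrow> ('a \<Rightarrow> 'b) \<Rightarrow> ('a \<Rightarrow> ('b, 'n) tvec) \<Rightarrow>
     'a \<Rightarrow> ('a, 'm) tvec \<Rightarrow> ('a, 'm) tvec" where
  "shape_operator A B D0 f \<xi> p v =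
     (THE w. w \<in> tangent_space A p \<and>
        pullback_conn A B f D0 p v \<xi> = - pushforward A B f p w)"

text \<open>
  Remark on dimensions.  For hypersurfaces of dimension 1 every \<open>k\<close> satisfies
  \<open>constant_curvature A D g k\<close>, so no inequality on \<open>k\<close> can hold.  For dimension 2 and \<open>c = 0\<close>
  the pseudosphere (\<open>k = -1\<close>) in Euclidean 3-space with its flat Levi-Civita connection violates
  $2k + c \ge 0$.  The theorem excludes exactly these cases.
\<close>

end

theory Submission
  imports Defs
begin

text \<open>
  Write \<open>K\<close> for the difference of the flat connection and the Levi-Civita connection of the ambient
  Hessian manifold.  By the Codazzi equation of the statistical structure, the cubic form
  \<open>\<langle>K(X,Y),Z\<rangle>\<close> is totally symmetric.  The connection of the hypersurface is the Levi-Civita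
  connection of the induced metric and also the tangential part of the flat connection; comparing this
  with the tangential part of the ambient Levi-Civita connection shows that \<open>K(X,Y)\<close> is normal for
  tangent \<open>X\<close>, \<open>Y\<close> (\<open>K_tangential\<close>).  With a unit normal \<open>n\<close>, two symmetric forms therefore
  describe the immersion at a point: \<open>\<beta>(X,Y) = \<langle>K(X,Y),n\<rangle>\<close> and the Riemannian second fundamental
  form \<open>\<sigma>(X,Y) = \<langle>SX,Y\<rangle>\<close>.

  These forms satisfy two equations.  The tangential part of the flatness of the ambient connection is
  a Gauss equation (\<open>gauss_equation\<close>),
  \<open>k(\<langle>V,W\<rangle>\<langle>U,Z\<rangle> - \<langle>U,W\<rangle>\<langle>V,Z\<rangle>) = (\<sigma>+\<beta>)(V,W)(\<sigma>-\<beta>)(U,Z) - (\<sigma>+\<beta>)(U,W)(\<sigma>-\<beta>)(V,Z)\<close>.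
  The condition on the Hessian curvature contains a derivative of \<open>K\<close>, but as \<open>K\<close> is normal on
  tangent vectors, the tangential part of that derivative is algebraic, by the Weingarten formula
  (\<open>hessian_equation\<close>):
  \<open>\<beta>(V,W)(\<beta>-\<sigma>)(U,Z) = -(c/2)(\<langle>U,V\<rangle>\<langle>W,Z\<rangle> + \<langle>U,W\<rangle>\<langle>V,Z\<rangle>) + (\<sigma>+\<beta>)(U,V)\<beta>(W,Z) + (\<sigma>+\<beta>)(U,W)\<beta>(V,Z)\<close>.

  The rest is linear algebra in one tangent space (\<open>gauss_hess_conclusion\<close>).  If \<open>c \<noteq> 0\<close>, the second
  equation says that \<open>\<beta>(Y,Y) \<noteq> 0\<close> for \<open>Y \<noteq> 0\<close>, that \<open>\<beta>\<close>-conjugate vectors are orthogonal, and then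
  that \<open>\<sigma> = \<beta>\<close> is a multiple \<open>e\<close> of the metric with \<open>4e\<^sup>2 = c\<close>.  So \<open>c > 0\<close>, and the Gauss equation
  gives \<open>k = 0\<close>; hence \<open>2k + c = c = 4e\<^sup>2\<close>.  If \<open>c = 0\<close> and \<open>k \<noteq> 0\<close>, the dimension is at least three,
  where the Gauss equation makes \<open>\<sigma> + \<beta>\<close> a multiple of the metric; the second equation then gives
  \<open>\<beta> = 0\<close>, and \<open>k\<close> is the square of a nonzero number.

  The equations are derived in coordinates, on functions between open subsets of Euclidean spaces
  (locale \<open>local_hypersurface\<close>); the formulas for connections and fields in charts
  (\<open>conn_chart\<close>, \<open>pullback_chart\<close>) translate the definitions on manifolds into this setting.  The
  sign of \<open>e\<close> is locally constant because \<open>\<sigma>\<close> is continuous, and constant on connected domains of the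
  normal field.
\<close>

section \<open>Functions of class \<open>C^k\<close>\<close>

lemma Ck_on_subset: "Ck_on k S f \<Longrightarrow> T \<subseteq> S \<Longrightarrow> Ck_on k T f"
  by (induction k arbitrary: f) (auto intro: continuous_on_subset)

lemma Ck_on_cong:
  assumes "open S" "\<And>x. x \<in> S \<Longrightarrow> f x = g x"
  shows "Ck_on k S f \<longleftrightarrow> Ck_on k S g"
  using assms(2)
proof (induction k arbitrary: f g)
  case 0
  then show ?case by (auto cong: continuous_on_cong)
next
  case (Suc k)
  have imp: "Ck_on (Suc k) S b" if "\<And>x. x \<in> S \<Longrightarrow> a x = b x" "Ck_on (Suc k) S a" for a b :: "'a \<Rightarrow> 'b"
  proof -
    have d: "(b has_derivative frechet_derivative a (at x)) (at x)" if "x \<in> S" for x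
    proof (rule has_derivative_transform_within_open[OF _ assms(1) that])
      show "(a has_derivative frechet_derivative a (at x)) (at x)"
        using \<open>Ck_on (Suc k) S a\<close> that by (auto simp: frechet_derivative_works)
    qed (use \<open>\<And>x. x \<in> S \<Longrightarrow> a x = b x\<close> in auto)
    have e: "frechet_derivative b (at x) v = frechet_derivative a (at x) v" if "x \<in> S" for x v
      using frechet_derivative_at[OF d[OF that]] by simp
    have "Ck_on k S (\<lambda>x. frechet_derivative b (at x) v)" for v
      using Suc.IH[of "\<lambda>x. frechet_derivative b (at x) v" "\<lambda>x. frechet_derivative a (at x) v"] e that(2)
      by auto
    then show ?thesis using d by (auto simp: differentiable_def)
  qed
  show ?case
    using imp[of f g, OF Suc.prems] imp[of g f, OF Suc.prems[symmetric]] by blast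
qed

lemma Ck_on_imp_continuous: "Ck_on k S f \<Longrightarrow> continuous_on S f"
  by (cases k) (auto simp: continuous_on_eq_continuous_within
      intro: differentiable_imp_continuous_within differentiable_at_withinI)

lemma Ck_on_SucD: "Ck_on (Suc k) S f \<Longrightarrow> Ck_on k S f"
proof (induction k arbitrary: f)
  case 0
  then show ?case by (metis Ck_on.simps(1) Ck_on_imp_continuous)
next
  case (Suc k)
  then show ?case by simp
qed

lemma Ck_on_const: "Ck_on k S (\<lambda>x. a)"
  by (induction k arbitrary: a) auto

lemma Ck_on_SucI:
  assumes "open S" "\<And>x. x \<in> S \<Longrightarrow> (f has_derivative f' x) (at x)"
    "\<And>v. Ck_on k S (\<lambda>x. f' x v)"
  shows "Ck_on (Suc k) S f"
proof -
  have "Ck_on k S (\<lambda>x. frechet_derivative f (at x) v)" for v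
    using assms(3)[of v] Ck_on_cong[OF assms(1), of "\<lambda>x. f' x v" "\<lambda>x. frechet_derivative f (at x) v" k]
      frechet_derivative_at[OF assms(2)] by auto
  then show ?thesis using assms(2) by (auto simp: differentiable_def)
qed

lemma Ck_on_Suc_has_derivative:
  "Ck_on (Suc k) S f \<Longrightarrow> x \<in> S \<Longrightarrow> (f has_derivative frechet_derivative f (at x)) (at x)"
  by (auto simp: frechet_derivative_works)

lemma Ck_on_bounded_linear:
  assumes "open S" "bounded_linear L" "Ck_on k S f"
  shows "Ck_on k S (\<lambda>x. L (f x))"
  using assms(3)
proof (induction k arbitrary: f)
  case 0
  then show ?case using bounded_linear.continuous_on[OF assms(2)] by auto
next
  case (Suc k)
  show ?case
    by (rule Ck_on_SucI[OF assms(1), of _ "\<lambda>x v. L (frechet_derivative f (at x) v)"])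
      (use Suc bounded_linear.has_derivative[OF assms(2) Ck_on_Suc_has_derivative[OF Suc.prems]] in auto)
qed

lemma Ck_on_add:
  assumes "open S" "Ck_on k S f" "Ck_on k S g"
  shows "Ck_on k S (\<lambda>x. f x + g x)"
  using assms(2,3)
proof (induction k arbitrary: f g)
  case 0
  then show ?case by (auto intro: continuous_intros)
next
  case (Suc k)
  show ?case
    by (rule Ck_on_SucI[OF assms(1),
          of _ "\<lambda>x v. frechet_derivative f (at x) v + frechet_derivative g (at x) v"])
      (use Suc has_derivative_add[OF Ck_on_Suc_has_derivative[OF Suc.prems(1)]
            Ck_on_Suc_has_derivative[OF Suc.prems(2)]] in auto)
qed

lemma Ck_on_sum:
  assumes "open S" "\<And>i. i \<in> I \<Longrightarrow> Ck_on k S (f i)"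
  shows "Ck_on k S (\<lambda>x. \<Sum>i\<in>I. f i x)"
  using assms(2)
  by (induction I rule: infinite_finite_induct) (auto intro: Ck_on_const Ck_on_add[OF assms(1)])

lemma Ck_on_scaleR:
  fixes h :: "'m::euclidean_space \<Rightarrow> real"
  assumes "open S" "Ck_on k S h" "Ck_on k S f"
  shows "Ck_on k S (\<lambda>x. h x *\<^sub>R f x)"
  using assms(2,3)
proof (induction k arbitrary: h f)
  case 0
  then show ?case by (auto intro: continuous_intros)
next
  case (Suc k)
  show ?case
  proof (rule Ck_on_SucI[OF assms(1),
          of _ "\<lambda>x v. h x *\<^sub>R frechet_derivative f (at x) v + frechet_derivative h (at x) v *\<^sub>R f x"])
    show "((\<lambda>x. h x *\<^sub>R f x) has_derivative
         (\<lambda>v. h x *\<^sub>R frechet_derivative f (at x) v + frechet_derivative h (at x) v *\<^sub>R f x)) (at x)"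
      if "x \<in> S" for x
      by (rule has_derivative_scaleR[OF Ck_on_Suc_has_derivative[OF Suc.prems(1) that]
            Ck_on_Suc_has_derivative[OF Suc.prems(2) that]])
    show "Ck_on k S (\<lambda>x. h x *\<^sub>R frechet_derivative f (at x) v + frechet_derivative h (at x) v *\<^sub>R f x)" for v
      by (rule Ck_on_add[OF assms(1)]; rule Suc.IH)
        (use Suc.prems Ck_on_SucD[OF Suc.prems(1)] Ck_on_SucD[OF Suc.prems(2)] in auto)
  qed
qed

lemma linear_basis_expansion:
  fixes L :: "'m::euclidean_space \<Rightarrow> 'e::real_vector"
  assumes "linear L" shows "L w = (\<Sum>b\<in>Basis. (w \<bullet> b) *\<^sub>R L b)"
proof -
  have "L w = L (\<Sum>b\<in>Basis. (w \<bullet> b) *\<^sub>R b)" by (simp only: euclidean_representation)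
  also have "\<dots> = (\<Sum>b\<in>Basis. (w \<bullet> b) *\<^sub>R L b)"
    by (simp only: linear_sum[OF assms] linear_scale[OF assms])
  finally show ?thesis .
qed

text \<open>The chain rule expands \<open>D(g \<circ> f)\<close> in a basis, which turns the derivative of a composition into
  sums of products of compositions of lower order.\<close>

lemma Ck_on_compose:
  fixes f :: "'m::euclidean_space \<Rightarrow> 'p::euclidean_space"
  assumes "open S" "open T" "f ` S \<subseteq> T" "Ck_on k S f" "Ck_on k T g"
  shows "Ck_on k S (\<lambda>x. g (f x))"
  using assms(4,5)
proof (induction k arbitrary: g)
  case 0
  then show ?case using continuous_on_compose2[OF _ _ assms(3)] by auto
next
  case (Suc k)
  let ?D = "\<lambda>x v. \<Sum>b\<in>Basis. (frechet_derivative f (at x) v \<bullet> b) *\<^sub>R frechet_derivative g (at (f x)) b"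
  have fk: "Ck_on k S f" by (rule Ck_on_SucD[OF Suc.prems(1)])
  show ?case
  proof (rule Ck_on_SucI[OF assms(1), of _ ?D])
    fix x assume x: "x \<in> S"
    have df: "(f has_derivative frechet_derivative f (at x)) (at x)"
      by (rule Ck_on_Suc_has_derivative[OF Suc.prems(1) x])
    have dg: "(g has_derivative frechet_derivative g (at (f x))) (at (f x))"
      by (rule Ck_on_Suc_has_derivative[OF Suc.prems(2)]) (use x assms(3) in auto)
    have lin: "linear (frechet_derivative g (at (f x)))"
      using dg has_derivative_linear by blast
    have "?D x = frechet_derivative g (at (f x)) \<circ> frechet_derivative f (at x)"
      by (rule ext) (simp only: o_apply linear_basis_expansion[OF lin, symmetric])
    then show "((\<lambda>x. g (f x)) has_derivative ?D x) (at x)"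
      using diff_chain_at[OF df dg] by (simp add: o_def)
  next
    fix v
    show "Ck_on k S (\<lambda>x. ?D x v)"
      by (intro Ck_on_sum Ck_on_scaleR Ck_on_bounded_linear[OF _ bounded_linear_inner_left] assms(1) Suc.IH)
        (use Suc.prems fk in auto)
  qed
qed

section \<open>Smooth functions\<close>

lemma smooth_on_cong:
  "open S \<Longrightarrow> (\<And>x. x \<in> S \<Longrightarrow> f x = g x) \<Longrightarrow> smooth_on S f \<longleftrightarrow> smooth_on S g"
  unfolding smooth_on_def using Ck_on_cong by blast

lemma smooth_on_subset: "smooth_on S f \<Longrightarrow> T \<subseteq> S \<Longrightarrow> smooth_on T f"
  unfolding smooth_on_def using Ck_on_subset by blast

lemma smooth_on_const: "smooth_on S (\<lambda>x. a)"
  by (simp add: smooth_on_def Ck_on_const)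

lemma smooth_on_add:
  "open S \<Longrightarrow> smooth_on S f \<Longrightarrow> smooth_on S g \<Longrightarrow> smooth_on S (\<lambda>x. f x + g x)"
  by (simp add: smooth_on_def Ck_on_add)

lemma smooth_on_scaleR:
  fixes h :: "'m::euclidean_space \<Rightarrow> real"
  shows "open S \<Longrightarrow> smooth_on S h \<Longrightarrow> smooth_on S f \<Longrightarrow> smooth_on S (\<lambda>x. h x *\<^sub>R f x)"
  by (simp add: smooth_on_def Ck_on_scaleR)

lemma smooth_on_sum:
  "open S \<Longrightarrow> (\<And>i. i \<in> I \<Longrightarrow> smooth_on S (f i)) \<Longrightarrow> smooth_on S (\<lambda>x. \<Sum>i\<in>I. f i x)"
  by (simp add: smooth_on_def Ck_on_sum)

lemma smooth_on_bounded_linear: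
  "open S \<Longrightarrow> bounded_linear L \<Longrightarrow> smooth_on S f \<Longrightarrow> smooth_on S (\<lambda>x. L (f x))"
  by (simp add: smooth_on_def Ck_on_bounded_linear)

lemma smooth_on_minus:
  assumes "open S" "smooth_on S f" "smooth_on S g"
  shows "smooth_on S (\<lambda>x. f x - g x)"
  using smooth_on_add[OF assms(1,2) smooth_on_bounded_linear[OF assms(1)
        bounded_linear_minus[OF bounded_linear_ident] assms(3)]] by simp

lemma smooth_on_compose:
  fixes f :: "'m::euclidean_space \<Rightarrow> 'p::euclidean_space"
  assumes "open S" "open T" "f ` S \<subseteq> T" "smooth_on S f" "smooth_on T g"
  shows "smooth_on S (\<lambda>x. g (f x))"
  using assms by (auto simp: smooth_on_def intro: Ck_on_compose)

lemma smooth_on_has_derivative: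
  "smooth_on S f \<Longrightarrow> x \<in> S \<Longrightarrow> (f has_derivative frechet_derivative f (at x)) (at x)"
  unfolding smooth_on_def by (meson Ck_on_Suc_has_derivative)

lemma smooth_on_differentiable: "smooth_on S f \<Longrightarrow> x \<in> S \<Longrightarrow> f differentiable (at x)"
  using smooth_on_has_derivative differentiable_def by blast

lemma smooth_on_frechet:
  "smooth_on S f \<Longrightarrow> smooth_on S (\<lambda>x. frechet_derivative f (at x) v)"
  unfolding smooth_on_def by (metis Ck_on.simps(2))

lemma smooth_on_continuous_on: "smooth_on S f \<Longrightarrow> continuous_on S f"
  using Ck_on_imp_continuous smooth_on_def by blast

lemma linear_frechet:
  "f differentiable (at x) \<Longrightarrow> linear (frechet_derivative f (at x))"
  using frechet_derivative_works has_derivative_linear by blast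

lemma smooth_on_frechet_apply:
  fixes f :: "'m::euclidean_space \<Rightarrow> 'e::real_normed_vector" and w :: "'m \<Rightarrow> 'm"
  assumes "open S" "smooth_on S f" "smooth_on S w"
  shows "smooth_on S (\<lambda>x. frechet_derivative f (at x) (w x))"
proof -
  have "smooth_on S (\<lambda>x. \<Sum>b\<in>Basis. (w x \<bullet> b) *\<^sub>R frechet_derivative f (at x) b)"
    by (intro smooth_on_sum smooth_on_scaleR smooth_on_frechet
        smooth_on_bounded_linear[OF _ bounded_linear_inner_left] assms)
  moreover have "frechet_derivative f (at x) (w x) = (\<Sum>b\<in>Basis. (w x \<bullet> b) *\<^sub>R frechet_derivative f (at x) b)"
    if "x \<in> S" for x
    by (rule linear_basis_expansion[OF linear_frechet[OF smooth_on_differentiable[OF assms(2) that]]])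
  ultimately show ?thesis by (subst smooth_on_cong[OF assms(1)]) auto
qed

text \<open>The mean value theorem is applied first in the direction \<open>u\<close>, to
  \<open>f (x + au + sv) - f (x + au)\<close>, and then to the resulting increment of the derivative in the
  direction \<open>v\<close>.\<close>

lemma second_difference_mean_value:
  fixes f :: "'m::euclidean_space \<Rightarrow> real"
  assumes S: "open S" "smooth_on S f" and s: "s > 0"
    and inS: "\<And>a b. 0 \<le> a \<Longrightarrow> a \<le> s \<Longrightarrow> 0 \<le> b \<Longrightarrow> b \<le> s \<Longrightarrow> x + a *\<^sub>R u + b *\<^sub>R v \<in> S"
  obtains a b where "0 \<le> a" "a \<le> s" "0 \<le> b" "b \<le> s"
    "f (x + s *\<^sub>R u + s *\<^sub>R v) - f (x + s *\<^sub>R u) - f (x + s *\<^sub>R v) + f x =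
     s^2 * frechet_derivative (\<lambda>y. frechet_derivative f (at y) u) (at (x + a *\<^sub>R u + b *\<^sub>R v)) v"
proof -
  let ?fu = "\<lambda>y. frechet_derivative f (at y) u"
  have df: "((\<lambda>a. f (x + a *\<^sub>R u + b *\<^sub>R v)) has_real_derivative ?fu (x + a *\<^sub>R u + b *\<^sub>R v)) (at a)"
    if ab: "0 \<le> a" "a \<le> s" "0 \<le> b" "b \<le> s" for a b
  proof -
    have D: "(f has_derivative frechet_derivative f (at (x + a *\<^sub>R u + b *\<^sub>R v))) (at (x + a *\<^sub>R u + b *\<^sub>R v))"
      by (rule smooth_on_has_derivative[OF S(2) inS[OF ab]])
    have I: "((\<lambda>a. x + a *\<^sub>R u + b *\<^sub>R v) has_derivative (\<lambda>h. h *\<^sub>R u)) (at a)"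
      by (auto intro!: derivative_eq_intros)
    have "((\<lambda>a. f (x + a *\<^sub>R u + b *\<^sub>R v)) has_derivative (\<lambda>h. frechet_derivative f (at (x + a *\<^sub>R u + b *\<^sub>R v)) (h *\<^sub>R u))) (at a)"
      using diff_chain_at[OF I D] by (simp add: o_def)
    then show ?thesis
      using linear_scale[OF has_derivative_linear[OF D]]
      by (simp add: has_field_derivative_def mult_commute_abs)
  qed
  have dfu: "((\<lambda>b. ?fu (x + a *\<^sub>R u + b *\<^sub>R v)) has_real_derivative
      frechet_derivative ?fu (at (x + a *\<^sub>R u + b *\<^sub>R v)) v) (at b)"
    if ab: "0 \<le> a" "a \<le> s" "0 \<le> b" "b \<le> s" for a b
  proof -
    have D: "(?fu has_derivative frechet_derivative ?fu (at (x + a *\<^sub>R u + b *\<^sub>R v))) (at (x + a *\<^sub>R u + b *\<^sub>R v))"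
      by (rule smooth_on_has_derivative[OF smooth_on_frechet[OF S(2)] inS[OF ab]])
    have I: "((\<lambda>b. x + a *\<^sub>R u + b *\<^sub>R v) has_derivative (\<lambda>h. h *\<^sub>R v)) (at b)"
      by (auto intro!: derivative_eq_intros)
    have "((\<lambda>b. ?fu (x + a *\<^sub>R u + b *\<^sub>R v)) has_derivative (\<lambda>h. frechet_derivative ?fu (at (x + a *\<^sub>R u + b *\<^sub>R v)) (h *\<^sub>R v))) (at b)"
      using diff_chain_at[OF I D] by (simp add: o_def)
    then show ?thesis
      using linear_scale[OF has_derivative_linear[OF D]]
      by (simp add: has_field_derivative_def mult_commute_abs)
  qed
  let ?G = "\<lambda>a. f (x + a *\<^sub>R u + s *\<^sub>R v) - f (x + a *\<^sub>R u + 0 *\<^sub>R v)"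
  have "\<exists>z. 0 < z \<and> z < s \<and> ?G s - ?G 0 = (s - 0) * (?fu (x + z *\<^sub>R u + s *\<^sub>R v) - ?fu (x + z *\<^sub>R u + 0 *\<^sub>R v))"
    by (rule MVT2[OF s]) (rule DERIV_diff; rule df; use s in auto)
  then obtain a where a: "0 < a" "a < s"
    "?G s - ?G 0 = s * (?fu (x + a *\<^sub>R u + s *\<^sub>R v) - ?fu (x + a *\<^sub>R u + 0 *\<^sub>R v))" by auto
  have "\<exists>z. 0 < z \<and> z < s \<and> ?fu (x + a *\<^sub>R u + s *\<^sub>R v) - ?fu (x + a *\<^sub>R u + 0 *\<^sub>R v) =
      (s - 0) * frechet_derivative ?fu (at (x + a *\<^sub>R u + z *\<^sub>R v)) v"
    by (rule MVT2[OF s]) (rule dfu; use a in auto)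
  then obtain b where b: "0 < b" "b < s"
    "?fu (x + a *\<^sub>R u + s *\<^sub>R v) - ?fu (x + a *\<^sub>R u + 0 *\<^sub>R v) = s * frechet_derivative ?fu (at (x + a *\<^sub>R u + b *\<^sub>R v)) v"
    by auto
  show thesis
    by (rule that[of a b]) (use a b in \<open>auto simp: power2_eq_square algebra_simps\<close>)
qed

text \<open>Schwarz's theorem.  The second difference
  \<open>f (x + su + sv) - f (x + su) - f (x + sv) + f x\<close> is symmetric in \<open>u\<close> and \<open>v\<close>, and by the mean
  value theorem it is \<open>s\<^sup>2\<close> times a value of either mixed second derivative near \<open>x\<close>.  By continuity
  the two mixed derivatives cannot differ at \<open>x\<close>.\<close>

lemma second_derivative_symmetric_real:
  fixes f :: "'m::euclidean_space \<Rightarrow> real"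
  assumes S: "open S" "smooth_on S f" and x: "x \<in> S"
  shows "frechet_derivative (\<lambda>y. frechet_derivative f (at y) u) (at x) v =
         frechet_derivative (\<lambda>y. frechet_derivative f (at y) v) (at x) u"
    (is "?A x = ?B x")
proof (rule ccontr)
  assume ne: "?A x \<noteq> ?B x"
  define e where "e = \<bar>?A x - ?B x\<bar> / 2"
  have e: "e > 0" using ne by (simp add: e_def)
  have cA: "continuous (at x) ?A" "continuous (at x) ?B"
    using smooth_on_continuous_on[OF smooth_on_frechet[OF smooth_on_frechet[OF S(2)]]] S(1) x
    by (auto simp: continuous_on_eq_continuous_at)
  obtain d1 where d1: "d1 > 0" "\<And>y. dist y x < d1 \<Longrightarrow> dist (?A y) (?A x) < e"
    using cA(1) e unfolding continuous_at_eps_delta dist_real_def dist_norm by auto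
  obtain d2 where d2: "d2 > 0" "\<And>y. dist y x < d2 \<Longrightarrow> dist (?B y) (?B x) < e"
    using cA(2) e unfolding continuous_at_eps_delta dist_real_def dist_norm by auto
  obtain d3 where d3: "d3 > 0" "ball x d3 \<subseteq> S" using S(1) x openE by blast
  define d where "d = min d1 (min d2 d3)"
  have d: "d > 0" using d1 d2 d3 by (simp add: d_def)
  define s where "s = d / (2 * (norm u + norm v + 1))"
  have nn: "norm u + norm v + 1 > 0"
    using norm_ge_zero[of u] norm_ge_zero[of v] by linarith
  have s: "s > 0" using d nn by (simp add: s_def)
  have near: "dist (x + a *\<^sub>R u + b *\<^sub>R v) x < d" "dist (x + b *\<^sub>R v + a *\<^sub>R u) x < d"
    if "0 \<le> a" "a \<le> s" "0 \<le> b" "b \<le> s" for a b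
  proof -
    have "norm (a *\<^sub>R u + b *\<^sub>R v) \<le> norm (a *\<^sub>R u) + norm (b *\<^sub>R v)" by (rule norm_triangle_ineq)
    also have "\<dots> \<le> s * norm u + s * norm v"
      using that by (auto intro!: add_mono mult_right_mono)
    also have "\<dots> \<le> s * (norm u + norm v + 1)" using s by (simp add: algebra_simps)
    also have "\<dots> = d / 2" using nn by (simp add: s_def field_simps)
    also have "\<dots> < d" using d by simp
    finally have "norm (a *\<^sub>R u + b *\<^sub>R v) < d" .
    then show "dist (x + a *\<^sub>R u + b *\<^sub>R v) x < d" "dist (x + b *\<^sub>R v + a *\<^sub>R u) x < d"
      by (simp_all add: dist_norm add.assoc) (simp add: add.commute)
  qed
  have inS: "y \<in> S" if "dist y x < d" for y
    using that d3 by (auto simp: d_def dist_commute)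
  obtain a b where ab: "0 \<le> a" "a \<le> s" "0 \<le> b" "b \<le> s"
    "f (x + s *\<^sub>R u + s *\<^sub>R v) - f (x + s *\<^sub>R u) - f (x + s *\<^sub>R v) + f x = s^2 * ?A (x + a *\<^sub>R u + b *\<^sub>R v)"
    by (rule second_difference_mean_value[OF S s inS[OF near(1)]])
  obtain a' b' where ab': "0 \<le> a'" "a' \<le> s" "0 \<le> b'" "b' \<le> s"
    "f (x + s *\<^sub>R v + s *\<^sub>R u) - f (x + s *\<^sub>R v) - f (x + s *\<^sub>R u) + f x = s^2 * ?B (x + a' *\<^sub>R v + b' *\<^sub>R u)"
    by (rule second_difference_mean_value[OF S s inS[OF near(2)]])
  have "s^2 * ?A (x + a *\<^sub>R u + b *\<^sub>R v) = s^2 * ?B (x + a' *\<^sub>R v + b' *\<^sub>R u)"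
    unfolding ab(5)[symmetric] ab'(5)[symmetric] by (simp add: algebra_simps)
  then have eq: "?A (x + a *\<^sub>R u + b *\<^sub>R v) = ?B (x + a' *\<^sub>R v + b' *\<^sub>R u)" using s by simp
  have "dist (?A (x + a *\<^sub>R u + b *\<^sub>R v)) (?A x) < e"
    using near(1)[OF ab(1-4)] d1 by (simp add: d_def)
  moreover have "dist (?B (x + a' *\<^sub>R v + b' *\<^sub>R u)) (?B x) < e"
    using near(2)[OF ab'(3,4) ab'(1,2)] d2 by (simp add: d_def)
  ultimately show False using eq by (simp add: e_def dist_real_def abs_if split: if_splits)
qed

lemma frechet_bounded_linear:
  assumes "bounded_linear L" "f differentiable (at x)"
  shows "frechet_derivative (\<lambda>y. L (f y)) (at x) v = L (frechet_derivative f (at x) v)"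
  using frechet_derivative_at[OF bounded_linear.has_derivative[OF assms(1)], of f] assms(2)
  by (metis frechet_derivative_works)

lemma frechet_cong_open:
  assumes "open S" "x \<in> S" "\<And>y. y \<in> S \<Longrightarrow> f y = g y"
  shows "frechet_derivative f (at x) = frechet_derivative g (at x)"
proof -
  have "(f has_derivative L) (at x) \<longleftrightarrow> (g has_derivative L) (at x)" for L
    using has_derivative_transform_within_open[of f L x UNIV S g]
      has_derivative_transform_within_open[of g L x UNIV S f] assms by auto
  then show ?thesis unfolding frechet_derivative_def by simp
qed

lemma second_derivative_symmetric:
  fixes f :: "'m::euclidean_space \<Rightarrow> 'e::euclidean_space"
  assumes S: "open S" "smooth_on S f" and x: "x \<in> S"
  shows "frechet_derivative (\<lambda>y. frechet_derivative f (at y) u) (at x) v =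
         frechet_derivative (\<lambda>y. frechet_derivative f (at y) v) (at x) u"
proof (rule euclidean_eqI)
  fix b :: 'e
  have 1: "frechet_derivative (\<lambda>y. frechet_derivative (\<lambda>z. f z \<bullet> b) (at y) u) (at x) v =
     frechet_derivative (\<lambda>y. frechet_derivative f (at y) u) (at x) v \<bullet> b" for u v
  proof -
    have "frechet_derivative (\<lambda>y. frechet_derivative (\<lambda>z. f z \<bullet> b) (at y) u) (at x) =
        frechet_derivative (\<lambda>y. frechet_derivative f (at y) u \<bullet> b) (at x)"
      by (rule frechet_cong_open[OF S(1) x])
        (simp add: frechet_bounded_linear[OF bounded_linear_inner_left] smooth_on_differentiable[OF S(2)])
    then show ?thesis
      by (simp add: frechet_bounded_linear[OF bounded_linear_inner_left]
          smooth_on_differentiable[OF smooth_on_frechet[OF S(2)] x])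
  qed
  show "frechet_derivative (\<lambda>y. frechet_derivative f (at y) u) (at x) v \<bullet> b =
         frechet_derivative (\<lambda>y. frechet_derivative f (at y) v) (at x) u \<bullet> b"
    using second_derivative_symmetric_real[OF S(1)
        smooth_on_bounded_linear[OF S(1) bounded_linear_inner_left S(2)] x, of b u v]
    by (simp add: 1)
qed

text \<open>Metrics and Christoffel symbols are bilinear maps that vary with the point.  The product rule for
  their values on two fields along a map follows by expanding both fields in a basis, since the
  components of the tensor are differentiable.\<close>

lemma has_derivative_tensor:
  fixes T :: "'y::euclidean_space \<Rightarrow> 'p::euclidean_space \<Rightarrow> 'q::euclidean_space \<Rightarrow> 'e::real_normed_vector"
    and F :: "'x::real_normed_vector \<Rightarrow> 'y"
  assumes Q: "open Q" "F x \<in> Q" and bil: "\<And>y. y \<in> Q \<Longrightarrow> bilinear (T y)"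
    and T: "\<And>u v. (\<lambda>y. T y u v) differentiable (at (F x))"
    and F: "(F has_derivative F') (at x)"
    and A: "(A has_derivative A') (at x)" and W: "(W has_derivative W') (at x)"
  shows "((\<lambda>x. T (F x) (A x) (W x)) has_derivative
     (\<lambda>h. frechet_derivative (\<lambda>y. T y (A x) (W x)) (at (F x)) (F' h)
         + T (F x) (A' h) (W x) + T (F x) (A x) (W' h))) (at x)"
proof -
  have expand: "T y a w = (\<Sum>i\<in>Basis. \<Sum>j\<in>Basis. (a \<bullet> i) *\<^sub>R (w \<bullet> j) *\<^sub>R T y i j)" if "y \<in> Q" for y a w
  proof -
    have l: "linear (\<lambda>a. T y a w)" "\<And>i. linear (T y i)" using bil[OF that] by (auto simp: bilinear_def)
    show ?thesis
      by (subst linear_basis_expansion[OF l(1)], subst linear_basis_expansion[OF l(2)])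
        (simp add: scaleR_sum_right)
  qed
  let ?T' = "\<lambda>i j. frechet_derivative (\<lambda>y. T y i j) (at (F x))"
  have Td: "((\<lambda>y. T y u v) has_derivative ?T' u v) (at (F x))" for u v
    using T frechet_derivative_works by blast
  have TF: "((\<lambda>x. T (F x) i j) has_derivative (\<lambda>h. ?T' i j (F' h))) (at x)" for i j
    using diff_chain_at[OF F Td] by (simp add: o_def)
  let ?S = "\<lambda>h. \<Sum>i\<in>Basis. \<Sum>j\<in>Basis. (A x \<bullet> i) *\<^sub>R ((W x \<bullet> j) *\<^sub>R ?T' i j (F' h) + (W' h \<bullet> j) *\<^sub>R T (F x) i j)
        + (A' h \<bullet> i) *\<^sub>R (W x \<bullet> j) *\<^sub>R T (F x) i j"
  have "((\<lambda>x. \<Sum>i\<in>Basis. \<Sum>j\<in>Basis. (A x \<bullet> i) *\<^sub>R (W x \<bullet> j) *\<^sub>R T (F x) i j) has_derivative ?S) (at x)"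
    by (intro has_derivative_sum has_derivative_scaleR has_derivative_inner_left A W TF)
  moreover have "\<exists>N. open N \<and> x \<in> N \<and> (\<forall>x'\<in>N. F x' \<in> Q)"
    by (rule continuous_at_open[THEN iffD1, OF has_derivative_continuous[OF F], rule_format, OF conjI[OF Q]])
  then obtain N where N: "open N" "x \<in> N" "\<And>x'. x' \<in> N \<Longrightarrow> F x' \<in> Q" by auto
  ultimately have D: "((\<lambda>x. T (F x) (A x) (W x)) has_derivative ?S) (at x)"
    by (elim has_derivative_transform_within_open[OF _ N(1,2)]) (rule expand[OF N(3), symmetric])
  have "((\<lambda>y. \<Sum>i\<in>Basis. \<Sum>j\<in>Basis. (A x \<bullet> i) *\<^sub>R (W x \<bullet> j) *\<^sub>R T y i j) has_derivative
      (\<lambda>h. \<Sum>i\<in>Basis. \<Sum>j\<in>Basis. (A x \<bullet> i) *\<^sub>R (W x \<bullet> j) *\<^sub>R ?T' i j h)) (at (F x))"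
    by (intro has_derivative_sum has_derivative_scaleR_right Td)
  then have "((\<lambda>y. T y (A x) (W x)) has_derivative
      (\<lambda>h. \<Sum>i\<in>Basis. \<Sum>j\<in>Basis. (A x \<bullet> i) *\<^sub>R (W x \<bullet> j) *\<^sub>R ?T' i j h)) (at (F x))"
    by (rule has_derivative_transform_within_open[OF _ Q]) (rule expand[symmetric])
  then have T'e: "frechet_derivative (\<lambda>y. T y (A x) (W x)) (at (F x)) =
      (\<lambda>h. \<Sum>i\<in>Basis. \<Sum>j\<in>Basis. (A x \<bullet> i) *\<^sub>R (W x \<bullet> j) *\<^sub>R ?T' i j h)"
    by (rule frechet_derivative_at[symmetric])
  have "?S h = frechet_derivative (\<lambda>y. T y (A x) (W x)) (at (F x)) (F' h)
         + T (F x) (A' h) (W x) + T (F x) (A x) (W' h)" for h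
    unfolding T'e
    by (subst expand[OF Q(2), of "A' h"], subst expand[OF Q(2), of "A x" "W' h"])
      (simp add: sum.distrib scaleR_add_right)
  then show ?thesis using D by simp
qed

section \<open>Forms satisfying the Gauss and Hessian equations\<close>

definition sym_form :: "('v::real_vector \<Rightarrow> 'v \<Rightarrow> real) \<Rightarrow> bool" where
  "sym_form b \<longleftrightarrow> bilinear b \<and> (\<forall>u v. b u v = b v u)"

lemma sym_formI:
  assumes "\<And>v. linear (\<lambda>u. b u v)" "\<And>u v. b u v = b v u"
  shows "sym_form b"
proof -
  have "b u = (\<lambda>v. b v u)" for u using assms(2) by auto
  then show ?thesis unfolding sym_form_def bilinear_def using assms by metis
qed

lemma linear_nontrivial_kernel:
  fixes L :: "'v::euclidean_space \<Rightarrow> 'w::euclidean_space"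
  assumes "linear L" "DIM('w) < DIM('v)"
  obtains y where "y \<noteq> 0" "L y = 0"
proof -
  have "\<not> inj L"
  proof
    assume "inj L"
    then have "dim (range L) = DIM('v)" using dim_image_eq[OF assms(1), of UNIV] by simp
    moreover have "dim (range L) \<le> DIM('w)" by (rule dim_subset_UNIV)
    ultimately show False using assms(2) by simp
  qed
  then show thesis using linear_injective_0[OF assms(1)] that by blast
qed

lemma form_eqs:
  assumes "sym_form b"
  shows "b (u + v) w = b u w + b v w" "b u (v + w) = b u v + b u w"
    "b (a *\<^sub>R u) w = a * b u w" "b u (a *\<^sub>R w) = a * b u w" 
    "b (u - v) w = b u w - b v w" "b u (v - w) = b u v - b u w"
  using assms by (auto simp: sym_form_def bilinear_ladd bilinear_radd bilinear_lmul bilinear_rmul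
      bilinear_lsub bilinear_rsub)

lemma form_sym: "sym_form b \<Longrightarrow> b u v = b v u"
  by (auto simp: sym_form_def)

lemma form_zero: "sym_form b \<Longrightarrow> b 0 v = 0" "sym_form b \<Longrightarrow> b v 0 = 0"
  by (auto simp: sym_form_def bilinear_lzero bilinear_rzero)

lemma exists_orthogonal:
  fixes b :: "'v::euclidean_space \<Rightarrow> 'v \<Rightarrow> real"
  assumes "sym_form b" "DIM('v) \<ge> 2"
  obtains y where "y \<noteq> 0" "b y z = 0"
proof (rule linear_nontrivial_kernel[of "\<lambda>y. b y z"])
  show "linear (\<lambda>y. b y z)" using assms(1) by (auto simp: sym_form_def bilinear_def)
qed (use assms(2) in auto)

lemma exists_orthogonal2:
  fixes b :: "'v::euclidean_space \<Rightarrow> 'v \<Rightarrow> real"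
  assumes "sym_form b" "DIM('v) \<ge> 3"
  obtains y where "y \<noteq> 0" "b y z = 0" "b y w = 0"
proof (rule linear_nontrivial_kernel[of "\<lambda>y. (b y z, b y w)"])
  have l: "linear (\<lambda>y. b y z)" for z using assms(1) by (auto simp: sym_form_def bilinear_def)
  show "linear (\<lambda>y. (b y z, b y w))"
    by (rule linearI) (simp_all add: linear_add[OF l] linear_scale[OF l])
qed (use assms(2) in \<open>auto simp: zero_prod_def\<close>)

text \<open>Below, \<open>m\<close> is the metric on a tangent space of the hypersurface.\<close>

context
  fixes m :: "'v::euclidean_space \<Rightarrow> 'v \<Rightarrow> real"
  assumes m: "sym_form m" and pos: "\<And>v. v \<noteq> 0 \<Longrightarrow> m v v > 0"
begin

text \<open>An endomorphism for which every vector is an eigenvector is a homothety: eigenvectors with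
  different eigenvalues would be orthogonal, and their sum could not be an eigenvector.\<close>

lemma form_multiple_of_metric:
  assumes b: "sym_form b" and eigen: "\<And>x. x \<noteq> 0 \<Longrightarrow> \<exists>l. \<forall>z. b x z = l * m x z"
  shows "\<exists>e. \<forall>x z. b x z = e * m x z"
proof -
  obtain l where l: "\<And>x z. x \<noteq> 0 \<Longrightarrow> b x z = l x * m x z" using eigen by metis
  have same: "l x = l z" if "x \<noteq> 0" "z \<noteq> 0" for x z
  proof (rule ccontr)
    assume ne: "l x \<noteq> l z"
    have "l x * m x z = l z * m x z"
      using l[OF that(1), of z] l[OF that(2), of x] form_sym[OF b] form_sym[OF m] by metis
    then have "m x z = 0" using ne by simp
    then have o: "m x z = 0" "m z x = 0" using form_sym[OF m] by metis+
    have nz: "x + z \<noteq> 0"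
    proof
      assume "x + z = 0"
      then have "m (x + z) z = 0" using form_zero[OF m] by simp
      then show False using o pos[OF that(2)] by (simp add: form_eqs[OF m])
    qed
    have "b x z = 0" "b z x = 0" using l that o by auto
    then have "l x * m x x = l (x + z) * m x x" "l z * m z z = l (x + z) * m z z"
      using l[OF nz, of x] l[OF nz, of z] l[OF that(1), of x] l[OF that(2), of z] o
      by (simp_all add: form_eqs[OF m] form_eqs[OF b])
    then show False using ne pos[OF that(1)] pos[OF that(2)] by simp
  qed
  obtain x0 :: 'v where "x0 \<noteq> 0" using nonempty_Basis nonzero_Basis by blast
  then have "b x z = l x0 * m x z" for x z
    using l[of x z] same[of x x0] form_zero[OF b] form_zero[OF m] by (cases "x = 0") auto
  then show ?thesis by blast
qed

text \<open>With respect to a unit normal, \<open>\<sigma>\<close> is the Riemannian second fundamental form and \<open>\<beta>\<close> is the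
  difference tensor of the two ambient connections on tangent vectors, so that \<open>\<sigma> + \<beta>\<close> is the second
  fundamental form of the statistical connection and \<open>\<sigma> - \<beta>\<close> that of the dual connection.\<close>

context
  fixes \<sigma> \<beta> :: "'v \<Rightarrow> 'v \<Rightarrow> real" and k c :: real
  assumes \<sigma>: "sym_form \<sigma>" and \<beta>: "sym_form \<beta>"
    and gauss: "\<And>u v w z. k * (m v w * m u z - m u w * m v z) =
      (\<sigma> v w + \<beta> v w) * (\<sigma> u z - \<beta> u z) - (\<sigma> u w + \<beta> u w) * (\<sigma> v z - \<beta> v z)"
    and hess: "\<And>u v w z. \<beta> v w * (\<beta> u z - \<sigma> u z) =
      - (c/2) * (m u v * m w z + m u w * m v z)
      + (\<sigma> u v + \<beta> u v) * \<beta> w z + (\<sigma> u w + \<beta> u w) * \<beta> v z"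
begin

lemma hess_anisotropic:
  assumes "c \<noteq> 0" "y \<noteq> 0" shows "\<beta> y y \<noteq> 0"
  using hess[of y y y y] pos[OF assms(2)] assms(1) by auto

text \<open>Up to the factor \<open>\<beta> y y\<close>, the Hessian equation gives \<open>\<sigma>\<close> and \<open>\<beta>\<close> on \<open>z\<close> in terms
  of \<open>m\<close> as soon as a vector \<open>y\<close> with \<open>\<beta> y z = 0\<close> is known.\<close>

lemma hess_conjugate:
  assumes "\<beta> y z = 0"
  shows "\<beta> y y * (\<beta> x z - \<sigma> x z) = - c * (m y z * m x y)"
    and "\<beta> y y * (\<beta> x z + \<sigma> x z) = c/2 * (m y z * m x y + m y y * m x z)"
    and "2 * (\<beta> y y * \<beta> x z) = c/2 * (m y y * m x z - m y z * m x y)"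
proof -
  show 1: "\<beta> y y * (\<beta> x z - \<sigma> x z) = - c * (m y z * m x y)"
    using hess[of y y x z] assms by (simp add: algebra_simps)
  have "\<beta> z y = 0" using assms form_sym[OF \<beta>, of y z] by simp
  then show 2: "\<beta> y y * (\<beta> x z + \<sigma> x z) = c/2 * (m y z * m x y + m y y * m x z)"
    using hess[of y z x y] form_sym[OF m, of z y] assms by (simp add: algebra_simps)
  show "2 * (\<beta> y y * \<beta> x z) = c/2 * (m y y * m x z - m y z * m x y)"
    using 1 2 by (simp add: algebra_simps)
qed

text \<open>The Hessian equation for \<open>(y, y, y, W)\<close> involves only values that the previous lemma
  expresses by \<open>m\<close>, up to the factors \<open>\<beta> y y\<close> and \<open>\<beta> z z\<close>.  Its part
  orthogonal to \<open>y\<close> reduces to the vanishing of \<open>(m y z)\<^sup>3\<close>.\<close>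

lemma hess_conjugate_orthogonal:
  assumes c: "c \<noteq> 0" and nz: "y \<noteq> 0" "z \<noteq> 0" and yz: "\<beta> y z = 0"
  shows "m y z = 0"
proof -
  have zy: "\<beta> z y = 0" using yz form_sym[OF \<beta>, of y z] by simp
  \<comment> \<open>a multiple of the component of \<open>z\<close> orthogonal to \<open>y\<close>\<close>
  define W where "W = m y y *\<^sub>R z - m y z *\<^sub>R y"
  let ?b = "\<beta> y y" and ?d = "\<beta> z z" and ?a = "m y z" and ?y = "m y y" and ?z = "m z z"
  have mzy: "m z y = ?a" by (rule form_sym[OF m])
  have Wy: "m W y = 0" "m y W = 0" and Wz: "m W z = ?y * ?z - ?a^2"
    by (simp_all add: W_def form_eqs[OF m] mzy power2_eq_square)
  have bd: "2 * (?b * ?d) = c/2 * (?y * ?z - ?a^2)"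
    using hess_conjugate(3)[OF yz, of z] by (simp add: mzy power2_eq_square)
  have bdnz: "?b * ?d \<noteq> 0" using hess_anisotropic[OF c] nz by simp
  then have Wz0: "m W z \<noteq> 0" using bd Wz by auto
  have h1: "?d * (\<beta> y W - \<sigma> y W) = - c * (?a * m W z)"
    using hess_conjugate(1)[OF zy, of W] form_sym[OF \<beta>, of W y] form_sym[OF \<sigma>, of W y] mzy by simp
  have h2: "?d * (?b + \<sigma> y y) = c/2 * (?a^2 + ?z * ?y)"
    using hess_conjugate(2)[OF zy, of y] mzy by (simp add: power2_eq_square)
  have h3: "2 * (?d * \<beta> y W) = c/2 * (- (?a * m W z))"
    using hess_conjugate(3)[OF zy, of W] form_sym[OF \<beta>, of W y] mzy Wy by simp
  have h4: "?b * (\<beta> y W - \<sigma> y W) = 2 * (?b + \<sigma> y y) * \<beta> y W"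
    using hess[of y y y W] Wy by (simp add: algebra_simps)
  have "(2 * (?b * ?d)) * (- c * (?a * m W z)) = (2 * (?b * ?d)) * (?d * (\<beta> y W - \<sigma> y W))"
    by (simp only: h1)
  also have "\<dots> = 2 * ?d^2 * (?b * (\<beta> y W - \<sigma> y W))" by (simp add: power2_eq_square)
  also have "\<dots> = 2 * (?d * (?b + \<sigma> y y)) * (2 * (?d * \<beta> y W))" 
    unfolding h4 by (simp add: power2_eq_square)
  also have "\<dots> = 2 * (c/2 * (?a^2 + ?z * ?y)) * (c/2 * (- (?a * m W z)))" by (simp only: h2 h3)
  finally have "c^2 * m W z * (?a * ((?y * ?z - ?a^2) - (?a^2 + ?z * ?y))) = 0"
    unfolding bd by (simp add: power2_eq_square algebra_simps)
  then have "?a * ((?y * ?z - ?a^2) - (?a^2 + ?z * ?y)) = 0" using c Wz0 by simp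
  then show ?thesis by (simp add: algebra_simps)
qed

text \<open>Every \<open>z\<close> has a \<open>\<beta>\<close>-conjugate \<open>y\<close>, which is orthogonal to it; the formulas for conjugate
  vectors then say that \<open>\<sigma>\<close> and \<open>\<beta>\<close> agree and that \<open>z\<close> is an eigenvector of \<open>\<beta>\<close>.  Since the Gauss
  equation has the factor \<open>\<sigma> - \<beta>\<close>, the hypersurface is flat.\<close>

lemma hess_nonzero:
  assumes c: "c \<noteq> 0" and dim: "DIM('v) \<ge> 2"
  shows "c > 0 \<and> k = 0 \<and> (\<exists>e. e^2 = c/4 \<and> (\<forall>u v. \<sigma> u v = e * m u v))"
proof -
  have ex: "\<sigma> z x = \<beta> z x \<and> (\<exists>l. \<forall>x. \<beta> z x = l * m z x)" if z: "z \<noteq> 0" for x z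
  proof -
    obtain y where y: "y \<noteq> 0" "\<beta> y z = 0" using exists_orthogonal[OF \<beta> dim] .
    note o = hess_conjugate_orthogonal[OF c y(1) z y(2)] and b = hess_anisotropic[OF c y(1)]
    have "\<beta> x z - \<sigma> x z = 0" using hess_conjugate(1)[OF y(2), of x] o b by simp
    moreover have "\<beta> x z = (c * m y y / (4 * \<beta> y y)) * m x z" for x
      using hess_conjugate(3)[OF y(2), of x] o b by (simp add: field_simps)
    ultimately show ?thesis
      using form_sym[OF \<beta>] form_sym[OF \<sigma>] form_sym[OF m] by (metis eq_iff_diff_eq_0)
  qed
  then have \<sigma>\<beta>: "\<sigma> z x = \<beta> z x" for z x
    using form_zero[OF \<sigma>] form_zero[OF \<beta>] by (cases "z = 0") auto
  obtain e where e: "\<And>x z. \<beta> x z = e * m x z"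
    using form_multiple_of_metric[OF \<beta>] ex by metis
  obtain x :: 'v where x: "x \<noteq> 0" using nonempty_Basis nonzero_Basis by blast
  have "(4 * e^2 - c) * (m x x)^2 = 0"
    using hess[of x x x x] unfolding \<sigma>\<beta> e by (simp add: power2_eq_square algebra_simps eq_commute[of c])
  then have ec: "e^2 = c/4" using pos[OF x] by simp
  then have "c > 0" using c zero_le_power2[of e] by linarith
  obtain y where y: "y \<noteq> 0" "m y x = 0" using exists_orthogonal[OF m dim] .
  have "k * (m x x * m y y) = 0" using gauss[of x x y y] by (simp add: \<sigma>\<beta> y(2))
  then have "k = 0" using pos[OF x] pos[OF y(1)] by simp
  then show ?thesis using \<open>c > 0\<close> ec e \<sigma>\<beta> by metis
qed

lemma gauss_nondegenerate:
  assumes k: "k \<noteq> 0" and dim: "DIM('v) \<ge> 2"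
  shows "(\<And>z. \<sigma> x z + \<beta> x z = 0) \<Longrightarrow> x = 0" "(\<And>z. \<sigma> x z - \<beta> x z = 0) \<Longrightarrow> x = 0"
proof -
  obtain u where u: "u \<noteq> 0" "m u x = 0" using exists_orthogonal[OF m dim] .
  have ux: "m x u = 0" using u form_sym[OF m] by metis
  show "x = 0" if "\<And>z. \<sigma> x z + \<beta> x z = 0"
  proof (rule ccontr)
    assume "x \<noteq> 0"
    have s: "\<sigma> u x + \<beta> u x = 0" using that[of u] form_sym[OF \<sigma>, of x u] form_sym[OF \<beta>, of x u] by simp
    have "k * (m x x * m u u) = 0" using gauss[of x x u u] that s u by simp
    then show False using k pos[OF u(1)] pos[OF \<open>x \<noteq> 0\<close>] by simp
  qed
  show "x = 0" if "\<And>z. \<sigma> x z - \<beta> x z = 0"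
  proof (rule ccontr)
    assume "x \<noteq> 0"
    have s: "\<sigma> u x - \<beta> u x = 0" using that[of u] form_sym[OF \<sigma>, of x u] form_sym[OF \<beta>, of x u] by simp
    have "k * (m u u * m x x) = 0" using gauss[of x u u x] that s u ux by simp
    then show False using k pos[OF u(1)] pos[OF \<open>x \<noteq> 0\<close>] by simp
  qed
qed

text \<open>In dimension at least three there is, for orthogonal \<open>x\<close> and \<open>z\<close>, a third vector \<open>y\<close>
  orthogonal to both, and the Gauss equation with nondegenerate \<open>\<sigma> - \<beta>\<close> forces \<open>(\<sigma> + \<beta>) x z = 0\<close>.
  Hence \<open>\<sigma> + \<beta>\<close> is a nonzero multiple of \<open>m\<close>.  The Hessian equation then leaves no room for \<open>\<beta>\<close>, and
  the Gauss equation becomes that of a sphere.\<close>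

lemma gauss_nonneg:
  assumes c: "c = 0" and k: "k \<noteq> 0" and dim: "DIM('v) \<ge> 3"
  shows "k > 0"
proof -
  have dim2: "DIM('v) \<ge> 2" using dim by simp
  let ?p = "\<lambda>x z. \<sigma> x z + \<beta> x z"
  have p: "sym_form ?p"
    unfolding sym_form_def bilinear_def linear_iff
    using form_eqs[OF \<sigma>] form_eqs[OF \<beta>] form_sym[OF \<sigma>] form_sym[OF \<beta>] by (simp add: algebra_simps)
  have orth: "?p x z = 0" if xz: "m x z = 0" for x z
  proof -
    obtain y where y: "y \<noteq> 0" "m y x = 0" "m y z = 0" using exists_orthogonal2[OF m dim] .
    have "?p y z *\<^sub>R x - ?p x z *\<^sub>R y = 0"
    proof (rule gauss_nondegenerate(2)[OF k dim2])
      fix w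
      show "\<sigma> (?p y z *\<^sub>R x - ?p x z *\<^sub>R y) w - \<beta> (?p y z *\<^sub>R x - ?p x z *\<^sub>R y) w = 0"
        using gauss[of y z x w] xz y by (simp add: form_eqs[OF \<sigma>] form_eqs[OF \<beta>] algebra_simps)
    qed
    then have "m (?p y z *\<^sub>R x - ?p x z *\<^sub>R y) y = 0" using form_zero[OF m] by simp
    then have "?p x z * m y y = 0" using y form_sym[OF m, of x y] by (simp add: form_eqs[OF m])
    then show ?thesis using pos[OF y(1)] by simp
  qed
  have "\<exists>l. \<forall>z. ?p x z = l * m x z" if x: "x \<noteq> 0" for x
  proof (intro exI allI)
    fix z
    have xx: "m x x > 0" by (rule pos[OF x])
    have "m x (m x x *\<^sub>R z - m x z *\<^sub>R x) = 0" by (simp add: form_eqs[OF m])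
    from orth[OF this] have "m x x * ?p x z = m x z * ?p x x"
      by (simp add: form_eqs[OF \<sigma>] form_eqs[OF \<beta>] algebra_simps)
    then show "?p x z = (?p x x / m x x) * m x z" using xx by (simp add: field_simps)
  qed
  then obtain e where e: "\<And>x z. ?p x z = e * m x z" using form_multiple_of_metric[OF p] by metis
  obtain x0 :: 'v where x0: "x0 \<noteq> 0" using nonempty_Basis nonzero_Basis by blast
  have e0: "e \<noteq> 0" using gauss_nondegenerate(1)[OF k dim2, of x0] x0 e by auto
  have \<beta>0: "\<beta> y z = 0" for y z
  proof (cases "y = 0")
    case True then show ?thesis using form_zero[OF \<beta>] by simp
  next
    case False
    obtain u where u: "u \<noteq> 0" "m u y = 0" using exists_orthogonal[OF m dim2] .
    have "\<beta> y y * (\<sigma> u w - \<beta> u w) = 0" for w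
      using hess[of y y u w] unfolding e[of u y] u(2) c by auto
    then have yy: "\<beta> y y = 0" using gauss_nondegenerate(2)[OF k dim2, of u] u(1) by auto
    have "2 * (e * m y y) * \<beta> y z = 0" using hess[of y y y z] c e[of y y] yy by (auto simp: algebra_simps)
    then show ?thesis using e0 pos[OF False] by simp
  qed
  obtain y where y: "y \<noteq> 0" "m y x0 = 0" using exists_orthogonal[OF m dim2] .
  have s: "\<sigma> x z = e * m x z" for x z using e[of x z] \<beta>0 by simp
  have "k * (m x0 x0 * m y y) = e^2 * (m x0 x0 * m y y)"
    using gauss[of x0 x0 y y] \<beta>0 s y by (simp add: power2_eq_square algebra_simps)
  then have "k = e^2" using pos[OF y(1)] pos[OF x0] by simp
  then show ?thesis using e0 by simp
qed

lemma gauss_hess_conclusion: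
  assumes "DIM('v) \<ge> 2" "DIM('v) = 2 \<Longrightarrow> c \<noteq> 0"
  shows "2 * k + c \<ge> 0 \<and>
    (c > 0 \<longrightarrow> (\<exists>e. (e = 1/2 * sqrt (2 * k + c) \<or> e = - (1/2 * sqrt (2 * k + c))) \<and> (\<forall>u v. \<sigma> u v = e * m u v)))"
proof (cases "c = 0")
  case True
  then have "k \<ge> 0" using gauss_nonneg assms by (cases "k = 0") force+
  then show ?thesis using True by simp
next
  case False
  from hess_nonzero[OF this assms(1)] obtain e where e: "c > 0" "k = 0" "e^2 = c/4" "\<And>u v. \<sigma> u v = e * m u v"
    by blast
  have "(1/2 * sqrt c)^2 = e^2" using e(1,3) by (simp add: power_mult_distrib power_divide)
  then have "e = 1/2 * sqrt (2 * k + c) \<or> e = - (1/2 * sqrt (2 * k + c))"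
    using e(2) by (auto simp: power2_eq_iff)
  then show ?thesis using e by auto
qed

end
end

section \<open>Normal vectors of a hyperplane\<close>

text \<open>A dimension count: the image of \<open>T\<close> and \<open>n\<close> together span the ambient space.\<close>

lemma normal_line:
  fixes b :: "'n::euclidean_space \<Rightarrow> 'n \<Rightarrow> real" and T :: "'m::euclidean_space \<Rightarrow> 'n"
  assumes b: "sym_form b" and pos: "\<And>v. v \<noteq> 0 \<Longrightarrow> b v v > 0"
    and T: "linear T" "inj T" and dim: "DIM('n) = DIM('m) + 1"
    and n: "b n n = 1" "\<And>u. b n (T u) = 0" and N: "\<And>u. b N (T u) = 0"
  shows "N = b N n *\<^sub>R n"
proof -
  define L where "L = (\<lambda>p::'m \<times> real. T (fst p) + snd p *\<^sub>R n)"
  have L: "linear L"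
    unfolding L_def by (rule linearI)
      (simp_all add: linear_add[OF T(1)] linear_scale[OF T(1)] algebra_simps)
  have "p = 0" if "L p = 0" for p
  proof -
    have 0: "T (fst p) + snd p *\<^sub>R n = 0" using that by (simp add: L_def)
    then have "b n (T (fst p) + snd p *\<^sub>R n) = 0" using form_zero[OF b] by metis
    then have s: "snd p = 0" using n by (simp add: form_eqs[OF b])
    then have "fst p = 0" using 0 linear_injective_0[OF T(1)] T(2) by simp
    then show ?thesis using s by (simp add: prod_eq_iff)
  qed
  then have "inj L" using linear_injective_0[OF L] by blast
  then have "surj L"
    using linear_injective_imp_surjective[OF L] dim by simp
  then obtain p where p: "N = T (fst p) + snd p *\<^sub>R n"
    unfolding surj_def L_def by blast
  have "b N (T (fst p)) = b (T (fst p)) (T (fst p))"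
    using n by (simp add: p form_eqs[OF b])
  then have "T (fst p) = 0" using N pos by (metis less_irrefl)
  then show ?thesis using n p by (simp add: form_eqs[OF b])
qed

lemma unit_normal_exists:
  fixes b :: "'n::euclidean_space \<Rightarrow> 'n \<Rightarrow> real" and T :: "'m::euclidean_space \<Rightarrow> 'n"
  assumes b: "sym_form b" and pos: "\<And>v. v \<noteq> 0 \<Longrightarrow> b v v > 0"
    and T: "linear T" and dim: "DIM('n) = DIM('m) + 1"
  obtains n where "b n n = 1" "\<And>u. b n (T u) = 0"
proof -
  have "linear (\<lambda>a. \<Sum>i\<in>Basis. b a (T i) *\<^sub>R i)"
    by (rule linearI)
      (simp_all add: form_eqs[OF b] scaleR_add_left sum.distrib scaleR_sum_right)
  then obtain y where y: "y \<noteq> 0" "(\<Sum>i\<in>Basis. b y (T i) *\<^sub>R i) = 0"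
    by (rule linear_nontrivial_kernel) (use dim in auto)
  have Ti: "b y (T i) = 0" if "i \<in> Basis" for i
    using arg_cong[OF y(2), of "\<lambda>z. z \<bullet> i"] that by (simp add: inner_sum_left_Basis)
  have l: "linear (\<lambda>u. b y (T u))"
    by (rule linearI) (simp_all add: form_eqs[OF b] linear_add[OF T] linear_scale[OF T])
  have Tu: "b y (T u) = 0" for u
    by (subst linear_basis_expansion[OF l]) (simp add: Ti)
  let ?r = "1 / sqrt (b y y)"
  have "b (?r *\<^sub>R y) (?r *\<^sub>R y) = 1"
    using pos[OF y(1)] by (simp add: form_eqs[OF b])
  moreover have "b (?r *\<^sub>R y) (T u) = 0" for u by (simp add: form_eqs[OF b] Tu)
  ultimately show thesis using that by blast
qed

section \<open>Statistical hypersurfaces in coordinates\<close>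

lemma has_derivative_frechet_field:
  fixes F :: "'m::euclidean_space \<Rightarrow> 'n::real_normed_vector"
  assumes V: "open V" "smooth_on V F" "x \<in> V" and A: "(A has_derivative A') (at x)"
  shows "((\<lambda>x. frechet_derivative F (at x) (A x)) has_derivative
    (\<lambda>h. frechet_derivative (\<lambda>y. frechet_derivative F (at y) (A x)) (at x) h
       + frechet_derivative F (at x) (A' h))) (at x)"
proof -
  \<comment> \<open>the scalar argument makes the linear maps \<open>D F\<close> an instance of the bilinear product rule\<close>
  let ?T = "\<lambda>y u s::real. s *\<^sub>R frechet_derivative F (at y) u"
  have "((\<lambda>x. ?T (id x) (A x) 1) has_derivative
    (\<lambda>h. frechet_derivative (\<lambda>y. ?T y (A x) 1) (at (id x)) (id h)
       + ?T (id x) (A' h) 1 + ?T (id x) (A x) 0)) (at x)"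
  proof (rule has_derivative_tensor[OF V(1)])
    fix y assume "y \<in> V"
    then have "linear (frechet_derivative F (at y))"
      using linear_frechet smooth_on_differentiable V(2) by blast
    then show "bilinear (?T y)"
      by (auto simp: bilinear_def linear_iff algebra_simps)
  next
    show "(\<lambda>y. ?T y u s) differentiable at (id x)" for u s
      using smooth_on_differentiable[OF smooth_on_frechet[OF V(2)] V(3), of u]
      by (auto intro: differentiable_scaleR)
  qed (use V A in \<open>auto simp: id_def\<close>)
  then show ?thesis by simp
qed

lemma derivative_zero_on_open:
  fixes f :: "'m::real_normed_vector \<Rightarrow> real"
  assumes "open U" "x \<in> U" "\<And>y. y \<in> U \<Longrightarrow> f y = 0" "(f has_derivative f') (at x)"
  shows "f' h = 0"
proof -
  have "((\<lambda>x. 0) has_derivative f') (at x)"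
    by (rule has_derivative_transform_within_open[OF assms(4,1,2)]) (use assms(3) in auto)
  then show ?thesis using has_derivative_unique[OF _ has_derivative_const] by metis
qed

text \<open>The statistical immersion between two coordinate domains: \<open>F\<close> is the immersion, \<open>gm\<close> and \<open>gt\<close>
  are the metrics, and \<open>Gm\<close>, \<open>Gt\<close>, \<open>Go\<close> are the Christoffel symbols of the connection of the
  hypersurface, of the flat ambient connection and of the ambient Levi-Civita connection.  Each
  geometric hypothesis is evaluated on coordinate fields.\<close>

locale local_hypersurface =
  fixes V :: "'m::euclidean_space set" and Q :: "'n::euclidean_space set" and F :: "'m \<Rightarrow> 'n"
    and gm :: "'m \<Rightarrow> 'm \<Rightarrow> 'm \<Rightarrow> real" and Gm :: "'m \<Rightarrow> 'm \<Rightarrow> 'm \<Rightarrow> 'm"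
    and gt :: "'n \<Rightarrow> 'n \<Rightarrow> 'n \<Rightarrow> real" and Gt Go :: "'n \<Rightarrow> 'n \<Rightarrow> 'n \<Rightarrow> 'n"
    and k c :: real
  assumes V: "open V" and Q: "open Q" and FV: "\<And>x. x \<in> V \<Longrightarrow> F x \<in> Q" and F: "smooth_on V F"
    and inj: "\<And>x. x \<in> V \<Longrightarrow> inj (frechet_derivative F (at x))"
    and gm: "\<And>x. x \<in> V \<Longrightarrow> sym_form (gm x)" and gm_pos: "\<And>x v. x \<in> V \<Longrightarrow> v \<noteq> 0 \<Longrightarrow> gm x v v > 0"
    and gt: "\<And>y. y \<in> Q \<Longrightarrow> sym_form (gt y)" and gt_pos: "\<And>y a. y \<in> Q \<Longrightarrow> a \<noteq> 0 \<Longrightarrow> gt y a a > 0"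
    and gt_smooth: "\<And>a b. smooth_on Q (\<lambda>y. gt y a b)"
    and Gm: "\<And>x. x \<in> V \<Longrightarrow> bilinear (Gm x)" and Gt: "\<And>y. y \<in> Q \<Longrightarrow> bilinear (Gt y)"
    and Go: "\<And>y. y \<in> Q \<Longrightarrow> bilinear (Go y)"
    and Gm_sym: "\<And>x u v. x \<in> V \<Longrightarrow> Gm x u v = Gm x v u"
    and Gt_sym: "\<And>y a b. y \<in> Q \<Longrightarrow> Gt y a b = Gt y b a"
    and Go_sym: "\<And>y a b. y \<in> Q \<Longrightarrow> Go y a b = Go y b a"
    and Gm_smooth: "\<And>u v. smooth_on V (\<lambda>x. Gm x u v)"
    and Gt_smooth: "\<And>a b. smooth_on Q (\<lambda>y. Gt y a b)"
    and Go_smooth: "\<And>a b. smooth_on Q (\<lambda>y. Go y a b)"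
    and gm_metric: "\<And>x u v w. x \<in> V \<Longrightarrow>
      frechet_derivative (\<lambda>x. gm x v w) (at x) u = gm x (Gm x u v) w + gm x v (Gm x u w)"
    and gt_metric: "\<And>y a b d. y \<in> Q \<Longrightarrow>
      frechet_derivative (\<lambda>y. gt y b d) (at y) a = gt y (Go y a b) d + gt y b (Go y a d)"
    and codazzi: "\<And>y a b d. y \<in> Q \<Longrightarrow>
      frechet_derivative (\<lambda>y. gt y b d) (at y) a - gt y (Gt y a b) d - gt y b (Gt y a d) =
      frechet_derivative (\<lambda>y. gt y a d) (at y) b - gt y (Gt y b a) d - gt y a (Gt y b d)"
    and curvature_m: "\<And>x u v w. x \<in> V \<Longrightarrow>
      (frechet_derivative (\<lambda>x. Gm x v w) (at x) u + Gm x u (Gm x v w))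
      - (frechet_derivative (\<lambda>x. Gm x u w) (at x) v + Gm x v (Gm x u w)) =
      k *\<^sub>R (gm x v w *\<^sub>R u - gm x u w *\<^sub>R v)"
    and flat: "\<And>y a b d. y \<in> Q \<Longrightarrow>
      frechet_derivative (\<lambda>y. Gt y b d) (at y) a + Gt y a (Gt y b d) =
      frechet_derivative (\<lambda>y. Gt y a d) (at y) b + Gt y b (Gt y a d)"
    and hessian: "\<And>y a b d. y \<in> Q \<Longrightarrow>
      frechet_derivative (\<lambda>y. Gt y b d - Go y b d) (at y) a + Gt y a (Gt y b d - Go y b d)
      - (Gt y (Gt y a b) d - Go y (Gt y a b) d) - (Gt y b (Gt y a d) - Go y b (Gt y a d)) =
      (- (c/2)) *\<^sub>R (gt y a b *\<^sub>R d + gt y a d *\<^sub>R b)"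
    and isometric: "\<And>x u v. x \<in> V \<Longrightarrow>
      gm x u v = gt (F x) (frechet_derivative F (at x) u) (frechet_derivative F (at x) v)"
    and statistical: "\<And>x u v w. x \<in> V \<Longrightarrow> gm x (Gm x u v) w =
      gt (F x) (frechet_derivative (\<lambda>x. frechet_derivative F (at x) v) (at x) u
          + Gt (F x) (frechet_derivative F (at x) u) (frechet_derivative F (at x) v))
        (frechet_derivative F (at x) w)"
begin

definition T :: "'m \<Rightarrow> 'm \<Rightarrow> 'n" where "T x = frechet_derivative F (at x)"
definition F2 :: "'m \<Rightarrow> 'm \<Rightarrow> 'm \<Rightarrow> 'n" where
  "F2 x u v = frechet_derivative (\<lambda>x. T x v) (at x) u"
definition K :: "'n \<Rightarrow> 'n \<Rightarrow> 'n \<Rightarrow> 'n" where "K y a b = Gt y a b - Go y a b"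

text \<open>\<open>II\<close> is the second fundamental form of \<open>F\<close> for the ambient Levi-Civita connection and \<open>hh\<close>
  the one for the flat ambient connection; both will turn out to be normal to \<open>F\<close>.\<close>

definition II :: "'m \<Rightarrow> 'm \<Rightarrow> 'm \<Rightarrow> 'n" where
  "II x u v = F2 x u v + Go (F x) (T x u) (T x v) - T x (Gm x u v)"
definition hh :: "'m \<Rightarrow> 'm \<Rightarrow> 'm \<Rightarrow> 'n" where
  "hh x u v = F2 x u v + Gt (F x) (T x u) (T x v) - T x (Gm x u v)"

lemma hh_II: "hh x u v = II x u v + K (F x) (T x u) (T x v)"
  by (simp add: hh_def II_def K_def)

lemma T_linear: "x \<in> V \<Longrightarrow> linear (T x)"
  unfolding T_def by (rule linear_frechet[OF smooth_on_differentiable[OF F]])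

lemma T_smooth: "smooth_on V (\<lambda>x. T x u)"
  unfolding T_def by (rule smooth_on_frechet[OF F])

lemma F_der: "x \<in> V \<Longrightarrow> (F has_derivative T x) (at x)"
  unfolding T_def by (rule smooth_on_has_derivative[OF F])

lemma T_der: "x \<in> V \<Longrightarrow> ((\<lambda>x. T x v) has_derivative (\<lambda>u. F2 x u v)) (at x)"
  using smooth_on_has_derivative[OF T_smooth, of x v] by (simp add: F2_def)

lemma T_field_der:
  "x \<in> V \<Longrightarrow> (A has_derivative A') (at x) \<Longrightarrow>
    ((\<lambda>x. T x (A x)) has_derivative (\<lambda>h. F2 x h (A x) + T x (A' h))) (at x)"
  using has_derivative_frechet_field[OF V F] by (simp add: T_def F2_def)

lemma F2_smooth: "smooth_on V (\<lambda>x. F2 x u v)"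
  unfolding F2_def by (rule smooth_on_frechet[OF T_smooth])

lemma F2_sym: "x \<in> V \<Longrightarrow> F2 x u v = F2 x v u"
  unfolding F2_def T_def using second_derivative_symmetric[OF V F] by blast

lemma F2_linear: "x \<in> V \<Longrightarrow> linear (\<lambda>u. F2 x u v)"
  using T_der has_derivative_linear by blast

lemma F3_sym:
  "x \<in> V \<Longrightarrow> frechet_derivative (\<lambda>x. F2 x v w) (at x) u = frechet_derivative (\<lambda>x. F2 x u w) (at x) v"
  unfolding F2_def using second_derivative_symmetric[OF V T_smooth] by blast

lemma isometric_T: "x \<in> V \<Longrightarrow> gt (F x) (T x u) (T x v) = gm x u v"
  using isometric by (simp add: T_def)

lemma statistical_T: "x \<in> V \<Longrightarrow>
    gt (F x) (F2 x u v + Gt (F x) (T x u) (T x v)) (T x w) = gm x (Gm x u v) w"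
  using statistical by (simp add: T_def F2_def)

lemmas gt_eqs = form_eqs[OF gt[OF FV]]

lemma K_bilinear: "y \<in> Q \<Longrightarrow> bilinear (K y)"
  using Gt[of y] Go[of y] unfolding K_def bilinear_def by (auto intro: linear_compose_sub)

lemma K_sym: "y \<in> Q \<Longrightarrow> K y a b = K y b a"
  using Gt_sym Go_sym by (simp add: K_def)

lemma K_smooth: "smooth_on Q (\<lambda>y. K y a b)"
  unfolding K_def by (rule smooth_on_minus[OF Q Gt_smooth Go_smooth])

text \<open>As the Levi-Civita terms drop out of the Codazzi equation, that equation says that the cubic
  form \<open>gt y (K y a b) d\<close> is totally symmetric.\<close>

lemma K_metric_sym:
  assumes y: "y \<in> Q"
  shows "gt y (K y a b) d = gt y (K y a d) b"
proof -
  note s = form_sym[OF gt[OF y]] and e = form_eqs[OF gt[OF y]]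
  have *: "gt y b (K y a d) = gt y a (K y b d)" for a b d
    using codazzi[OF y, where a=a and b=b and d=d] Gt_sym[OF y, of a b] Go_sym[OF y, of a b]
    unfolding gt_metric[OF y] K_def e by simp
  have "gt y (K y a b) d = gt y d (K y b a)" using s K_sym[OF y] by metis
  also have "\<dots> = gt y b (K y d a)" by (rule *)
  also have "\<dots> = gt y (K y a d) b" using s K_sym[OF y] by metis
  finally show ?thesis .
qed

lemma metric_along:
  assumes x: "x \<in> V" and A: "(A has_derivative A') (at x)" and W: "(W has_derivative W') (at x)"
  shows "((\<lambda>x. gt (F x) (A x) (W x)) has_derivative
    (\<lambda>h. gt (F x) (A' h + Go (F x) (T x h) (A x)) (W x)
       + gt (F x) (A x) (W' h + Go (F x) (T x h) (W x)))) (at x)"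
proof -
  have "((\<lambda>x. gt (F x) (A x) (W x)) has_derivative
     (\<lambda>h. frechet_derivative (\<lambda>y. gt y (A x) (W x)) (at (F x)) (T x h)
         + gt (F x) (A' h) (W x) + gt (F x) (A x) (W' h))) (at x)"
    by (rule has_derivative_tensor[where Q=Q, OF Q FV[OF x] _ _ F_der[OF x] A W])
      (use gt smooth_on_differentiable[OF gt_smooth FV[OF x]] in \<open>auto simp: sym_form_def\<close>)
  then show ?thesis by (simp add: gt_metric[OF FV[OF x]] gt_eqs[OF x] algebra_simps)
qed

text \<open>The connection of the hypersurface is metric, and so is the tangential part of the ambient
  Levi-Civita connection.  Their difference, the tangential part of \<open>K\<close>, is therefore skew in its
  last two arguments; being totally symmetric as well, it vanishes.\<close>

lemma K_tangential:
  assumes x: "x \<in> V"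
  shows "gt (F x) (K (F x) (T x u) (T x v)) (T x w) = 0"
proof -
  let ?h = "\<lambda>h. gt (F x) (F2 x h v + Go (F x) (T x h) (T x v)) (T x w)
       + gt (F x) (T x v) (F2 x h w + Go (F x) (T x h) (T x w))"
  have "((\<lambda>x. gm x v w) has_derivative ?h) (at x)"
    by (rule has_derivative_transform_within_open[OF metric_along[OF x T_der[OF x] T_der[OF x]] V x])
      (rule isometric_T)
  then have h: "?h = frechet_derivative (\<lambda>x. gm x v w) (at x)" by (rule frechet_derivative_at)
  have "?h u = gm x (Gm x u v) w + gm x v (Gm x u w)"
    using fun_cong[OF h, of u] by (simp only: gm_metric[OF x])
  also have "\<dots> = gt (F x) (F2 x u v + Gt (F x) (T x u) (T x v)) (T x w)
      + gt (F x) (F2 x u w + Gt (F x) (T x u) (T x w)) (T x v)"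
    using form_sym[OF gm[OF x], of v] statistical_T[OF x] by simp
  finally have "gt (F x) (K (F x) (T x u) (T x v)) (T x w) + gt (F x) (K (F x) (T x u) (T x w)) (T x v) = 0"
    using form_sym[OF gt[OF FV[OF x]], of "T x v"] by (simp add: K_def gt_eqs[OF x])
  then show ?thesis using K_metric_sym[OF FV[OF x]] by simp
qed

lemma hh_normal: assumes x: "x \<in> V" shows "gt (F x) (hh x u v) (T x w) = 0"
  using statistical_T[OF x, of u v w] isometric_T[OF x, of "Gm x u v" w]
  by (simp add: hh_def gt_eqs[OF x])

lemma II_smooth: "smooth_on V (\<lambda>x. II x u v) \<and> smooth_on V (\<lambda>x. hh x u v)"
proof -
  have FQ: "F ` V \<subseteq> Q" using FV by blast
  have G: "smooth_on V (\<lambda>x. G (F x) (T x u) (T x v))"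
    if bil: "\<And>y. y \<in> Q \<Longrightarrow> bilinear (G y)" and sm: "\<And>a b. smooth_on Q (\<lambda>y. G y a b)" for G :: "'n \<Rightarrow> 'n \<Rightarrow> 'n \<Rightarrow> 'n"
  proof -
    have "smooth_on V (\<lambda>x. \<Sum>i\<in>Basis. \<Sum>j\<in>Basis. (T x u \<bullet> i) *\<^sub>R (T x v \<bullet> j) *\<^sub>R G (F x) i j)"
      by (intro smooth_on_sum smooth_on_scaleR V smooth_on_bounded_linear[OF _ bounded_linear_inner_left]
          T_smooth smooth_on_compose[OF V Q FQ F sm])
    moreover have "G (F x) (T x u) (T x v) = (\<Sum>i\<in>Basis. \<Sum>j\<in>Basis. (T x u \<bullet> i) *\<^sub>R (T x v \<bullet> j) *\<^sub>R G (F x) i j)"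
      if "x \<in> V" for x
    proof -
      have l: "linear (\<lambda>a. G (F x) a (T x v))" "\<And>i. linear (G (F x) i)"
        using bil[OF FV[OF that]] by (auto simp: bilinear_def)
      show ?thesis
        by (subst linear_basis_expansion[OF l(1)], subst linear_basis_expansion[OF l(2)])
          (simp add: scaleR_sum_right)
    qed
    ultimately show ?thesis by (subst smooth_on_cong[OF V]) auto
  qed
  have Tg: "smooth_on V (\<lambda>x. T x (Gm x u v))"
    unfolding T_def by (rule smooth_on_frechet_apply[OF V F Gm_smooth])
  show ?thesis unfolding II_def hh_def
    using G[OF Go Go_smooth] G[OF Gt Gt_smooth] Tg F2_smooth
    by (intro conjI smooth_on_minus smooth_on_add V)
qed

text \<open>Differentiating the orthogonality of \<open>N\<close> and \<open>T w\<close> gives the first formula.  In the second one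
  the flat connection enters, whose dual connection has second fundamental form \<open>II - K\<close>.\<close>

lemma weingarten:
  assumes U: "open U" "U \<subseteq> V" and x: "x \<in> U" and N: "(N has_derivative N') (at x)"
    and normal: "\<And>x w. x \<in> U \<Longrightarrow> gt (F x) (N x) (T x w) = 0"
  shows "gt (F x) (N' u + Go (F x) (T x u) (N x)) (T x w) = - gt (F x) (N x) (II x u w)"
    and "gt (F x) (N' u + Gt (F x) (T x u) (N x)) (T x w) =
      gt (F x) (N x) (K (F x) (T x u) (T x w) - II x u w)"
proof -
  have xV: "x \<in> V" using U x by auto
  have "gt (F x) (N' u + Go (F x) (T x u) (N x)) (T x w)
       + gt (F x) (N x) (F2 x u w + Go (F x) (T x u) (T x w)) = 0"
    by (rule derivative_zero_on_open[OF U(1) x normal metric_along[OF xV N T_der[OF xV]]])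
  moreover have "gt (F x) (N x) (T x (Gm x u w)) = 0" by (rule normal[OF x])
  ultimately show 1: "gt (F x) (N' u + Go (F x) (T x u) (N x)) (T x w) = - gt (F x) (N x) (II x u w)"
    by (simp add: II_def gt_eqs[OF xV])
  have "gt (F x) (K (F x) (T x u) (N x)) (T x w) = gt (F x) (N x) (K (F x) (T x u) (T x w))"
    using K_metric_sym[OF FV[OF xV]] form_sym[OF gt[OF FV[OF xV]]] by metis
  then show "gt (F x) (N' u + Gt (F x) (T x u) (N x)) (T x w) =
      gt (F x) (N x) (K (F x) (T x u) (T x w) - II x u w)"
    using 1 by (simp add: K_def gt_eqs[OF xV])
qed

lemma statistical_der:
  assumes x: "x \<in> V"
  shows "((\<lambda>x. F2 x v w + Gt (F x) (T x v) (T x w)) has_derivative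
     (\<lambda>u. frechet_derivative (\<lambda>x. F2 x v w) (at x) u
        + (frechet_derivative (\<lambda>y. Gt y (T x v) (T x w)) (at (F x)) (T x u)
        + Gt (F x) (F2 x u v) (T x w) + Gt (F x) (T x v) (F2 x u w)))) (at x)"
  by (intro has_derivative_add smooth_on_has_derivative[OF F2_smooth x]
      has_derivative_tensor[where Q=Q, OF Q FV[OF x] _ _ F_der[OF x] T_der[OF x] T_der[OF x]] Gt
      smooth_on_differentiable[OF Gt_smooth FV[OF x]])

text \<open>The covariant derivative \<open>C u v\<close>, in the direction \<open>u\<close>, of the derivative of \<open>T w\<close> in the
  direction \<open>v\<close> is symmetric in \<open>u\<close> and \<open>v\<close>, because the ambient connection is flat.  The Gauss
  equation compares the tangential parts of \<open>C u v\<close> and \<open>C v u\<close>.\<close>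

lemma gauss_equation:
  assumes x: "x \<in> V"
  shows "k * (gm x v w * gm x u z - gm x u w * gm x v z) =
    gt (F x) (hh x v w) (II x u z - K (F x) (T x u) (T x z))
    - gt (F x) (hh x u w) (II x v z - K (F x) (T x v) (T x z))"
proof -
  let ?y = "F x"
  note y = FV[OF x]
  define S where "S v w = F2 x v w + Gt ?y (T x v) (T x w)" for v w
  define S' where "S' v w u = frechet_derivative (\<lambda>x. F2 x v w) (at x) u
        + (frechet_derivative (\<lambda>y. Gt y (T x v) (T x w)) (at ?y) (T x u)
        + Gt ?y (F2 x u v) (T x w) + Gt ?y (T x v) (F2 x u w))" for v w u
  define C where "C u v = S' v w u + Gt ?y (T x u) (S v w)" for u v
  have radd: "Gt ?y a (b + d) = Gt ?y a b + Gt ?y a d" for a b d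
    using Gt[OF y] by (simp add: bilinear_radd)
  have C_sym: "C u v = C v u" for u v
    using F3_sym[OF x, of v w u] F2_sym[OF x, of u v] flat[OF y, of "T x v" "T x w" "T x u"]
    unfolding C_def S'_def S_def radd by (simp add: algebra_simps)
  have tang: "gt ?y (C u v) (T x z) =
      gm x (frechet_derivative (\<lambda>x. Gm x v w) (at x) u + Gm x u (Gm x v w)) z
      + gt ?y (hh x v w) (K ?y (T x u) (T x z) - II x u z)" for u v
  proof -
    let ?G = "frechet_derivative (\<lambda>x. Gm x v w) (at x)"
    have TG: "((\<lambda>x. T x (Gm x v w)) has_derivative (\<lambda>u. F2 x u (Gm x v w) + T x (?G u))) (at x)"
      by (rule T_field_der[OF x smooth_on_has_derivative[OF Gm_smooth x]])
    have hd: "((\<lambda>x. hh x v w) has_derivative (\<lambda>u. S' v w u - (F2 x u (Gm x v w) + T x (?G u)))) (at x)"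
      unfolding hh_def S'_def by (rule has_derivative_diff[OF statistical_der[OF x] TG])
    have S: "S v w = hh x v w + T x (Gm x v w)" by (simp add: S_def hh_def)
    have "gt ?y (S' v w u - (F2 x u (Gm x v w) + T x (?G u)) + Gt ?y (T x u) (hh x v w)) (T x z)
      = gt ?y (hh x v w) (K ?y (T x u) (T x z) - II x u z)"
      by (rule weingarten(2)[OF V order_refl x hd hh_normal])
    moreover have "C u v = (S' v w u - (F2 x u (Gm x v w) + T x (?G u)) + Gt ?y (T x u) (hh x v w))
        + (F2 x u (Gm x v w) + Gt ?y (T x u) (T x (Gm x v w))) + T x (?G u)"
      by (simp add: C_def S radd)
    ultimately show ?thesis
      using statistical_T[OF x, of u "Gm x v w" z] isometric_T[OF x, of "?G u" z]
      by (simp only: form_eqs(1)[OF gt[OF y]] form_eqs(1)[OF gm[OF x]])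
  qed
  have "gm x (k *\<^sub>R (gm x v w *\<^sub>R u - gm x u w *\<^sub>R v)) z
      + gt ?y (hh x v w) (K ?y (T x u) (T x z) - II x u z)
      - gt ?y (hh x u w) (K ?y (T x v) (T x z) - II x v z) = 0"
    using tang[of u v] tang[of v u] C_sym[of u v]
    unfolding curvature_m[OF x, of v w u, symmetric] form_eqs[OF gm[OF x]] by simp
  then show ?thesis by (simp add: form_eqs[OF gm[OF x]] gt_eqs[OF x] algebra_simps)
qed

text \<open>On tangent vectors \<open>K\<close> has normal values, so that the tangential part of its covariant
  derivative is given by the Weingarten formula.  In this way the condition on the Hessian curvature,
  which contains a derivative of \<open>K\<close>, becomes an algebraic equation between second fundamental
  forms.\<close>

lemma hessian_equation:
  assumes x: "x \<in> V"
  shows "gt (F x) (K (F x) (T x v) (T x w)) (K (F x) (T x u) (T x z) - II x u z) =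
    - (c/2) * (gm x u v * gm x w z + gm x u w * gm x v z)
    + gt (F x) (hh x u v) (K (F x) (T x w) (T x z)) + gt (F x) (hh x u w) (K (F x) (T x v) (T x z))"
proof -
  let ?y = "F x" and ?t = "T x"
  note y = FV[OF x]
  let ?K' = "frechet_derivative (\<lambda>y. K y (?t v) (?t w)) (at ?y) (?t u)"
  have N: "((\<lambda>x. K (F x) (T x v) (T x w)) has_derivative
    (\<lambda>u. frechet_derivative (\<lambda>y. K y (?t v) (?t w)) (at ?y) (?t u)
       + K ?y (F2 x u v) (?t w) + K ?y (?t v) (F2 x u w))) (at x)"
    by (intro has_derivative_tensor[where Q=Q, OF Q y _ _ F_der[OF x] T_der[OF x] T_der[OF x]] K_bilinear
      smooth_on_differentiable[OF K_smooth y])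
  have W: "gt ?y (?K' + K ?y (F2 x u v) (?t w) + K ?y (?t v) (F2 x u w) + Gt ?y (?t u) (K ?y (?t v) (?t w))) (?t z)
    = gt ?y (K ?y (?t v) (?t w)) (K ?y (?t u) (?t z) - II x u z)"
    by (rule weingarten(2)[OF V order_refl x N K_tangential])
  have H: "?K' + Gt ?y (?t u) (K ?y (?t v) (?t w)) - K ?y (Gt ?y (?t u) (?t v)) (?t w)
      - K ?y (?t v) (Gt ?y (?t u) (?t w)) =
      (- (c/2)) *\<^sub>R (gt ?y (?t u) (?t v) *\<^sub>R ?t w + gt ?y (?t u) (?t w) *\<^sub>R ?t v)"
    using hessian[OF y, of "?t v" "?t w" "?t u"] by (simp add: K_def)
  have S: "F2 x u v = hh x u v + T x (Gm x u v) - Gt ?y (?t u) (?t v)" for u v by (simp add: hh_def)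
  have Kl: "K ?y (a + b) d = K ?y a d + K ?y b d" "K ?y (a - b) d = K ?y a d - K ?y b d"
    "K ?y d (a + b) = K ?y d a + K ?y d b" "K ?y d (a - b) = K ?y d a - K ?y d b" for a b d
    using K_bilinear[OF y]
    by (simp_all add: bilinear_ladd bilinear_radd bilinear_lsub bilinear_rsub)
  have A: "?K' + K ?y (F2 x u v) (?t w) + K ?y (?t v) (F2 x u w) + Gt ?y (?t u) (K ?y (?t v) (?t w)) =
     (- (c/2)) *\<^sub>R (gt ?y (?t u) (?t v) *\<^sub>R ?t w + gt ?y (?t u) (?t w) *\<^sub>R ?t v)
     + K ?y (hh x u v) (?t w) + K ?y (?t (Gm x u v)) (?t w)
     + K ?y (?t v) (hh x u w) + K ?y (?t v) (?t (Gm x u w))"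
    unfolding H[symmetric] S Kl by (simp add: algebra_simps)
  have "gt ?y (K ?y (hh x u v) (?t w)) (?t z) = gt ?y (hh x u v) (K ?y (?t w) (?t z))"
    "gt ?y (K ?y (?t v) (hh x u w)) (?t z) = gt ?y (hh x u w) (K ?y (?t v) (?t z))"
    using K_metric_sym[OF y] K_sym[OF y] form_sym[OF gt[OF y]] by metis+
  then show ?thesis
    using W[unfolded A] K_tangential[OF x] isometric_T[OF x]
    by (simp add: form_eqs[OF gt[OF y]] algebra_simps)
qed

context
  fixes x n
  assumes x: "x \<in> V" and dim: "DIM('n) = DIM('m) + 1"
    and n: "gt (F x) n n = 1" "\<And>u. gt (F x) n (T x u) = 0"
begin

lemma normal_multiple: "(\<And>u. gt (F x) N (T x u) = 0) \<Longrightarrow> N = gt (F x) N n *\<^sub>R n"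
  using normal_line[OF gt[OF FV[OF x]] gt_pos[OF FV[OF x]] T_linear[OF x] _ dim n] inj[OF x]
  by (simp add: T_def)

lemma normal_product:
  assumes "\<And>u. gt (F x) N (T x u) = 0"
  shows "gt (F x) N N' = gt (F x) N n * gt (F x) N' n"
proof -
  have "gt (F x) N N' = gt (F x) (gt (F x) N n *\<^sub>R n) N'" using normal_multiple[OF assms] by simp
  then show ?thesis using form_sym[OF gt[OF FV[OF x]], of n N'] by (simp only: gt_eqs[OF x])
qed

lemma II_form: "sym_form (\<lambda>u v. gt (F x) (II x u v) n)"
proof -
  have l: "linear (\<lambda>u. gt (F x) (II x u v) n)" for v
    unfolding II_def
    using bilinear_ladd[OF Go[OF FV[OF x]]] bilinear_lmul[OF Go[OF FV[OF x]]]
      bilinear_ladd[OF Gm[OF x]] bilinear_lmul[OF Gm[OF x]]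
    by (intro linearI)
      (simp_all add: linear_add[OF F2_linear[OF x]] linear_scale[OF F2_linear[OF x]]
        linear_add[OF T_linear[OF x]] linear_scale[OF T_linear[OF x]] gt_eqs[OF x] algebra_simps)
  have s: "II x u v = II x v u" for u v
    using F2_sym[OF x] Go_sym[OF FV[OF x]] Gm_sym[OF x] unfolding II_def by metis
  show ?thesis by (rule sym_formI[OF l]) (simp only: s)
qed

lemma K_form: "sym_form (\<lambda>u v. gt (F x) (K (F x) (T x u) (T x v)) n)"
proof -
  have l: "linear (\<lambda>u. gt (F x) (K (F x) (T x u) (T x v)) n)" for v
    using bilinear_ladd[OF K_bilinear[OF FV[OF x]]] bilinear_lmul[OF K_bilinear[OF FV[OF x]]]
    by (intro linearI)
      (simp_all add: linear_add[OF T_linear[OF x]] linear_scale[OF T_linear[OF x]] gt_eqs[OF x])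
  show ?thesis by (rule sym_formI[OF l]) (simp only: K_sym[OF FV[OF x]])
qed

lemma second_fundamental_form:
  assumes "DIM('m) \<ge> 2" "DIM('m) = 2 \<Longrightarrow> c \<noteq> 0"
  shows "2 * k + c \<ge> 0 \<and> (c > 0 \<longrightarrow>
     (\<exists>e. (e = 1/2 * sqrt (2 * k + c) \<or> e = - (1/2 * sqrt (2 * k + c))) \<and>
       (\<forall>u v. gt (F x) (II x u v) n = e * gm x u v)))"
proof (rule gauss_hess_conclusion[OF gm[OF x] gm_pos[OF x] II_form K_form _ _ assms])
  note e = gt_eqs[OF x]
  show "k * (gm x v w * gm x u z - gm x u w * gm x v z) =
      (gt (F x) (II x v w) n + gt (F x) (K (F x) (T x v) (T x w)) n)
        * (gt (F x) (II x u z) n - gt (F x) (K (F x) (T x u) (T x z)) n)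
      - (gt (F x) (II x u w) n + gt (F x) (K (F x) (T x u) (T x w)) n)
        * (gt (F x) (II x v z) n - gt (F x) (K (F x) (T x v) (T x z)) n)" for u v w z
    using gauss_equation[OF x, of v w u z]
      normal_product[OF hh_normal[OF x], of v w "II x u z - K (F x) (T x u) (T x z)"]
      normal_product[OF hh_normal[OF x], of u w "II x v z - K (F x) (T x v) (T x z)"]
    by (simp only: hh_II e)
  show "gt (F x) (K (F x) (T x v) (T x w)) n
      * (gt (F x) (K (F x) (T x u) (T x z)) n - gt (F x) (II x u z) n) =
      - (c / 2) * (gm x u v * gm x w z + gm x u w * gm x v z)
      + (gt (F x) (II x u v) n + gt (F x) (K (F x) (T x u) (T x v)) n) * gt (F x) (K (F x) (T x w) (T x z)) n
      + (gt (F x) (II x u w) n + gt (F x) (K (F x) (T x u) (T x w)) n) * gt (F x) (K (F x) (T x v) (T x z)) n"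
    for u v w z
    using hessian_equation[OF x, of v w u z]
      normal_product[OF hh_normal[OF x], of u v "K (F x) (T x w) (T x z)"]
      normal_product[OF hh_normal[OF x], of u w "K (F x) (T x v) (T x z)"]
      normal_product[OF K_tangential[OF x], of v w "K (F x) (T x u) (T x z) - II x u z"]
    by (simp only: hh_II e)
qed

end

text \<open>The derivative of a unit normal field is tangential, and the Weingarten formula determines its
  tangential part.\<close>

lemma shape_operator_coordinates:
  assumes U: "open U" "U \<subseteq> V" and x: "x \<in> U" and dim: "DIM('n) = DIM('m) + 1"
    and \<xi>: "(\<xi> has_derivative \<xi>') (at x)"
    and unit: "\<And>x. x \<in> U \<Longrightarrow> gt (F x) (\<xi> x) (\<xi> x) = 1"
    and normal: "\<And>x w. x \<in> U \<Longrightarrow> gt (F x) (\<xi> x) (T x w) = 0"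
    and e: "\<And>u v. gt (F x) (II x u v) (\<xi> x) = e * gm x u v"
  shows "\<xi>' u + Go (F x) (T x u) (\<xi> x) = - (e *\<^sub>R T x u)"
proof -
  have xV: "x \<in> V" using U x by auto
  note s = form_sym[OF gt[OF FV[OF xV]]]
  let ?Z = "\<xi>' u + Go (F x) (T x u) (\<xi> x) + e *\<^sub>R T x u"
  have "gt (F x) ?Z (T x w) = 0" for w
    using weingarten(1)[OF U x \<xi> normal, of u w] e[of u w] s[of "\<xi> x" "II x u w"] isometric_T[OF xV, of u w]
    by (simp add: gt_eqs[OF xV])
  then have Z: "?Z = gt (F x) ?Z (\<xi> x) *\<^sub>R \<xi> x"
    by (rule normal_multiple[OF xV dim unit[OF x] normal[OF x]])
  have "((\<lambda>x. gt (F x) (\<xi> x) (\<xi> x) - 1) has_derivative (\<lambda>h. gt (F x) (\<xi>' h + Go (F x) (T x h) (\<xi> x)) (\<xi> x)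
       + gt (F x) (\<xi> x) (\<xi>' h + Go (F x) (T x h) (\<xi> x)) - 0)) (at x)"
    by (intro has_derivative_diff metric_along[OF xV \<xi> \<xi>] has_derivative_const)
  from derivative_zero_on_open[OF U(1) x _ this, of u]
  have "gt (F x) (\<xi>' u + Go (F x) (T x u) (\<xi> x)) (\<xi> x) = 0"
    using unit s[of "\<xi> x" "\<xi>' u + Go (F x) (T x u) (\<xi> x)"] by simp
  then have "gt (F x) ?Z (\<xi> x) = 0"
    using normal[OF x, of u] s[of "\<xi> x" "T x u"] by (simp add: gt_eqs[OF xV])
  then have "?Z = 0" using Z by simp
  then show ?thesis by (simp add: eq_neg_iff_add_eq_0)
qed

end

section \<open>Charts and tangent vectors\<close>

locale smooth_manifold =
  fixes A :: "('a::topological_space, 'm::euclidean_space) chart set"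
  assumes atlas: "smooth_atlas A"
begin

lemma chart_at: "chart_at A p \<in> A" "p \<in> cdom (chart_at A p)"
proof -
  have "\<exists>c. c \<in> A \<and> p \<in> cdom c" using atlas unfolding smooth_atlas_def by blast
  from someI_ex[OF this] show "chart_at A p \<in> A" "p \<in> cdom (chart_at A p)"
    unfolding chart_at_def by auto
qed

context fixes c assumes c: "c \<in> A"
begin

lemma chart: "is_chart c"
  using c atlas by (auto simp: smooth_atlas_def)

lemma open_cdom: "open (cdom c)"
  using chart by (auto simp: is_chart_def)

lemma cinv_in: "x \<in> cmap c ` cdom c \<Longrightarrow> cinv c x \<in> cdom c"
  unfolding cinv_def by (rule inv_into_into)

lemma cmap_cinv: "x \<in> cmap c ` cdom c \<Longrightarrow> cmap c (cinv c x) = x"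
  unfolding cinv_def by (rule f_inv_into_f)

lemma cinv_cmap: "p \<in> cdom c \<Longrightarrow> cinv c (cmap c p) = p"
  using chart by (auto simp: is_chart_def homeomorphism_def)

lemma image_chart: "cmap c ` (U \<inter> cdom c) = cmap c ` cdom c \<inter> cinv c -` U"
  by (auto simp: cinv_cmap)

lemma open_image_chart: "open U \<Longrightarrow> open (cmap c ` (U \<inter> cdom c))"
  unfolding image_chart
  by (rule continuous_open_preimage) (use chart in \<open>auto simp: is_chart_def homeomorphism_def\<close>)

lemma open_chart_image: "open (cmap c ` cdom c)"
  using chart by (auto simp: is_chart_def)

lemma open_preimage_chart: "open W \<Longrightarrow> open (cdom c \<inter> cmap c -` W)"
  by (rule continuous_open_preimage) (use chart in \<open>auto simp: is_chart_def homeomorphism_def\<close>)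

end

lemma transition_smooth:
  "c \<in> A \<Longrightarrow> d \<in> A \<Longrightarrow> smooth_on (cmap c ` (cdom d \<inter> cdom c)) (cmap d \<circ> cinv c)"
  using atlas by (auto simp: smooth_atlas_def Int_commute)

lemma transition_der:
  assumes "c \<in> A" "d \<in> A" "p \<in> cdom c" "p \<in> cdom d"
  shows "((cmap d \<circ> cinv c) has_derivative frechet_derivative (cmap d \<circ> cinv c) (at (cmap c p))) (at (cmap c p))"
  by (rule smooth_on_has_derivative[OF transition_smooth]) (use assms in auto)

lemma transition_linear:
  assumes "c \<in> A" "d \<in> A" "p \<in> cdom c" "p \<in> cdom d"
  shows "linear (frechet_derivative (cmap d \<circ> cinv c) (at (cmap c p)))"
  using transition_der[OF assms] has_derivative_linear by blast

text \<open>The independence of charts of directional derivatives and of push-forwards and the consistency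
  of transition maps are all instances of the following chain rule.\<close>

lemma chart_change:
  fixes h :: "'a \<Rightarrow> 'e::real_normed_vector"
  assumes cd: "c \<in> A" "d \<in> A" "p \<in> cdom c" "p \<in> cdom d"
    and h: "(h \<circ> cinv d) differentiable (at (cmap d p))"
  shows "((h \<circ> cinv c) has_derivative
     (\<lambda>u. frechet_derivative (h \<circ> cinv d) (at (cmap d p)) (frechet_derivative (cmap d \<circ> cinv c) (at (cmap c p)) u)))
     (at (cmap c p))"
proof -
  let ?y = "cmap c p"
  have y: "(cmap d \<circ> cinv c) ?y = cmap d p" using cd by (simp add: cinv_cmap)
  have "((h \<circ> cinv d) has_derivative frechet_derivative (h \<circ> cinv d) (at (cmap d p))) (at ((cmap d \<circ> cinv c) ?y))"
    unfolding y using h frechet_derivative_works by blast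
  from diff_chain_at[OF transition_der[OF cd] this]
  have "((\<lambda>x. h (cinv d (cmap d (cinv c x)))) has_derivative
     (\<lambda>u. frechet_derivative (h \<circ> cinv d) (at (cmap d p)) (frechet_derivative (cmap d \<circ> cinv c) (at (cmap c p)) u)))
     (at ?y)" by (simp add: o_def)
  then show ?thesis
  proof (rule has_derivative_transform_within_open)
    show "open (cmap c ` (cdom d \<inter> cdom c))" by (rule open_image_chart[OF cd(1) open_cdom[OF cd(2)]])
    show "h (cinv d (cmap d (cinv c x))) = (h \<circ> cinv c) x" if "x \<in> cmap c ` (cdom d \<inter> cdom c)" for x
      using that cd by (auto simp: cinv_cmap)
  qed (use cd in auto)
qed

lemma transition_cocycle:
  assumes "c \<in> A" "d \<in> A" "e \<in> A" "p \<in> cdom c" "p \<in> cdom d" "p \<in> cdom e"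
  shows "frechet_derivative (cmap e \<circ> cinv c) (at (cmap c p)) u =
    frechet_derivative (cmap e \<circ> cinv d) (at (cmap d p)) (frechet_derivative (cmap d \<circ> cinv c) (at (cmap c p)) u)"
proof -
  have "(cmap e \<circ> cinv d) differentiable (at (cmap d p))"
    using transition_der[of d e p] assms differentiable_def by blast
  from frechet_derivative_at[OF chart_change[OF assms(1,2,4,5) this]] show ?thesis by metis
qed

lemma transition_self:
  assumes "c \<in> A" "p \<in> cdom c"
  shows "frechet_derivative (cmap c \<circ> cinv c) (at (cmap c p)) u = u"
proof -
  have "((cmap c \<circ> cinv c) has_derivative (\<lambda>u. u)) (at (cmap c p))"
    by (rule has_derivative_transform_within_open[OF has_derivative_ident open_chart_image[OF assms(1)]])
      (use assms cmap_cinv in auto)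
  then show ?thesis using frechet_derivative_at by metis
qed

lemma dderiv_chart:
  assumes "c \<in> A" "p \<in> cdom c" "v \<in> tangent_space A p"
    and h: "(h \<circ> cinv c) differentiable (at (cmap c p))"
  shows "dderiv A p v h = frechet_derivative (h \<circ> cinv c) (at (cmap c p)) (v c)"
proof -
  let ?d = "chart_at A p"
  note d = chart_at[of p]
  have "frechet_derivative (h \<circ> cinv ?d) (at (cmap ?d p)) =
    (\<lambda>u. frechet_derivative (h \<circ> cinv c) (at (cmap c p)) (frechet_derivative (cmap c \<circ> cinv ?d) (at (cmap ?d p)) u))"
    by (rule frechet_derivative_at[OF chart_change[OF d(1) assms(1) d(2) assms(2) h], symmetric])
  moreover have "v c = frechet_derivative (cmap c \<circ> cinv ?d) (at (cmap ?d p)) (v ?d)"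
    using assms(1-3) d unfolding tangent_space_def by blast
  ultimately show ?thesis by (simp add: dderiv_def Let_def)
qed

lemma tangentD:
  "v \<in> tangent_space A p \<Longrightarrow> c \<in> A \<Longrightarrow> d \<in> A \<Longrightarrow> p \<in> cdom c \<Longrightarrow> p \<in> cdom d \<Longrightarrow>
    v d = frechet_derivative (cmap d \<circ> cinv c) (at (cmap c p)) (v c)"
  unfolding tangent_space_def by blast

lemma tangent_outside: "v \<in> tangent_space A p \<Longrightarrow> \<not> (c \<in> A \<and> p \<in> cdom c) \<Longrightarrow> v c = 0"
  unfolding tangent_space_def by blast

lemma tangent_eqI:
  assumes "v \<in> tangent_space A p" "w \<in> tangent_space A p" "c \<in> A" "p \<in> cdom c" "v c = w c"
  shows "v = w"
proof
  fix d
  show "v d = w d"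
  proof (cases "d \<in> A \<and> p \<in> cdom d")
    case True
    then show ?thesis using tangentD[OF assms(1,3)] tangentD[OF assms(2,3)] assms(4,5) by metis
  next
    case False
    then show ?thesis using tangent_outside assms(1,2) by metis
  qed
qed

lemma tangent_space_lin:
  assumes "v \<in> tangent_space A p" "w \<in> tangent_space A p"
  shows "a *\<^sub>T v + b *\<^sub>T w \<in> tangent_space A p"
  unfolding tangent_space_def mem_Collect_eq
proof (intro conjI ballI impI allI)
  fix c d assume cd: "c \<in> A" "d \<in> A" "p \<in> cdom c \<inter> cdom d"
  then have l: "linear (frechet_derivative (cmap d \<circ> cinv c) (at (cmap c p)))"
    using transition_linear by blast
  have "v d = frechet_derivative (cmap d \<circ> cinv c) (at (cmap c p)) (v c)"
    "w d = frechet_derivative (cmap d \<circ> cinv c) (at (cmap c p)) (w c)"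
    using tangentD[of _ p c d] assms cd by auto
  then show "(a *\<^sub>T v + b *\<^sub>T w) d = frechet_derivative (cmap d \<circ> cinv c) (at (cmap c p)) ((a *\<^sub>T v + b *\<^sub>T w) c)"
    by (simp add: vscale_def linear_add[OF l] linear_scale[OF l])
next
  fix c assume "\<not> (c \<in> A \<and> p \<in> cdom c)"
  then show "(a *\<^sub>T v + b *\<^sub>T w) c = 0"
    using tangent_outside[OF assms(1)] tangent_outside[OF assms(2)] by (simp add: vscale_def)
qed

lemma vscale_simps:
  "1 *\<^sub>T v = (v :: ('a, 'm) tvec)" "0 *\<^sub>T v = (0 :: ('a, 'm) tvec)" "(a *\<^sub>T v) c = a *\<^sub>R v c"
  "(-1) *\<^sub>T v = (- v :: ('a, 'm) tvec)"
  by (auto simp: vscale_def)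

lemma tangent_space_add: "v \<in> tangent_space A p \<Longrightarrow> w \<in> tangent_space A p \<Longrightarrow> v + w \<in> tangent_space A p"
  using tangent_space_lin[of v p w 1 1] by (simp add: vscale_simps)

lemma tangent_space_scale: "v \<in> tangent_space A p \<Longrightarrow> a *\<^sub>T v \<in> tangent_space A p"
  using tangent_space_lin[of v p v a 0] by (simp add: vscale_simps)

lemma tangent_space_diff: "v \<in> tangent_space A p \<Longrightarrow> w \<in> tangent_space A p \<Longrightarrow> v - w \<in> tangent_space A p"
  using tangent_space_lin[of v p w 1 "-1"] by (simp add: vscale_simps)

lemma tangent_space_0: "0 \<in> tangent_space A p"
proof -
  have "(0::('a, 'm) tvec) d = frechet_derivative (cmap d \<circ> cinv c) (at (cmap c p)) (0 c)"
    if "c \<in> A" "d \<in> A" "p \<in> cdom c \<inter> cdom d" for c d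
    using transition_linear[of c d p] that by (simp add: linear_0)
  then show ?thesis unfolding tangent_space_def by auto
qed

lemma tangent_space_sum:
  "(\<And>i. i \<in> I \<Longrightarrow> v i \<in> tangent_space A p) \<Longrightarrow> (\<Sum>i\<in>I. v i) \<in> tangent_space A p"
  by (induction I rule: infinite_finite_induct) (auto simp: tangent_space_0 tangent_space_add)

lemma coord_field_tangent:
  assumes "c \<in> A" "p \<in> cdom c" shows "coord_field A c b p \<in> tangent_space A p"
  unfolding tangent_space_def mem_Collect_eq
proof (intro conjI ballI impI allI)
  fix d e assume de: "d \<in> A" "e \<in> A" "p \<in> cdom d \<inter> cdom e"
  then show "coord_field A c b p e = frechet_derivative (cmap e \<circ> cinv d) (at (cmap d p)) (coord_field A c b p d)"
    using transition_cocycle[OF assms(1) de(1,2) assms(2)] assms(2) by (simp add: coord_field_def)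
qed (auto simp: coord_field_def)

lemma coord_field_self: "c \<in> A \<Longrightarrow> p \<in> cdom c \<Longrightarrow> coord_field A c b p c = b"
  using transition_self by (simp add: coord_field_def)

lemma tangent_coord_field:
  "v \<in> tangent_space A p \<Longrightarrow> c \<in> A \<Longrightarrow> p \<in> cdom c \<Longrightarrow> coord_field A c (v c) p = v"
  by (rule tangent_eqI[OF coord_field_tangent _ _ _ coord_field_self])

lemma coord_field_linear:
  assumes "c \<in> A"
  shows "coord_field A c (u + v) = coord_field A c u + coord_field A c v"
    and "coord_field A c (a *\<^sub>R u) = (\<lambda>q. a *\<^sub>T coord_field A c u q)"
proof -
  have l: "linear (frechet_derivative (cmap d \<circ> cinv c) (at (cmap c p)))" if "d \<in> A" "p \<in> cdom d" "p \<in> cdom c" for p d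
    using transition_linear[OF assms that(1,3,2)] .
  show "coord_field A c (u + v) = coord_field A c u + coord_field A c v"
    by (intro ext) (simp add: coord_field_def linear_add[OF l])
  show "coord_field A c (a *\<^sub>R u) = (\<lambda>q. a *\<^sub>T coord_field A c u q)"
    by (intro ext) (simp add: coord_field_def vscale_def linear_scale[OF l])
qed

section \<open>Vector fields in charts\<close>

lemma vector_fieldsI:
  assumes "\<And>p. p \<in> U \<Longrightarrow> X p \<in> tangent_space A p"
    and "\<And>c. c \<in> A \<Longrightarrow> smooth_on (cmap c ` (U \<inter> cdom c)) (\<lambda>x. X (cinv c x) c)"
  shows "X \<in> vector_fields A U"
  using assms unfolding vector_fields_def by auto

lemma vector_field_smooth:
  assumes "X \<in> vector_fields A U" "c \<in> A"
  shows "smooth_on (cmap c ` (U \<inter> cdom c)) (\<lambda>x. X (cinv c x) c)"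
  using assms unfolding vector_fields_def by auto

lemma vector_field_tangent: "X \<in> vector_fields A U \<Longrightarrow> p \<in> U \<Longrightarrow> X p \<in> tangent_space A p"
  unfolding vector_fields_def by auto

lemma vector_fields_subset:
  assumes X: "X \<in> vector_fields A U" and U: "U' \<subseteq> U"
  shows "X \<in> vector_fields A U'"
proof (rule vector_fieldsI)
  show "X p \<in> tangent_space A p" if "p \<in> U'" for p
    using vector_field_tangent[OF X] that U by auto
  show "smooth_on (cmap c ` (U' \<inter> cdom c)) (\<lambda>x. X (cinv c x) c)" if "c \<in> A" for c
    by (rule smooth_on_subset[OF vector_field_smooth[OF X that]]) (use U in auto)
qed

lemma smooth_chart_change:
  fixes h :: "'a \<Rightarrow> 'e::real_normed_vector"
  assumes cd: "c \<in> A" "d \<in> A" and U: "open U" "U \<subseteq> cdom c"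
    and h: "smooth_on (cmap c ` U) (h \<circ> cinv c)"
  shows "smooth_on (cmap d ` (U \<inter> cdom d)) (h \<circ> cinv d)"
proof -
  have UU: "U \<inter> cdom c = U" using U by auto
  have o: "open (cmap d ` (U \<inter> cdom d))" "open (cmap c ` U)"
    using open_image_chart[OF cd(2) U(1)] open_image_chart[OF cd(1) U(1)] UU by auto
  have "smooth_on (cmap d ` (U \<inter> cdom d)) (\<lambda>x. (h \<circ> cinv c) ((cmap c \<circ> cinv d) x))"
  proof (rule smooth_on_compose[OF o _ _ h])
    show "(cmap c \<circ> cinv d) ` cmap d ` (U \<inter> cdom d) \<subseteq> cmap c ` U"
      using cinv_cmap[OF cd(2)] by auto
    show "smooth_on (cmap d ` (U \<inter> cdom d)) (cmap c \<circ> cinv d)"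
      by (rule smooth_on_subset[OF transition_smooth[OF cd(2,1)]]) (use U in auto)
  qed
  moreover have "(h \<circ> cinv c) ((cmap c \<circ> cinv d) x) = (h \<circ> cinv d) x" if "x \<in> cmap d ` (U \<inter> cdom d)" for x
    using that U cinv_cmap[OF cd(1)] cinv_cmap[OF cd(2)] by auto
  ultimately show ?thesis by (subst smooth_on_cong[OF o(1)]) auto
qed

lemma smooth_fun_chart:
  assumes "c \<in> A" "open U" "U \<subseteq> cdom c" "smooth_on (cmap c ` U) (h \<circ> cinv c)"
  shows "smooth_fun A U h"
  unfolding smooth_fun_def using smooth_chart_change[OF assms(1) _ assms(2-4)] by blast

lemma coord_field_vector_field:
  assumes c: "c \<in> A" and U: "open U" "U \<subseteq> cdom c"
  shows "coord_field A c b \<in> vector_fields A U"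
proof -
  have "smooth_on (cmap d ` (U \<inter> cdom d)) (\<lambda>x. coord_field A c b (cinv d x) d)" if d: "d \<in> A" for d
  proof -
    let ?U = "U \<inter> cdom d"
    have Ud: "open ?U" "?U \<subseteq> cdom c" using U open_cdom[OF d] by auto
    have "smooth_on (cmap c ` ?U) (\<lambda>y. frechet_derivative (cmap d \<circ> cinv c) (at y) b)"
      by (rule smooth_on_frechet[OF smooth_on_subset[OF transition_smooth[OF c d]]]) (use Ud in auto)
    moreover have "open (cmap c ` ?U)" using open_image_chart[OF c Ud(1)] Ud(2) by (simp add: Int_absorb2)
    ultimately have "smooth_on (cmap c ` ?U) ((\<lambda>q. coord_field A c b q d) \<circ> cinv c)"
      by (subst smooth_on_cong) (use Ud d cinv_cmap[OF c] in \<open>auto simp: coord_field_def\<close>)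
    from smooth_chart_change[OF c d Ud this] show ?thesis by (simp add: o_def Int_assoc)
  qed
  then show ?thesis using coord_field_tangent[OF c] U(2) by (intro vector_fieldsI) auto
qed

lemma coord_vf: "c \<in> A \<Longrightarrow> coord_field A c b \<in> vector_fields A (cdom c)"
  by (rule coord_field_vector_field[OF _ open_cdom]) auto

lemma vector_fields_add:
  assumes X: "X \<in> vector_fields A U" and Y: "Y \<in> vector_fields A U" and U: "open U"
  shows "X + Y \<in> vector_fields A U"
  by (rule vector_fieldsI)
    (simp_all add: tangent_space_add vector_field_tangent[OF X] vector_field_tangent[OF Y]
      smooth_on_add[OF open_image_chart[OF _ U] vector_field_smooth[OF X] vector_field_smooth[OF Y]])

lemma vector_fields_diff:
  assumes X: "X \<in> vector_fields A U" and Y: "Y \<in> vector_fields A U" and U: "open U"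
  shows "X - Y \<in> vector_fields A U"
  by (rule vector_fieldsI)
    (simp_all add: tangent_space_diff vector_field_tangent[OF X] vector_field_tangent[OF Y]
      smooth_on_minus[OF open_image_chart[OF _ U] vector_field_smooth[OF X] vector_field_smooth[OF Y]])

lemma vector_fields_0: "0 \<in> vector_fields A U"
  using tangent_space_0 by (intro vector_fieldsI) (auto simp: smooth_on_const)

lemma vector_fields_sum:
  "open U \<Longrightarrow> (\<And>i. i \<in> I \<Longrightarrow> X i \<in> vector_fields A U) \<Longrightarrow> (\<Sum>i\<in>I. X i) \<in> vector_fields A U"
  by (induction I rule: infinite_finite_induct) (auto simp: vector_fields_0 vector_fields_add)

lemma vector_fields_scale:
  assumes X: "X \<in> vector_fields A U" and h: "smooth_fun A U h" and U: "open U"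
  shows "(\<lambda>q. h q *\<^sub>T X q) \<in> vector_fields A U"
proof (rule vector_fieldsI)
  fix c assume c: "c \<in> A"
  have "smooth_on (cmap c ` (U \<inter> cdom c)) (h \<circ> cinv c)" using h c unfolding smooth_fun_def by auto
  from smooth_on_scaleR[OF open_image_chart[OF c U] this vector_field_smooth[OF X c]]
  show "smooth_on (cmap c ` (U \<inter> cdom c)) (\<lambda>x. (h (cinv c x) *\<^sub>T X (cinv c x)) c)"
    by (simp add: vscale_def o_def)
qed (rule tangent_space_scale[OF vector_field_tangent[OF X]])

section \<open>Connections and metrics in charts\<close>

definition christoffel :: "('a, 'm) conn \<Rightarrow> ('a, 'm) chart \<Rightarrow> 'm \<Rightarrow> 'm \<Rightarrow> 'm \<Rightarrow> 'm" where
  "christoffel D c x u v = D (cinv c x) (coord_field A c u (cinv c x)) (coord_field A c v) c"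

definition metric_coeff :: "('a, 'm) metric \<Rightarrow> ('a, 'm) chart \<Rightarrow> 'm \<Rightarrow> 'm \<Rightarrow> 'm \<Rightarrow> real" where
  "metric_coeff g c x u v = g (cinv c x) (coord_field A c u (cinv c x)) (coord_field A c v (cinv c x))"

lemma christoffel_conn:
  assumes "c \<in> A" "p \<in> cdom c" "v \<in> tangent_space A p"
  shows "D p v (coord_field A c b) c = christoffel D c (cmap c p) (v c) b"
  using assms by (simp add: christoffel_def cinv_cmap tangent_coord_field)

lemma cov_coord:
  assumes "c \<in> A" "p \<in> cdom c"
  shows "cov D (coord_field A c u) (coord_field A c v) p c = christoffel D c (cmap c p) u v"
  using assms by (simp add: cov_def christoffel_def cinv_cmap)

lemma sum_field_apply: "(\<Sum>i\<in>I. (X i :: ('a, 'm) vfield)) p = (\<Sum>i\<in>I. X i p)"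
  by (induction I rule: infinite_finite_induct) auto

lemma sum_tvec_apply: "(\<Sum>i\<in>I. (v i :: ('a, 'm) tvec)) c = (\<Sum>i\<in>I. v i c)"
  by (induction I rule: infinite_finite_induct) auto

context
  fixes D :: "('a, 'm) conn"
  assumes D: "affine_connection A D"
begin

context
  fixes U p v
  assumes U: "open U" "p \<in> U" and v: "v \<in> tangent_space A p"
begin

lemma
  assumes "Y \<in> vector_fields A U"
  shows conn_tangent: "D p v Y \<in> tangent_space A p"
    and conn_add_left: "w \<in> tangent_space A p \<Longrightarrow> D p (v + w) Y = D p v Y + D p w Y"
    and conn_scale_left: "D p (a *\<^sub>T v) Y = a *\<^sub>T D p v Y"
    and conn_add: "Z \<in> vector_fields A U \<Longrightarrow> D p v (Y + Z) = D p v Y + D p v Z"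
    and conn_leibniz: "smooth_fun A U h \<Longrightarrow>
           D p v (\<lambda>q. h q *\<^sub>T Y q) = dderiv A p v h *\<^sub>T Y p + h p *\<^sub>T D p v Y"
    and conn_local: "Z \<in> vector_fields A U \<Longrightarrow> (\<And>q. q \<in> U \<Longrightarrow> Y q = Z q) \<Longrightarrow> D p v Y = D p v Z"
proof -
  have *: "D p v Y \<in> tangent_space A p \<and>
        D p (v + w) Y = D p v Y + D p w Y \<and>
        (\<forall>a. D p (a *\<^sub>T v) Y = a *\<^sub>T D p v Y) \<and>
        D p v (Y + Z) = D p v Y + D p v Z \<and>
        (\<forall>h. smooth_fun A U h \<longrightarrow>
           D p v (\<lambda>q. h q *\<^sub>T Y q) = dderiv A p v h *\<^sub>T Y p + h p *\<^sub>T D p v Y) \<and>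
        ((\<forall>q\<in>U. Y q = Z q) \<longrightarrow> D p v Y = D p v Z)"
    if "w \<in> tangent_space A p" "Z \<in> vector_fields A U" for w Z
    using D[unfolded affine_connection_def, rule_format, OF U(1), THEN conjunct1, rule_format, OF U(2) v that(1) assms that(2)] .
  show "D p v Y \<in> tangent_space A p" "D p (a *\<^sub>T v) Y = a *\<^sub>T D p v Y"
    "smooth_fun A U h \<Longrightarrow> D p v (\<lambda>q. h q *\<^sub>T Y q) = dderiv A p v h *\<^sub>T Y p + h p *\<^sub>T D p v Y"
    using *[OF v assms] by blast+
  show "w \<in> tangent_space A p \<Longrightarrow> D p (v + w) Y = D p v Y + D p w Y"
    using *[OF _ assms] by blast
  show "Z \<in> vector_fields A U \<Longrightarrow> D p v (Y + Z) = D p v Y + D p v Z"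
    "Z \<in> vector_fields A U \<Longrightarrow> (\<And>q. q \<in> U \<Longrightarrow> Y q = Z q) \<Longrightarrow> D p v Y = D p v Z"
    using *[OF v] by blast+
qed

lemma conn_zero: "D p v 0 = 0"
  using conn_add[OF vector_fields_0 vector_fields_0] by simp

lemma conn_sum:
  "(\<And>i. i \<in> I \<Longrightarrow> Y i \<in> vector_fields A U) \<Longrightarrow> D p v (\<Sum>i\<in>I. Y i) = (\<Sum>i\<in>I. D p v (Y i))"
  by (induction I rule: infinite_finite_induct)
    (auto simp: conn_zero conn_add vector_fields_sum[OF U(1)])

end

lemma cov_vector_field:
  assumes U: "open U" and X: "X \<in> vector_fields A U" and Y: "Y \<in> vector_fields A U"
  shows "cov D X Y \<in> vector_fields A U"
  using D[unfolded affine_connection_def, rule_format, OF U, THEN conjunct2, rule_format, OF X Y] .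

context fixes c assumes c: "c \<in> A"
begin

lemma christoffel_bilinear:
  assumes x: "x \<in> cmap c ` cdom c"
  shows "bilinear (christoffel D c x)"
proof -
  note p = cinv_in[OF c x] and oc = open_cdom[OF c]
  let ?p = "cinv c x"
  note t = coord_field_tangent[OF c p]
  have const: "smooth_fun A (cdom c) (\<lambda>q. a)" for a
    unfolding smooth_fun_def by (simp add: o_def smooth_on_const)
  have dconst: "dderiv A ?p v (\<lambda>q. a) = 0" for v a
    unfolding dderiv_def by (simp add: o_def Let_def frechet_derivative_const)
  have "linear (\<lambda>u. christoffel D c x u v)" for v
    unfolding christoffel_def
    by (rule linearI)
      (simp_all add: coord_field_linear[OF c] conn_add_left[OF oc p t coord_vf[OF c] t]
        conn_scale_left[OF oc p t coord_vf[OF c]] vscale_simps)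
  moreover have "linear (christoffel D c x u)" for u
    unfolding christoffel_def
    by (rule linearI)
      (simp_all add: coord_field_linear[OF c] conn_add[OF oc p t coord_vf[OF c] coord_vf[OF c]]
        conn_leibniz[OF oc p t coord_vf[OF c] const] dconst vscale_simps)
  ultimately show ?thesis unfolding bilinear_def by auto
qed

text \<open>The coordinate formula of a connection follows from its Leibniz rule, applied to the expansion
  of the field in coordinate fields.\<close>

lemma conn_chart:
  assumes U: "open U" "p \<in> U" and v: "v \<in> tangent_space A p" and p: "p \<in> cdom c"
    and Y: "Y \<in> vector_fields A U"
  shows "D p v Y c = frechet_derivative (\<lambda>x. Y (cinv c x) c) (at (cmap c p)) (v c)
     + christoffel D c (cmap c p) (v c) (Y p c)"
proof -
  let ?U = "U \<inter> cdom c" and ?Y = "\<lambda>x. Y (cinv c x) c" and ?x = "cmap c p"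
  have U': "open ?U" "p \<in> ?U" using U p open_cdom[OF c] by auto
  have Y': "Y \<in> vector_fields A ?U" by (rule vector_fields_subset[OF Y]) auto
  have E: "coord_field A c b \<in> vector_fields A ?U" for b
    by (rule vector_fields_subset[OF coord_vf[OF c]]) auto
  have Ys: "smooth_on (cmap c ` ?U) ?Y" by (rule vector_field_smooth[OF Y c])
  have Yd: "?Y differentiable (at ?x)" by (rule smooth_on_differentiable[OF Ys]) (use U' in auto)
  define h where "h b q = Y q c \<bullet> b" for b q
  have hs: "smooth_fun A ?U (h b)" for b
  proof (rule smooth_fun_chart[OF c U'(1)])
    show "smooth_on (cmap c ` ?U) (h b \<circ> cinv c)"
      using smooth_on_bounded_linear[OF open_image_chart[OF c U(1)] bounded_linear_inner_left Ys]
      by (simp add: h_def o_def)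
  qed auto
  have hd: "dderiv A p v (h b) = frechet_derivative ?Y (at ?x) (v c) \<bullet> b" for b
  proof -
    have e: "h b \<circ> cinv c = (\<lambda>x. ?Y x \<bullet> b)" by (auto simp: h_def)
    have "(\<lambda>x. ?Y x \<bullet> b) differentiable (at ?x)"
      using Yd by (auto simp: differentiable_def intro: has_derivative_inner_left)
    then have "dderiv A p v (h b) = frechet_derivative (\<lambda>x. ?Y x \<bullet> b) (at ?x) (v c)"
      using dderiv_chart[OF c p v, of "h b"] by (simp only: e)
    then show ?thesis by (simp add: frechet_bounded_linear[OF bounded_linear_inner_left Yd])
  qed
  let ?f = "\<lambda>b q. h b q *\<^sub>T coord_field A c b q"
  have f: "?f b \<in> vector_fields A ?U" for b by (rule vector_fields_scale[OF E hs U'(1)])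
  have "Y q = (\<Sum>b\<in>Basis. ?f b) q" if q: "q \<in> ?U" for q
  proof (rule tangent_eqI[OF _ _ c])
    show "Y q \<in> tangent_space A q" by (rule vector_field_tangent[OF Y' q])
    show "(\<Sum>b\<in>Basis. ?f b) q \<in> tangent_space A q"
      by (rule vector_field_tangent[OF vector_fields_sum[OF U'(1) f] q])
    show "q \<in> cdom c" using q by simp
    then show "Y q c = (\<Sum>b\<in>Basis. ?f b) q c"
      by (simp add: sum_field_apply sum_tvec_apply vscale_simps coord_field_self[OF c] h_def euclidean_representation)
  qed
  then have "D p v Y = D p v (\<Sum>b\<in>Basis. ?f b)"
    by (rule conn_local[OF U' v Y' vector_fields_sum[OF U'(1) f]])
  also have "\<dots> = (\<Sum>b\<in>Basis. D p v (?f b))" by (rule conn_sum[OF U' v f])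
  also have "\<dots> = (\<Sum>b\<in>Basis. dderiv A p v (h b) *\<^sub>T coord_field A c b p + h b p *\<^sub>T D p v (coord_field A c b))"
    by (rule sum.cong[OF refl conn_leibniz[OF U' v E hs]])
  finally have "D p v Y c = (\<Sum>b\<in>Basis. (frechet_derivative ?Y (at ?x) (v c) \<bullet> b) *\<^sub>R b)
      + (\<Sum>b\<in>Basis. (Y p c \<bullet> b) *\<^sub>R christoffel D c ?x (v c) b)"
    by (simp add: sum_tvec_apply vscale_simps hd coord_field_self[OF c p] christoffel_conn[OF c p v] h_def sum.distrib)
  moreover have "linear (christoffel D c ?x (v c))"
    using christoffel_bilinear[of ?x] p by (auto simp: bilinear_def)
  ultimately show ?thesis using linear_basis_expansion[of "christoffel D c ?x (v c)" "Y p c"]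
    by (simp add: euclidean_representation)
qed

lemma christoffel_smooth: "smooth_on (cmap c ` cdom c) (\<lambda>x. christoffel D c x u v)"
  using vector_field_smooth[OF cov_vector_field[OF open_cdom[OF c] coord_vf[OF c] coord_vf[OF c]] c]
  by (simp add: christoffel_def cov_def)

lemma cov_coord_field:
  assumes p: "p \<in> cdom c" and Y: "Y \<in> vector_fields A (cdom c)"
  shows "cov D (coord_field A c u) Y p c =
    frechet_derivative (\<lambda>x. Y (cinv c x) c) (at (cmap c p)) u + christoffel D c (cmap c p) u (Y p c)"
  using conn_chart[OF open_cdom[OF c] p coord_field_tangent[OF c p] p Y, of u]
  by (simp add: cov_def coord_field_self[OF c p])

text \<open>The component of the bracket in the chart \<open>c\<close> is clearly zero.  This determines the components
  in the other charts because the bracket is a tangent vector, which in turn holds because it is the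
  difference of two covariant derivatives.\<close>

lemma torsion_coord:
  assumes tf: "torsion_free A D" and p: "p \<in> cdom c"
  shows "lie_bracket A (coord_field A c u) (coord_field A c v) p = 0"
    and "christoffel D c (cmap c p) u v = christoffel D c (cmap c p) v u"
proof -
  let ?X = "coord_field A c u" and ?Y = "coord_field A c v"
  note oc = open_cdom[OF c]
  have t: "cov D ?X ?Y p - cov D ?Y ?X p = lie_bracket A ?X ?Y p"
    using tf oc p coord_vf[OF c] unfolding torsion_free_def by blast
  have z: "frechet_derivative (\<lambda>x. coord_field A c b (cinv c x) c) (at (cmap c p)) w = 0" for b w
  proof -
    have "frechet_derivative (\<lambda>x. coord_field A c b (cinv c x) c) (at (cmap c p)) =
      frechet_derivative (\<lambda>x. b) (at (cmap c p))"
      by (rule frechet_cong_open[OF open_chart_image[OF c]])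
        (use p coord_field_self[OF c cinv_in[OF c]] in auto)
    then show ?thesis by (simp add: frechet_derivative_const)
  qed
  then have l: "lie_bracket A ?X ?Y p c = 0"
    by (simp add: lie_bracket_def)
  have m: "lie_bracket A ?X ?Y p \<in> tangent_space A p"
    unfolding t[symmetric]
    by (intro tangent_space_diff vector_field_tangent[OF cov_vector_field[OF oc coord_vf[OF c] coord_vf[OF c]] p])
  show "lie_bracket A ?X ?Y p = 0"
    by (rule tangent_eqI[OF m tangent_space_0 c p]) (simp add: l)
  show "christoffel D c (cmap c p) u v = christoffel D c (cmap c p) v u"
    using fun_cong[OF t, of c] l by (simp add: cov_coord[OF c p])
qed

lemma curvature_coord:
  assumes tf: "torsion_free A D" and p: "p \<in> cdom c"
  shows "curvature A D (coord_field A c u) (coord_field A c v) (coord_field A c w) p c =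
    (frechet_derivative (\<lambda>x. christoffel D c x v w) (at (cmap c p)) u
       + christoffel D c (cmap c p) u (christoffel D c (cmap c p) v w))
    - (frechet_derivative (\<lambda>x. christoffel D c x u w) (at (cmap c p)) v
       + christoffel D c (cmap c p) v (christoffel D c (cmap c p) u w))"
proof -
  note oc = open_cdom[OF c]
  let ?E = "coord_field A c"
  have z: "D p 0 (?E w) = 0"
    using conn_scale_left[OF oc p tangent_space_0 coord_vf[OF c], of 0 w] by (simp add: vscale_def zero_fun_def)
  have s: "cov D (?E u) (cov D (?E v) (?E w)) p c =
     frechet_derivative (\<lambda>x. christoffel D c x v w) (at (cmap c p)) u
       + christoffel D c (cmap c p) u (christoffel D c (cmap c p) v w)" for u v
    using cov_coord_field[OF p cov_vector_field[OF oc coord_vf[OF c] coord_vf[OF c]], of u v w]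
    by (simp add: cov_coord[OF c p]) (simp add: cov_def christoffel_def)
  show ?thesis
    unfolding curvature_def by (simp add: s) (simp add: cov_def torsion_coord(1)[OF tf p] z)
qed

end
end

context
  fixes g :: "('a, 'm) metric" and c
  assumes g: "riemannian_metric A g" and c: "c \<in> A"
begin

lemma metric_facts:
  assumes "u \<in> tangent_space A p" "v \<in> tangent_space A p"
  shows "g p u v = g p v u" "w \<in> tangent_space A p \<Longrightarrow> g p (u + v) w = g p u w + g p v w"
    "g p (a *\<^sub>T u) v = a * g p u v" "u \<noteq> 0 \<Longrightarrow> g p u u > 0"
  using g assms unfolding riemannian_metric_def by blast+

lemma metric_chart:
  "p \<in> cdom c \<Longrightarrow> v \<in> tangent_space A p \<Longrightarrow> w \<in> tangent_space A p \<Longrightarrow>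
    g p v w = metric_coeff g c (cmap c p) (v c) (w c)"
  by (simp add: metric_coeff_def cinv_cmap[OF c] tangent_coord_field[OF _ c])

lemma metric_form:
  assumes x: "x \<in> cmap c ` cdom c"
  shows "sym_form (metric_coeff g c x)"
proof (rule sym_formI)
  note t = coord_field_tangent[OF c cinv_in[OF c x]]
  show "linear (\<lambda>u. metric_coeff g c x u v)" for v
    unfolding metric_coeff_def
    by (rule linearI) (simp_all add: coord_field_linear[OF c] metric_facts(2)[OF t t t] metric_facts(3)[OF t t])
  show "metric_coeff g c x u v = metric_coeff g c x v u" for u v
    unfolding metric_coeff_def by (rule metric_facts(1)[OF t t])
qed

lemma metric_pos:
  assumes x: "x \<in> cmap c ` cdom c" and v: "v \<noteq> 0"
  shows "metric_coeff g c x v v > 0"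
  unfolding metric_coeff_def
proof (rule metric_facts(4))
  show "coord_field A c v (cinv c x) \<noteq> 0"
    using coord_field_self[OF c cinv_in[OF c x], of v] v by auto
qed (use coord_field_tangent[OF c cinv_in[OF c x]] in auto)

lemma metric_smooth: "smooth_on (cmap c ` cdom c) (\<lambda>x. metric_coeff g c x u v)"
proof -
  have v: "coord_field A c b \<in> vector_fields A (cdom c)" for b
    by (rule coord_field_vector_field[OF c open_cdom[OF c]]) auto
  have "smooth_fun A (cdom c) (\<lambda>p. g p (coord_field A c u p) (coord_field A c v p))"
    using g open_cdom[OF c] v unfolding riemannian_metric_def by blast
  then have "smooth_on (cmap c ` (cdom c \<inter> cdom c)) ((\<lambda>p. g p (coord_field A c u p) (coord_field A c v p)) \<circ> cinv c)"
    using c unfolding smooth_fun_def by blast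
  then show ?thesis by (simp add: metric_coeff_def o_def)
qed

lemma cov_metric_coord:
  assumes D: "affine_connection A D" and p: "p \<in> cdom c"
  shows "cov_metric A D g (coord_field A c u) (coord_field A c v) (coord_field A c w) p =
    frechet_derivative (\<lambda>x. metric_coeff g c x v w) (at (cmap c p)) u
    - metric_coeff g c (cmap c p) (christoffel D c (cmap c p) u v) w
    - metric_coeff g c (cmap c p) v (christoffel D c (cmap c p) u w)"
proof -
  let ?E = "coord_field A c"
  note t = coord_field_tangent[OF c p]
  have e: "(\<lambda>q. g q (?E v q) (?E w q)) \<circ> cinv c = (\<lambda>x. metric_coeff g c x v w)"
    by (auto simp: metric_coeff_def)
  have "dderiv A p (?E u p) (\<lambda>q. g q (?E v q) (?E w q)) =
    frechet_derivative (\<lambda>x. metric_coeff g c x v w) (at (cmap c p)) u"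
    using dderiv_chart[OF c p t, of "\<lambda>q. g q (?E v q) (?E w q)" u]
      smooth_on_differentiable[OF metric_smooth, of "cmap c p" v w] p
    unfolding e by (simp add: coord_field_self[OF c p])
  moreover have "cov D (?E u) (?E b) p \<in> tangent_space A p" for b
    by (rule vector_field_tangent[OF cov_vector_field[OF D open_cdom[OF c] coord_vf[OF c] coord_vf[OF c]] p])
  ultimately show ?thesis
    by (simp add: cov_metric_def metric_chart[OF p] t cov_coord[OF c p] coord_field_self[OF c p])
qed

end

lemma levi_civita_coord:
  assumes "levi_civita A g D" "riemannian_metric A g" and c: "c \<in> A" and x: "x \<in> cmap c ` cdom c"
  shows "frechet_derivative (\<lambda>x. metric_coeff g c x v w) (at x) u =
    metric_coeff g c x (christoffel D c x u v) w + metric_coeff g c x v (christoffel D c x u w)"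
proof -
  have D: "affine_connection A D" using assms(1) by (simp add: levi_civita_def)
  let ?E = "coord_field A c"
  have "cov_metric A D g (?E u) (?E v) (?E w) (cinv c x) = 0"
    using assms(1) cinv_in[OF c x] open_cdom[OF c] coord_field_vector_field[OF c open_cdom[OF c] order_refl]
    unfolding levi_civita_def by blast
  then show ?thesis
    using cov_metric_coord[OF assms(2) c D cinv_in[OF c x], of u v w] by (simp add: cmap_cinv[OF c x])
qed

lemma codazzi_coord:
  assumes "statistical_manifold A D g" and c: "c \<in> A" and x: "x \<in> cmap c ` cdom c"
  shows "frechet_derivative (\<lambda>x. metric_coeff g c x v w) (at x) u
      - metric_coeff g c x (christoffel D c x u v) w - metric_coeff g c x v (christoffel D c x u w) =
    frechet_derivative (\<lambda>x. metric_coeff g c x u w) (at x) v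
      - metric_coeff g c x (christoffel D c x v u) w - metric_coeff g c x u (christoffel D c x v w)"
proof -
  have D: "affine_connection A D" "riemannian_metric A g" using assms(1) by (simp_all add: statistical_manifold_def)
  let ?E = "coord_field A c"
  have "cov_metric A D g (?E u) (?E v) (?E w) (cinv c x) = cov_metric A D g (?E v) (?E u) (?E w) (cinv c x)"
    using assms(1) cinv_in[OF c x] open_cdom[OF c] coord_field_vector_field[OF c open_cdom[OF c] order_refl]
    unfolding statistical_manifold_def by blast
  then show ?thesis
    using cov_metric_coord[OF D(2) c D(1) cinv_in[OF c x]] by (simp add: cmap_cinv[OF c x])
qed

lemma constant_curvature_coord:
  assumes "constant_curvature A D g k" and D: "affine_connection A D" "torsion_free A D"
    and g: "riemannian_metric A g" and c: "c \<in> A" and x: "x \<in> cmap c ` cdom c"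
  shows "(frechet_derivative (\<lambda>x. christoffel D c x v w) (at x) u + christoffel D c x u (christoffel D c x v w))
    - (frechet_derivative (\<lambda>x. christoffel D c x u w) (at x) v + christoffel D c x v (christoffel D c x u w)) =
    k *\<^sub>R (metric_coeff g c x v w *\<^sub>R u - metric_coeff g c x u w *\<^sub>R v)"
proof -
  let ?E = "coord_field A c" and ?p = "cinv c x"
  note p = cinv_in[OF c x]
  have "curvature A D (?E u) (?E v) (?E w) ?p =
      k *\<^sub>T (g ?p (?E v ?p) (?E w ?p) *\<^sub>T ?E u ?p - g ?p (?E u ?p) (?E w ?p) *\<^sub>T ?E v ?p)"
    using assms(1) p open_cdom[OF c] coord_field_vector_field[OF c open_cdom[OF c] order_refl]
    unfolding constant_curvature_def by blast
  from fun_cong[OF this, of c] show ?thesis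
    by (simp add: curvature_coord[OF D(1) c D(2) p] cmap_cinv[OF c x] vscale_simps coord_field_self[OF c p] metric_coeff_def)
qed

lemma hessian_curvature_coord:
  assumes "constant_hessian_curvature A D D0 g k" and D: "affine_connection A D" and D0: "affine_connection A D0"
    and g: "riemannian_metric A g" and c: "c \<in> A" and x: "x \<in> cmap c ` cdom c"
  shows "frechet_derivative (\<lambda>x. christoffel D c x v w - christoffel D0 c x v w) (at x) u
      + christoffel D c x u (christoffel D c x v w - christoffel D0 c x v w)
      - (christoffel D c x (christoffel D c x u v) w - christoffel D0 c x (christoffel D c x u v) w)
      - (christoffel D c x v (christoffel D c x u w) - christoffel D0 c x v (christoffel D c x u w)) =
      (- (k/2)) *\<^sub>R (metric_coeff g c x u v *\<^sub>R w + metric_coeff g c x u w *\<^sub>R v)"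
proof -
  let ?E = "coord_field A c" and ?p = "cinv c x" and ?K = "difference_tensor D D0"
  note p = cinv_in[OF c x] and oc = open_cdom[OF c] and E = coord_field_vector_field[OF c open_cdom[OF c] order_refl]
    and t = coord_field_tangent[OF c cinv_in[OF c x]]
  have h: "(cov D (?E u) (?K (?E v) (?E w)) - ?K (cov D (?E u) (?E v)) (?E w) - ?K (?E v) (cov D (?E u) (?E w))) ?p =
      (- (k / 2)) *\<^sub>T (g ?p (?E u ?p) (?E v ?p) *\<^sub>T ?E w ?p + g ?p (?E u ?p) (?E w ?p) *\<^sub>T ?E v ?p)"
    using assms(1) p oc E unfolding constant_hessian_curvature_def Let_def by blast
  have Y: "cov D (?E u) (?E w) \<in> vector_fields A (cdom c)" for u w
    by (rule cov_vector_field[OF D oc E E])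
  have K: "?K (?E v) (?E w) \<in> vector_fields A (cdom c)"
    unfolding difference_tensor_def
    by (rule vector_fields_diff[OF Y cov_vector_field[OF D0 oc E E] oc])
  have 1: "cov D (?E u) (?K (?E v) (?E w)) ?p c =
     frechet_derivative (\<lambda>x. christoffel D c x v w - christoffel D0 c x v w) (at x) u
      + christoffel D c x u (christoffel D c x v w - christoffel D0 c x v w)"
    using cov_coord_field[OF D c p K, of u]
    by (simp add: cmap_cinv[OF c x]) (simp add: difference_tensor_def cov_def christoffel_def)
  have 2: "?K (cov D (?E u) (?E v)) (?E w) ?p c =
      christoffel D c x (christoffel D c x u v) w - christoffel D0 c x (christoffel D c x u v) w"
    using christoffel_conn[OF c p vector_field_tangent[OF Y p], of D u v w] christoffel_conn[OF c p vector_field_tangent[OF Y p], of D0 u v w]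
    by (simp add: difference_tensor_def cov_def cmap_cinv[OF c x]) (simp add: christoffel_def)
  have 3: "?K (?E v) (cov D (?E u) (?E w)) ?p c =
      christoffel D c x v (christoffel D c x u w) - christoffel D0 c x v (christoffel D c x u w)"
    using cov_coord_field[OF D c p Y, of v u w] cov_coord_field[OF D0 c p Y, of v u w]
    by (simp add: difference_tensor_def cmap_cinv[OF c x] cov_coord[OF c p])
  show ?thesis
    using fun_cong[OF h, of c] 1 2 3
    by (simp add: vscale_simps coord_field_self[OF c p] metric_coeff_def)
qed

end

section \<open>Fields along a map in charts\<close>

locale smooth_manifold_map =
  M: smooth_manifold A + N: smooth_manifold B
  for A :: "('a::topological_space, 'm::euclidean_space) chart set"
    and B :: "('b::topological_space, 'n::euclidean_space) chart set" +
  fixes f :: "'a \<Rightarrow> 'b"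
  assumes f: "smooth_map A B f"
begin

lemma open_vimage_cdom: "d \<in> B \<Longrightarrow> open (f -` cdom d)"
  using f N.open_cdom open_vimage unfolding smooth_map_def by blast

lemma map_smooth:
  assumes "c \<in> A" "d \<in> B"
  shows "smooth_on (cmap c ` (f -` cdom d \<inter> cdom c)) (cmap d \<circ> f \<circ> cinv c)"
  using f assms unfolding smooth_map_def by (simp add: Int_commute)

lemma map_der:
  assumes "c \<in> A" "d \<in> B" "p \<in> cdom c" "f p \<in> cdom d"
  shows "((cmap d \<circ> f \<circ> cinv c) has_derivative frechet_derivative (cmap d \<circ> f \<circ> cinv c) (at (cmap c p))) (at (cmap c p))"
  by (rule smooth_on_has_derivative[OF map_smooth]) (use assms in auto)

lemma push_chart:
  assumes "c \<in> A" "d \<in> B" "p \<in> cdom c" "f p \<in> cdom d" "v \<in> tangent_space A p"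
  shows "pushforward A B f p v d = frechet_derivative (cmap d \<circ> f \<circ> cinv c) (at (cmap c p)) (v c)"
proof -
  let ?e = "chart_at A p"
  note e = M.chart_at[of p]
  have "((cmap d \<circ> f) \<circ> cinv c) differentiable (at (cmap c p))"
    using map_der[OF assms(1-4)] differentiable_def by blast
  from frechet_derivative_at[OF M.chart_change[OF e(1) assms(1) e(2) assms(3) this]]
  have "frechet_derivative (cmap d \<circ> f \<circ> cinv ?e) (at (cmap ?e p)) (v ?e) =
    frechet_derivative (cmap d \<circ> f \<circ> cinv c) (at (cmap c p))
     (frechet_derivative (cmap c \<circ> cinv ?e) (at (cmap ?e p)) (v ?e))" by metis
  then show ?thesis
    using assms M.tangentD[OF assms(5) e(1) assms(1) e(2) assms(3)]
    by (simp add: pushforward_def Let_def)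
qed

lemma push_tangent:
  assumes v: "v \<in> tangent_space A p"
  shows "pushforward A B f p v \<in> tangent_space B (f p)"
  unfolding tangent_space_def mem_Collect_eq
proof (intro conjI ballI impI allI)
  fix d e assume de: "d \<in> B" "e \<in> B" "f p \<in> cdom d \<inter> cdom e"
  let ?c = "chart_at A p"
  let ?F = "\<lambda>d. cmap d \<circ> f \<circ> cinv ?c" and ?J = "frechet_derivative (cmap e \<circ> cinv d) (at (cmap d (f p)))"
  note c = M.chart_at[of p]
  have y: "?F d (cmap ?c p) = cmap d (f p)" by (simp add: M.cinv_cmap[OF c])
  have "((cmap e \<circ> cinv d) has_derivative ?J) (at (?F d (cmap ?c p)))"
    unfolding y using N.transition_der de by blast
  from diff_chain_at[OF map_der[OF c(1) de(1) c(2)] this]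
  have "((\<lambda>x. (cmap e \<circ> cinv d) (?F d x)) has_derivative
      (\<lambda>u. ?J (frechet_derivative (?F d) (at (cmap ?c p)) u))) (at (cmap ?c p))"
    using de by (simp add: o_def)
  then have "(?F e has_derivative (\<lambda>u. ?J (frechet_derivative (?F d) (at (cmap ?c p)) u))) (at (cmap ?c p))"
  proof (rule has_derivative_transform_within_open)
    show "open (cmap ?c ` (f -` cdom d \<inter> cdom ?c))"
      by (rule M.open_image_chart[OF c(1) open_vimage_cdom[OF de(1)]])
    show "(cmap e \<circ> cinv d) (?F d x) = ?F e x" if "x \<in> cmap ?c ` (f -` cdom d \<inter> cdom ?c)" for x
      using that M.cinv_cmap[OF c(1)] N.cinv_cmap[OF de(1)] by auto
  qed (use c de in auto)
  from fun_cong[OF frechet_derivative_at[OF this], of "v ?c"]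
  show "pushforward A B f p v e = ?J (pushforward A B f p v d)"
    using de by (simp add: pushforward_def Let_def)
qed (auto simp: pushforward_def Let_def)

lemma pullback_tangent:
  assumes D: "affine_connection B D" and v: "v \<in> tangent_space A p"
  shows "pullback_conn A B f D p v W \<in> tangent_space B (f p)"
proof -
  note d = N.chart_at[of "f p"]
  show ?thesis unfolding pullback_conn_def Let_def
    by (intro N.tangent_space_sum N.tangent_space_add N.tangent_space_scale N.coord_field_tangent d
        N.conn_tangent[OF D N.open_cdom[OF d(1)] d(2) push_tangent[OF v] N.coord_vf[OF d(1)]])
qed

text \<open>The pullback connection is defined in one chart of the target; the product rule for the
  transition to any other chart gives the same formula there.\<close>

lemma pullback_chart:
  assumes D: "affine_connection B D"
    and c: "c \<in> A" "p \<in> cdom c" and d: "d \<in> B" "f p \<in> cdom d" and v: "v \<in> tangent_space A p"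
    and U: "open U" "p \<in> U" and W: "\<And>q. q \<in> U \<Longrightarrow> W q \<in> tangent_space B (f q)"
    and Wd: "\<And>e. e \<in> B \<Longrightarrow> f p \<in> cdom e \<Longrightarrow> (\<lambda>x. W (cinv c x) e) differentiable (at (cmap c p))"
  shows "pullback_conn A B f D p v W d = frechet_derivative (\<lambda>x. W (cinv c x) d) (at (cmap c p)) (v c)
    + N.christoffel D d (cmap d (f p)) (frechet_derivative (cmap d \<circ> f \<circ> cinv c) (at (cmap c p)) (v c)) (W p d)"
proof -
  let ?e = "chart_at B (f p)" and ?x = "cmap c p" and ?y = "cmap d (f p)" and ?F = "cmap d \<circ> f \<circ> cinv c"
  note e = N.chart_at[of "f p"]
  let ?J = "frechet_derivative (cmap d \<circ> cinv ?e) (at (cmap ?e (f p)))"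
  let ?w = "frechet_derivative ?F (at ?x) (v c)"
  let ?G = "N.christoffel D d ?y ?w"
  define E where "E b y = coord_field B ?e b (cinv d y) d" for b y
  let ?E' = "\<lambda>b. frechet_derivative (E b) (at ?y)"
  let ?W' = "frechet_derivative (\<lambda>x. W (cinv c x) ?e) (at ?x)"
  have lin: "linear (N.christoffel D d ?y ?w)"
    using N.christoffel_bilinear[OF D d(1), of ?y] d by (auto simp: bilinear_def)
  have J: "linear ?J" by (rule N.transition_linear[OF e(1) d(1) e(2) d(2)])
  have WJ: "W q d = (\<Sum>b\<in>Basis. (W q ?e \<bullet> b) *\<^sub>R coord_field B ?e b (f q) d)"
    if q: "q \<in> U" "f q \<in> cdom d" "f q \<in> cdom ?e" for q
    using N.tangentD[OF W[OF q(1)] e(1) d(1) q(3,2)]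
      linear_basis_expansion[OF N.transition_linear[OF e(1) d(1) q(3,2)], of "W q ?e"] q d
    by (simp add: coord_field_def)
  have WJp: "W p d = (\<Sum>b\<in>Basis. (W p ?e \<bullet> b) *\<^sub>R ?J b)"
    using WJ[OF U(2) d(2) e(2)] e d by (simp add: coord_field_def)
  have conn: "D (f p) (pushforward A B f p v) (coord_field B ?e b) d = ?E' b ?w + ?G (?J b)" for b
    using N.conn_chart[OF D d(1) N.open_cdom[OF e(1)] e(2) push_tangent[OF v] d(2) N.coord_vf[OF e(1)], of b]
      e d by (simp add: push_chart[OF c(1) d(1) c(2) d(2) v] E_def[abs_def]) (simp add: coord_field_def)
  have cf: "coord_field B ?e b (f p) d = ?J b" for b
    using e d by (simp add: coord_field_def)
  have ddW: "dderiv A p v (\<lambda>q. W q ?e \<bullet> b) = ?W' (v c) \<bullet> b" for b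
  proof -
    have eq: "(\<lambda>q. W q ?e \<bullet> b) \<circ> cinv c = (\<lambda>x. W (cinv c x) ?e \<bullet> b)" by auto
    have "(\<lambda>x. W (cinv c x) ?e \<bullet> b) differentiable (at ?x)"
      using Wd[OF e] by (auto simp: differentiable_def intro: has_derivative_inner_left)
    then have "dderiv A p v (\<lambda>q. W q ?e \<bullet> b) = frechet_derivative (\<lambda>x. W (cinv c x) ?e \<bullet> b) (at ?x) (v c)"
      using M.dderiv_chart[OF c v, of "\<lambda>q. W q ?e \<bullet> b"] by (simp only: eq)
    then show ?thesis by (simp add: frechet_bounded_linear[OF bounded_linear_inner_left Wd[OF e]])
  qed
  have "pullback_conn A B f D p v W d = (\<Sum>b\<in>Basis. (?W' (v c) \<bullet> b) *\<^sub>R ?J b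
      + (W p ?e \<bullet> b) *\<^sub>R (?E' b ?w + ?G (?J b)))"
    by (simp add: pullback_conn_def Let_def N.sum_tvec_apply N.vscale_simps ddW conn cf)
  also have "\<dots> = (\<Sum>b\<in>Basis. (?W' (v c) \<bullet> b) *\<^sub>R ?J b + (W p ?e \<bullet> b) *\<^sub>R ?E' b ?w) + ?G (W p d)"
    unfolding WJp linear_sum[OF lin] linear_scale[OF lin]
    by (simp add: scaleR_add_right sum.distrib)
  finally have P: "pullback_conn A B f D p v W d =
     (\<Sum>b\<in>Basis. (?W' (v c) \<bullet> b) *\<^sub>R ?J b + (W p ?e \<bullet> b) *\<^sub>R ?E' b ?w) + ?G (W p d)" .
  have Fx: "?F ?x = ?y" by (simp add: M.cinv_cmap[OF c])
  have Ed: "(E b has_derivative ?E' b) (at (?F ?x))" for b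
    unfolding Fx E_def[abs_def]
    by (rule smooth_on_has_derivative[OF N.vector_field_smooth[OF N.coord_vf[OF e(1)] d(1)]]) (use e d in auto)
  have EF: "((\<lambda>x. E b (?F x)) has_derivative (\<lambda>u. ?E' b (frechet_derivative ?F (at ?x) u))) (at ?x)" for b
    using diff_chain_at[OF map_der[OF c(1) d(1) c(2) d(2)] Ed] by (simp add: o_def)
  have EJ: "E b ?y = ?J b" for b using e d by (simp add: E_def N.cinv_cmap coord_field_def)
  have "((\<lambda>x. W (cinv c x) ?e) has_derivative ?W') (at ?x)"
    using Wd[OF e] frechet_derivative_works by blast
  then have "((\<lambda>x. \<Sum>b\<in>Basis. (W (cinv c x) ?e \<bullet> b) *\<^sub>R E b (?F x)) has_derivative
     (\<lambda>u. \<Sum>b\<in>Basis. (W (cinv c ?x) ?e \<bullet> b) *\<^sub>R ?E' b (frechet_derivative ?F (at ?x) u) + (?W' u \<bullet> b) *\<^sub>R E b (?F ?x))) (at ?x)"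
    by (intro has_derivative_sum has_derivative_scaleR has_derivative_inner_left EF)
  then have "((\<lambda>x. W (cinv c x) d) has_derivative
     (\<lambda>u. \<Sum>b\<in>Basis. (W (cinv c ?x) ?e \<bullet> b) *\<^sub>R ?E' b (frechet_derivative ?F (at ?x) u) + (?W' u \<bullet> b) *\<^sub>R E b (?F ?x))) (at ?x)"
  proof (rule has_derivative_transform_within_open)
    let ?V = "U \<inter> f -` cdom d \<inter> f -` cdom ?e"
    show "open (cmap c ` (?V \<inter> cdom c))"
      by (rule M.open_image_chart[OF c(1)]) (intro open_Int U open_vimage_cdom d e)
    show "?x \<in> cmap c ` (?V \<inter> cdom c)" using U c d e by auto
    show "(\<Sum>b\<in>Basis. (W (cinv c x) ?e \<bullet> b) *\<^sub>R E b (?F x)) = W (cinv c x) d" if "x \<in> cmap c ` (?V \<inter> cdom c)" for x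
      using that WJ by (auto simp: E_def M.cinv_cmap[OF c(1)] N.cinv_cmap[OF d(1)])
  qed
  from fun_cong[OF frechet_derivative_at[OF this], of "v c"]
  show ?thesis using P unfolding Fx EJ by (simp add: M.cinv_cmap[OF c] add.commute)
qed

lemma pullback_push_coord:
  assumes D: "affine_connection B D" and c: "c \<in> A" "p \<in> cdom c" and d: "d \<in> B" "f p \<in> cdom d"
  shows "pullback_conn A B f D p (coord_field A c u p) (\<lambda>q. pushforward A B f q (coord_field A c v q)) d =
    frechet_derivative (\<lambda>x. frechet_derivative (cmap d \<circ> f \<circ> cinv c) (at x) v) (at (cmap c p)) u
    + N.christoffel D d (cmap d (f p)) (frechet_derivative (cmap d \<circ> f \<circ> cinv c) (at (cmap c p)) u)
        (frechet_derivative (cmap d \<circ> f \<circ> cinv c) (at (cmap c p)) v)"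
proof -
  let ?W = "\<lambda>q. pushforward A B f q (coord_field A c v q)"
  let ?F = "\<lambda>e. cmap e \<circ> f \<circ> cinv c" and ?x = "cmap c p"
  have eq: "?W (cinv c x) e = frechet_derivative (?F e) (at x) v"
    if "x \<in> cmap c ` (f -` cdom e \<inter> cdom c)" "e \<in> B" for x e
  proof -
    have x: "x \<in> cmap c ` cdom c" "f (cinv c x) \<in> cdom e" using that(1) M.cinv_cmap[OF c(1)] by auto
    show ?thesis
      using push_chart[OF c(1) that(2) M.cinv_in[OF c(1) x(1)] x(2) M.coord_field_tangent[OF c(1) M.cinv_in[OF c(1) x(1)]], of v]
      by (simp add: M.coord_field_self[OF c(1) M.cinv_in[OF c(1) x(1)]] M.cmap_cinv[OF c(1) x(1)])
  qed
  have o: "open (cmap c ` (f -` cdom e \<inter> cdom c))" if "e \<in> B" for e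
    by (rule M.open_image_chart[OF c(1) open_vimage_cdom[OF that]])
  have diff: "(\<lambda>x. ?W (cinv c x) e) differentiable (at ?x)" if e: "e \<in> B" "f p \<in> cdom e" for e
  proof -
    have x: "?x \<in> cmap c ` (f -` cdom e \<inter> cdom c)" using e c by auto
    have "smooth_on (cmap c ` (f -` cdom e \<inter> cdom c)) (\<lambda>x. ?W (cinv c x) e)"
      by (subst smooth_on_cong[OF o[OF e(1)] eq[OF _ e(1)]], assumption)
        (rule smooth_on_frechet[OF map_smooth[OF c(1) e(1)]])
    then show ?thesis by (rule smooth_on_differentiable[OF _ x])
  qed
  have x: "?x \<in> cmap c ` (f -` cdom d \<inter> cdom c)" using d c by auto
  have "pullback_conn A B f D p (coord_field A c u p) ?W d =
    frechet_derivative (\<lambda>x. ?W (cinv c x) d) (at ?x) u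
    + N.christoffel D d (cmap d (f p)) (frechet_derivative (?F d) (at ?x) u) (?W p d)"
    using pullback_chart[OF D c d M.coord_field_tangent[OF c] M.open_cdom[OF c(1)] c(2)
      push_tangent[OF M.coord_field_tangent[OF c(1)]] diff, of u]
    by (simp add: M.coord_field_self[OF c])
  moreover have "?W p d = frechet_derivative (?F d) (at ?x) v"
    using eq[OF x d(1)] by (simp add: M.cinv_cmap[OF c])
  moreover have "frechet_derivative (\<lambda>x. ?W (cinv c x) d) (at ?x) =
     frechet_derivative (\<lambda>x. frechet_derivative (?F d) (at x) v) (at ?x)"
    by (rule frechet_cong_open[OF o[OF d(1)] x eq[OF _ d(1)]])
  ultimately show ?thesis by simp
qed

end

section \<open>Statistical hypersurfaces of Hessian manifolds\<close>

locale statistical_hypersurface = smooth_manifold_map A B f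
  for A :: "('a::topological_space, 'm::euclidean_space) chart set"
    and B :: "('b::topological_space, 'n::euclidean_space) chart set" and f :: "'a \<Rightarrow> 'b" +
  fixes D :: "('a, 'm) conn" and g :: "('a, 'm) metric"
    and D' D0 :: "('b, 'n) conn" and g' :: "('b, 'n) metric" and k c :: real
  assumes M: "trivial_statistical_manifold A D g" "constant_curvature A D g k"
    and N: "hessian_manifold B D' g'"
    and D0: "levi_civita B g' D0"
    and hess: "constant_hessian_curvature B D' D0 g' c"
    and stat: "statistical_immersion A D g B D' g' f"
begin

lemma conn_facts_M: "riemannian_metric A g" "affine_connection A D" "torsion_free A D" "levi_civita A g D"
  using M(1) by (auto simp: trivial_statistical_manifold_def statistical_manifold_def)

lemma conn_facts_N: "riemannian_metric B g'" "affine_connection B D'" "torsion_free B D'"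
    "statistical_manifold B D' g'" "constant_curvature B D' g' 0" "affine_connection B D0" "torsion_free B D0"
  using N D0 by (auto simp: hessian_manifold_def statistical_manifold_def levi_civita_def)

lemma immersion_inj: "inj_on (pushforward A B f p) (tangent_space A p)"
  using stat[unfolded statistical_immersion_def immersion_def] by simp

lemma immersion_isometric:
  "u \<in> tangent_space A p \<Longrightarrow> v \<in> tangent_space A p \<Longrightarrow>
    g p u v = g' (f p) (pushforward A B f p u) (pushforward A B f p v)"
  using stat[unfolded statistical_immersion_def, THEN conjunct2, THEN conjunct1, rule_format] .

lemma local_coordinates:
  assumes a: "a \<in> A" and b: "b \<in> B"
  shows "local_hypersurface (cmap a ` (f -` cdom b \<inter> cdom a)) (cmap b ` cdom b) (cmap b \<circ> f \<circ> cinv a)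
    (M.metric_coeff g a) (M.christoffel D a) (N.metric_coeff g' b) (N.christoffel D' b) (N.christoffel D0 b) k c"
proof
  let ?V = "cmap a ` (f -` cdom b \<inter> cdom a)" and ?Q = "cmap b ` cdom b" and ?F = "cmap b \<circ> f \<circ> cinv a"
  let ?T = "\<lambda>x. frechet_derivative ?F (at x)"
  note gM = conn_facts_M(1) and gN = conn_facts_N(1) and DM = conn_facts_M(2) and DN = conn_facts_N(2)
    and D0N = conn_facts_N(6)
  have Vsub: "?V \<subseteq> cmap a ` cdom a" by auto
  have V: "cinv a x \<in> cdom a" "cmap a (cinv a x) = x" "x \<in> cmap a ` cdom a" "f (cinv a x) \<in> cdom b"
    "?F x = cmap b (f (cinv a x))" if "x \<in> ?V" for x
    using that M.cinv_cmap[OF a] by auto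
  have Qb: "cinv b y \<in> cdom b" "cmap b (cinv b y) = y" if "y \<in> ?Q" for y
    using that N.cinv_cmap[OF b] by auto
  show "open ?V" by (rule M.open_image_chart[OF a open_vimage_cdom[OF b]])
  show "open ?Q" by (rule N.open_chart_image[OF b])
  show FV: "?F x \<in> ?Q" if "x \<in> ?V" for x using V[OF that] by auto
  show "smooth_on ?V ?F" by (rule map_smooth[OF a b])
  have push: "pushforward A B f (cinv a x) (coord_field A a u (cinv a x)) b = ?T x u" if "x \<in> ?V" for x u
    using push_chart[OF a b V(1,4) M.coord_field_tangent[OF a V(1)], OF that that that]
      M.coord_field_self[OF a V(1)[OF that]] V(2)[OF that] by simp
  show "inj (?T x)" if x: "x \<in> ?V" for x
  proof (rule injI)
    fix u v assume uv: "?T x u = ?T x v"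
    let ?p = "cinv a x" and ?E = "\<lambda>u. coord_field A a u (cinv a x)"
    have t: "?E u \<in> tangent_space A ?p" for u by (rule M.coord_field_tangent[OF a V(1)[OF x]])
    have "pushforward A B f ?p (?E u) = pushforward A B f ?p (?E v)"
      by (rule N.tangent_eqI[OF push_tangent[OF t] push_tangent[OF t] b V(4)[OF x]])
        (simp add: push[OF x] uv)
    then have "?E u = ?E v" using inj_onD[OF immersion_inj] t by blast
    then show "u = v" using M.coord_field_self[OF a V(1)[OF x]] by metis
  qed
  show "sym_form (M.metric_coeff g a x)" if "x \<in> ?V" for x by (rule M.metric_form[OF gM a V(3)[OF that]])
  show "M.metric_coeff g a x v v > 0" if "x \<in> ?V" "v \<noteq> 0" for x v
    by (rule M.metric_pos[OF gM a V(3)[OF that(1)] that(2)])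
  show "sym_form (N.metric_coeff g' b y)" if "y \<in> ?Q" for y by (rule N.metric_form[OF gN b that])
  show "N.metric_coeff g' b y v v > 0" if "y \<in> ?Q" "v \<noteq> 0" for y v
    by (rule N.metric_pos[OF gN b that])
  show "smooth_on ?Q (\<lambda>y. N.metric_coeff g' b y u v)" for u v by (rule N.metric_smooth[OF gN b])
  show "bilinear (M.christoffel D a x)" if "x \<in> ?V" for x by (rule M.christoffel_bilinear[OF DM a V(3)[OF that]])
  show "bilinear (N.christoffel D' b y)" if "y \<in> ?Q" for y by (rule N.christoffel_bilinear[OF DN b that])
  show "bilinear (N.christoffel D0 b y)" if "y \<in> ?Q" for y by (rule N.christoffel_bilinear[OF D0N b that])
  show "M.christoffel D a x u v = M.christoffel D a x v u" if "x \<in> ?V" for x u v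
    using M.torsion_coord(2)[OF DM a conn_facts_M(3) V(1)[OF that], of u v] V(2)[OF that] by simp
  show "N.christoffel D' b y u v = N.christoffel D' b y v u" if "y \<in> ?Q" for y u v
    using N.torsion_coord(2)[OF DN b conn_facts_N(3) Qb(1)[OF that], of u v] Qb(2)[OF that] by simp
  show "N.christoffel D0 b y u v = N.christoffel D0 b y v u" if "y \<in> ?Q" for y u v
    using N.torsion_coord(2)[OF D0N b conn_facts_N(7) Qb(1)[OF that], of u v] Qb(2)[OF that] by simp
  show "smooth_on ?V (\<lambda>x. M.christoffel D a x u v)" for u v
    by (rule smooth_on_subset[OF M.christoffel_smooth[OF DM a] Vsub])
  show "smooth_on ?Q (\<lambda>y. N.christoffel D' b y u v)" for u v by (rule N.christoffel_smooth[OF DN b])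
  show "smooth_on ?Q (\<lambda>y. N.christoffel D0 b y u v)" for u v by (rule N.christoffel_smooth[OF D0N b])
  show "frechet_derivative (\<lambda>x. M.metric_coeff g a x v w) (at x) u =
     M.metric_coeff g a x (M.christoffel D a x u v) w + M.metric_coeff g a x v (M.christoffel D a x u w)"
    if "x \<in> ?V" for x u v w
    by (rule M.levi_civita_coord[OF conn_facts_M(4) gM a V(3)[OF that]])
  show "frechet_derivative (\<lambda>y. N.metric_coeff g' b y v w) (at y) u =
     N.metric_coeff g' b y (N.christoffel D0 b y u v) w + N.metric_coeff g' b y v (N.christoffel D0 b y u w)"
    if "y \<in> ?Q" for y u v w
    by (rule N.levi_civita_coord[OF D0 gN b that])
  show "frechet_derivative (\<lambda>y. N.metric_coeff g' b y v w) (at y) u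
      - N.metric_coeff g' b y (N.christoffel D' b y u v) w - N.metric_coeff g' b y v (N.christoffel D' b y u w) =
    frechet_derivative (\<lambda>y. N.metric_coeff g' b y u w) (at y) v
      - N.metric_coeff g' b y (N.christoffel D' b y v u) w - N.metric_coeff g' b y u (N.christoffel D' b y v w)"
    if "y \<in> ?Q" for y u v w
    by (rule N.codazzi_coord[OF conn_facts_N(4) b that])
  show "frechet_derivative (\<lambda>x. M.christoffel D a x v w) (at x) u + M.christoffel D a x u (M.christoffel D a x v w)
    - (frechet_derivative (\<lambda>x. M.christoffel D a x u w) (at x) v + M.christoffel D a x v (M.christoffel D a x u w)) =
    k *\<^sub>R (M.metric_coeff g a x v w *\<^sub>R u - M.metric_coeff g a x u w *\<^sub>R v)"
    if "x \<in> ?V" for x u v w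
    by (rule M.constant_curvature_coord[OF M(2) DM conn_facts_M(3) gM a V(3)[OF that]])
  show "frechet_derivative (\<lambda>y. N.christoffel D' b y v w) (at y) u + N.christoffel D' b y u (N.christoffel D' b y v w) =
    frechet_derivative (\<lambda>y. N.christoffel D' b y u w) (at y) v + N.christoffel D' b y v (N.christoffel D' b y u w)"
    if "y \<in> ?Q" for y u v w
    using N.constant_curvature_coord[OF conn_facts_N(5) DN conn_facts_N(3) gN b that, of v w u] by simp
  show "frechet_derivative (\<lambda>y. N.christoffel D' b y v w - N.christoffel D0 b y v w) (at y) u
      + N.christoffel D' b y u (N.christoffel D' b y v w - N.christoffel D0 b y v w)
      - (N.christoffel D' b y (N.christoffel D' b y u v) w - N.christoffel D0 b y (N.christoffel D' b y u v) w)
      - (N.christoffel D' b y v (N.christoffel D' b y u w) - N.christoffel D0 b y v (N.christoffel D' b y u w)) =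
      - (c / 2) *\<^sub>R (N.metric_coeff g' b y u v *\<^sub>R w + N.metric_coeff g' b y u w *\<^sub>R v)"
    if "y \<in> ?Q" for y u v w
    by (rule N.hessian_curvature_coord[OF hess DN D0N gN b that])
  show "M.metric_coeff g a x u v = N.metric_coeff g' b (?F x) (?T x u) (?T x v)" if x: "x \<in> ?V" for x u v
  proof -
    note t = M.coord_field_tangent[OF a V(1)[OF x]]
    show ?thesis
      unfolding M.metric_coeff_def V(5)[OF x] immersion_isometric[OF t t]
        N.metric_chart[OF gN b V(4)[OF x] push_tangent[OF t] push_tangent[OF t]] push[OF x] ..
  qed
  show "M.metric_coeff g a x (M.christoffel D a x u v) w = N.metric_coeff g' b (?F x)
      (frechet_derivative (\<lambda>x. ?T x v) (at x) u + N.christoffel D' b (?F x) (?T x u) (?T x v)) (?T x w)"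
    if x: "x \<in> ?V" for x u v w
  proof -
    let ?p = "cinv a x" and ?E = "coord_field A a"
    note t = M.coord_field_tangent[OF a V(1)[OF x]]
    have "g ?p (cov D (?E u) (?E v) ?p) (?E w ?p) =
          g' (f ?p) (pullback_conn A B f D' ?p (?E u ?p) (\<lambda>q. pushforward A B f q (?E v q)))
                   (pushforward A B f ?p (?E w ?p))"
      by (rule stat[unfolded statistical_immersion_def, THEN conjunct2, THEN conjunct2, rule_format,
            OF M.open_cdom[OF a] M.coord_vf[OF a] M.coord_vf[OF a] M.coord_vf[OF a] V(1)[OF x]])
    moreover have "cov D (?E u) (?E v) ?p \<in> tangent_space A ?p"
      by (rule M.vector_field_tangent[OF M.cov_vector_field[OF DM M.open_cdom[OF a] M.coord_vf[OF a] M.coord_vf[OF a]] V(1)[OF x]])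
    ultimately show ?thesis
      using M.metric_chart[OF gM a V(1)[OF x], of "cov D (?E u) (?E v) ?p" "?E w ?p"] t
        N.metric_chart[OF gN b V(4)[OF x] pullback_tangent[OF DN t] push_tangent[OF t]]
      by (simp add: M.cov_coord[OF a V(1)[OF x]] V(2)[OF x] M.coord_field_self[OF a V(1)[OF x]]
          pullback_push_coord[OF DN a V(1)[OF x] b V(4)[OF x]] push[OF x])
  qed
qed

end

section \<open>The shape operator\<close>

context statistical_hypersurface
begin

context
  assumes dim: "DIM('m) \<ge> 2" "DIM('m) = 2 \<Longrightarrow> c \<noteq> 0" and codim: "DIM('n) = DIM('m) + 1"
begin

lemma curvature_inequality: "2 * k + c \<ge> 0"
proof -
  \<comment> \<open>the second fundamental forms at a single point already give the inequality\<close>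
  fix p :: 'a
  let ?a = "chart_at A p" and ?b = "chart_at B (f p)"
  note a = M.chart_at[of p] and b = N.chart_at[of "f p"]
  interpret L: local_hypersurface "cmap ?a ` (f -` cdom ?b \<inter> cdom ?a)" "cmap ?b ` cdom ?b"
    "cmap ?b \<circ> f \<circ> cinv ?a" "M.metric_coeff g ?a" "M.christoffel D ?a"
    "N.metric_coeff g' ?b" "N.christoffel D' ?b" "N.christoffel D0 ?b" k c
    by (rule local_coordinates[OF a(1) b(1)])
  have x: "cmap ?a p \<in> cmap ?a ` (f -` cdom ?b \<inter> cdom ?a)" using a b by auto
  obtain n where n: "N.metric_coeff g' ?b ((cmap ?b \<circ> f \<circ> cinv ?a) (cmap ?a p)) n n = 1"
    "\<And>u. N.metric_coeff g' ?b ((cmap ?b \<circ> f \<circ> cinv ?a) (cmap ?a p)) n (L.T (cmap ?a p) u) = 0"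
    by (rule unit_normal_exists[OF L.gt[OF L.FV[OF x]] L.gt_pos[OF L.FV[OF x]] L.T_linear[OF x] codim], assumption) (rule that)
  from L.second_fundamental_form[OF x codim n dim] show ?thesis by blast
qed

text \<open>Both sides are tangent vectors, so that one chart of the target suffices for the comparison; the
  uniqueness of the shape operator is the injectivity of the differential.\<close>

lemma shape_operator_eqI:
  assumes v: "v \<in> tangent_space A p" and b: "b \<in> B" "f p \<in> cdom b"
    and eq: "pullback_conn A B f D0 p v \<xi> b = - (e *\<^sub>R pushforward A B f p v b)"
  shows "shape_operator A B D0 f \<xi> p v = e *\<^sub>T v"
  unfolding shape_operator_def
proof (rule the_equality)
  have a: "chart_at A p \<in> A" "p \<in> cdom (chart_at A p)" by (rule M.chart_at)+
  note lin = has_derivative_linear[OF map_der[OF a(1) b(1) a(2) b(2)]]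
  have push: "pushforward A B f p (e *\<^sub>T v) b = e *\<^sub>R pushforward A B f p v b"
    by (simp add: push_chart[OF a(1) b(1) a(2) b(2)] v M.tangent_space_scale M.vscale_simps linear_scale[OF lin])
  have neg: "- pushforward A B f p w \<in> tangent_space B (f p)" if "w \<in> tangent_space A p" for w
    using N.tangent_space_scale[OF push_tangent[OF that], of "-1"] by (simp add: N.vscale_simps)
  have "pullback_conn A B f D0 p v \<xi> = - pushforward A B f p (e *\<^sub>T v)"
    by (rule N.tangent_eqI[OF pullback_tangent[OF conn_facts_N(6) v] neg b])
      (simp_all add: eq push v M.tangent_space_scale)
  then show *: "e *\<^sub>T v \<in> tangent_space A p \<and> pullback_conn A B f D0 p v \<xi> = - pushforward A B f p (e *\<^sub>T v)"
    using M.tangent_space_scale[OF v] by blast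
  show "w = e *\<^sub>T v" if "w \<in> tangent_space A p \<and> pullback_conn A B f D0 p v \<xi> = - pushforward A B f p w" for w
  proof (rule inj_onD[OF immersion_inj])
    show "pushforward A B f p w = pushforward A B f p (e *\<^sub>T v)"
      using that * by (metis neg_equal_iff_equal)
  qed (use that * in auto)
qed

text \<open>Locally the sign of the factor is the sign of the second fundamental form on one fixed
  coordinate vector, a continuous function.\<close>

lemma shape_operator_local:
  assumes c0: "c > 0" and U: "open U" and \<xi>: "unit_normal_field A B g' f U \<xi>" and p: "p \<in> U"
  defines "s \<equiv> 1/2 * sqrt (2 * k + c)"
  shows "\<exists>W e. open W \<and> p \<in> W \<and> (e = s \<or> e = - s) \<and>
    (\<forall>q\<in>W. \<forall>v\<in>tangent_space A q. shape_operator A B D0 f \<xi> q v = e *\<^sub>T v)"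
proof -
  let ?a = "chart_at A p" and ?b = "chart_at B (f p)"
  note a = M.chart_at[of p] and b = N.chart_at[of "f p"]
  let ?V = "cmap ?a ` (f -` cdom ?b \<inter> cdom ?a)" and ?F = "cmap ?b \<circ> f \<circ> cinv ?a"
  let ?gt = "N.metric_coeff g' ?b" and ?gm = "M.metric_coeff g ?a"
  let ?V' = "cmap ?a ` ((U \<inter> f -` cdom ?b) \<inter> cdom ?a)"
  interpret L: local_hypersurface ?V "cmap ?b ` cdom ?b" ?F ?gm "M.christoffel D ?a"
    ?gt "N.christoffel D' ?b" "N.christoffel D0 ?b" k c
    by (rule local_coordinates[OF a(1) b(1)])
  have V': "open ?V'" "?V' \<subseteq> ?V"
    using M.open_image_chart[OF a(1) open_Int[OF U open_vimage_cdom[OF b(1)]]] by auto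
  define n where "n x = \<xi> (cinv ?a x) ?b" for x
  have \<xi>s: "smooth_on (cmap ?a ` ((U \<inter> f -` cdom e) \<inter> cdom ?a)) (\<lambda>x. \<xi> (cinv ?a x) e)" if "e \<in> B" for e
  proof -
    have "U \<inter> f -` cdom e \<inter> cdom ?a = U \<inter> cdom ?a \<inter> f -` cdom e" by auto
    then show ?thesis
      using \<xi> a(1) that unfolding unit_normal_field_def fields_along_def by auto
  qed
  have n_der: "(n has_derivative frechet_derivative n (at x)) (at x)" if "x \<in> ?V'" for x
    using smooth_on_has_derivative[OF \<xi>s[OF b(1)] that] by (simp add: n_def[abs_def])
  have \<xi>t: "\<xi> q \<in> tangent_space B (f q)" if "q \<in> U" for q
    using \<xi> that unfolding unit_normal_field_def fields_along_def by auto
  have pt: "cinv ?a x \<in> cdom ?a" "cmap ?a (cinv ?a x) = x" "f (cinv ?a x) \<in> cdom ?b" "cinv ?a x \<in> U"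
    "?F x = cmap ?b (f (cinv ?a x))" if "x \<in> ?V'" for x
    using that M.cinv_cmap[OF a(1)] by auto
  have unit: "?gt (?F x) (n x) (n x) = 1" if x: "x \<in> ?V'" for x
  proof -
    note q = pt[OF x]
    have "g' (f (cinv ?a x)) (\<xi> (cinv ?a x)) (\<xi> (cinv ?a x)) = 1"
      using \<xi> q(4) unfolding unit_normal_field_def by auto
    then show ?thesis
      using N.metric_chart[OF conn_facts_N(1) b(1) q(3) \<xi>t[OF q(4)] \<xi>t[OF q(4)]] q(5) by (simp add: n_def)
  qed
  have normal: "?gt (?F x) (n x) (L.T x u) = 0" if x: "x \<in> ?V'" for x u
  proof -
    note q = pt[OF x]
    let ?v = "coord_field A ?a u (cinv ?a x)"
    note v = M.coord_field_tangent[OF a(1) q(1), of u]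
    have "g' (f (cinv ?a x)) (\<xi> (cinv ?a x)) (pushforward A B f (cinv ?a x) ?v) = 0"
      using \<xi> q(4) v unfolding unit_normal_field_def by auto
    moreover have "pushforward A B f (cinv ?a x) ?v ?b = L.T x u"
      using push_chart[OF a(1) b(1) q(1,3) v] by (simp add: L.T_def q(2) M.coord_field_self[OF a(1) q(1)])
    ultimately show ?thesis
      using N.metric_chart[OF conn_facts_N(1) b(1) q(3) \<xi>t[OF q(4)] push_tangent[OF v]] q(5) by (simp add: n_def)
  qed
  have ex: "\<exists>e. (e = s \<or> e = - s) \<and> (\<forall>u v. ?gt (?F x) (L.II x u v) (n x) = e * ?gm x u v)" if x: "x \<in> ?V'" for x
    using L.second_fundamental_form[OF _ codim unit[OF x] normal[OF x] dim] x V' c0 unfolding s_def by blast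
  obtain i :: 'm where i: "i \<in> Basis" using nonempty_Basis by blast
  let ?\<sigma> = "\<lambda>x. ?gt (?F x) (L.II x i i) (n x)"
  let ?x = "cmap ?a p"
  have x: "?x \<in> ?V'" using p a b by auto
  obtain e where e: "e = s \<or> e = - s" "\<And>u v. ?gt (?F ?x) (L.II ?x u v) (n ?x) = e * ?gm ?x u v"
    using ex[OF x] by blast
  have gm_i: "?gm x i i > 0" if "x \<in> ?V'" for x
    by (rule L.gm_pos) (use that V' i nonzero_Basis in auto)
  have "\<exists>S. open S \<and> ?x \<in> S \<and> S \<subseteq> ?V' \<and> (\<forall>x\<in>S. \<forall>u v. ?gt (?F x) (L.II x u v) (n x) = e * ?gm x u v)"
  proof (cases "s = 0")
    case True
    then have "\<forall>x\<in>?V'. \<forall>u v. ?gt (?F x) (L.II x u v) (n x) = e * ?gm x u v" using ex e(1) by force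
    then show ?thesis using V'(1) x by blast
  next
    case False
    have "?x \<in> ?V" using x V'(2) by blast
    from has_derivative_continuous[OF L.metric_along[OF this smooth_on_has_derivative[OF L.II_smooth[THEN conjunct1] this] n_der[OF x]], of i i]
    have cont: "continuous (at ?x) (\<lambda>x. e * ?\<sigma> x)" by (intro continuous_intros)
    have "e * ?\<sigma> ?x = e^2 * ?gm ?x i i" by (simp only: e(2) power2_eq_square mult.assoc)
    then have "e * ?\<sigma> ?x > 0" using gm_i[OF x] False e(1) by auto
    then obtain S where S: "open S" "?x \<in> S" "\<And>y. y \<in> S \<Longrightarrow> e * ?\<sigma> y > 0"
      using continuous_at_open[THEN iffD1, OF cont, rule_format, of "{0<..}"] by auto
    have "?gt (?F y) (L.II y u v) (n y) = e * ?gm y u v" if y: "y \<in> S \<inter> ?V'" for y u v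
    proof -
      obtain e' where e': "e' = s \<or> e' = - s" "\<And>u v. ?gt (?F y) (L.II y u v) (n y) = e' * ?gm y u v"
        using ex[of y] y by blast
      have "0 < e * e' * ?gm y i i" using S(3)[of y] y e'(2) by simp
      then have "e * e' > 0" using gm_i[of y] y by (simp add: zero_less_mult_iff)
      then have "e' = e" using e(1) e'(1) not_square_less_zero[of s] by auto
      then show ?thesis using e'(2) by simp
    qed
    then show ?thesis using S V'(1) x by (intro exI[of _ "S \<inter> ?V'"]) auto
  qed
  then obtain S where S: "open S" "?x \<in> S" "S \<subseteq> ?V'"
    "\<And>x u v. x \<in> S \<Longrightarrow> ?gt (?F x) (L.II x u v) (n x) = e * ?gm x u v" by blast
  have "shape_operator A B D0 f \<xi> q v = e *\<^sub>T v"
    if q: "q \<in> cdom ?a \<inter> cmap ?a -` S" and v: "v \<in> tangent_space A q" for q v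
  proof (rule shape_operator_eqI[OF v b(1)])
    let ?y = "cmap ?a q"
    have y: "?y \<in> S" "?y \<in> ?V'" and qa: "q \<in> cdom ?a" using q S(3) by auto
    have cq: "cinv ?a ?y = q" by (rule M.cinv_cmap[OF a(1) qa])
    have qU: "q \<in> U" and fq: "f q \<in> cdom ?b" using pt(3,4)[OF y(2)] cq by auto
    show "f q \<in> cdom ?b" by (rule fq)
    have "pullback_conn A B f D0 q v \<xi> ?b = frechet_derivative n (at ?y) (v ?a)
        + N.christoffel D0 ?b (?F ?y) (L.T ?y (v ?a)) (n ?y)"
    proof -
      have "(\<lambda>x. \<xi> (cinv ?a x) e) differentiable (at ?y)" if "e \<in> B" "f q \<in> cdom e" for e
        by (rule smooth_on_differentiable[OF \<xi>s[OF that(1)]]) (use that qa qU in auto)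
      from pullback_chart[OF conn_facts_N(6) a(1) qa b(1) fq v U qU \<xi>t this]
      show ?thesis by (simp add: n_def[abs_def] L.T_def cq)
    qed
    also have "\<dots> = - (e *\<^sub>R L.T ?y (v ?a))"
      by (rule L.shape_operator_coordinates[OF V' y(2) codim n_der[OF y(2)] unit normal S(4)[OF y(1)]])
    also have "L.T ?y (v ?a) = pushforward A B f q v ?b"
      using push_chart[OF a(1) b(1) qa fq v] by (simp add: L.T_def)
    finally show "pullback_conn A B f D0 q v \<xi> ?b = - (e *\<^sub>R pushforward A B f q v ?b)" .
  qed
  moreover have "open (cdom ?a \<inter> cmap ?a -` S)" by (rule M.open_preimage_chart[OF a(1) S(1)])
  moreover have "p \<in> cdom ?a \<inter> cmap ?a -` S" using a S by auto
  ultimately show ?thesis using e(1) by blast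
qed

text \<open>Tangent spaces are nonzero, so the factor at a point is unique.  Whether it equals \<open>s\<close> is
  therefore locally constant, hence constant on a connected domain.\<close>

lemma shape_operator_connected:
  assumes c0: "c > 0" and U: "open U" "connected U" and \<xi>: "unit_normal_field A B g' f U \<xi>"
  defines "s \<equiv> 1/2 * sqrt (2 * k + c)"
  shows "(\<forall>p\<in>U. \<forall>v\<in>tangent_space A p. shape_operator A B D0 f \<xi> p v = s *\<^sub>T v) \<or>
    (\<forall>p\<in>U. \<forall>v\<in>tangent_space A p. shape_operator A B D0 f \<xi> p v = (- s) *\<^sub>T v)"
proof -
  define P where "P e q \<longleftrightarrow> (\<forall>v\<in>tangent_space A q. shape_operator A B D0 f \<xi> q v = e *\<^sub>T v)" for e q
  have loc: "\<exists>W e. open W \<and> p \<in> W \<and> (e = s \<or> e = - s) \<and> (\<forall>q\<in>W. P e q)" if "p \<in> U" for p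
    using shape_operator_local[OF c0 U(1) \<xi> that] unfolding P_def s_def .
  have uniq: "e = e'" if "P e q" "P e' q" for e e' q
  proof -
    let ?a = "chart_at A q"
    note a = M.chart_at[of q]
    obtain i :: 'm where i: "i \<in> Basis" using nonempty_Basis by blast
    let ?v = "coord_field A ?a i q"
    have "e *\<^sub>T ?v = e' *\<^sub>T ?v" using that M.coord_field_tangent[OF a] unfolding P_def by metis
    from fun_cong[OF this, of ?a] have "e *\<^sub>R i = e' *\<^sub>R i"
      by (simp add: M.vscale_simps M.coord_field_self[OF a])
    then show ?thesis using i nonzero_Basis by auto
  qed
  have const: "P s p = P s q" if "p \<in> U" "q \<in> U" for p q
  proof (rule connected_local_const[OF U(2) that], intro ballI)
    fix r assume "r \<in> U"
    from loc[OF this] obtain W e where W: "open W" "r \<in> W" "\<And>q. q \<in> W \<Longrightarrow> P e q" by metis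
    have "P s r = P s q" if "q \<in> W" for q
    proof -
      have "P s q' \<longleftrightarrow> s = e" if "q' \<in> W" for q' using uniq[OF W(3)[OF that], of s] W(3)[OF that] by auto
      then show ?thesis using W(2) that by blast
    qed
    then show "\<forall>\<^sub>F q in at r within U. P s r = P s q"
      using W(1,2) unfolding eventually_at_topological by blast
  qed
  have "P s p \<or> P (- s) p" if "p \<in> U" for p using loc[OF that] by blast
  then have "(\<forall>p\<in>U. P s p) \<or> (\<forall>p\<in>U. P (- s) p)" using const by blast
  then show ?thesis unfolding P_def .
qed

end
end

theorem theorem4p2:
  fixes A :: "('a::{t2_space, second_countable_topology}, 'm::euclidean_space) chart set"
    and D :: "('a, 'm) conn" and g :: "('a, 'm) metric"
    and B :: "('b::{t2_space, second_countable_topology}, 'n::euclidean_space) chart set"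
    and D' D0 :: "('b, 'n) conn" and g' :: "('b, 'n) metric"
    and f :: "'a \<Rightarrow> 'b" and k c :: real
  assumes dim: "DIM('m) \<ge> 2" "DIM('m) = 2 \<Longrightarrow> c \<noteq> 0"
    and M: "trivial_statistical_manifold A D g" "constant_curvature A D g k"
    and N: "hessian_manifold B D' g'"
    and D0: "levi_civita B g' D0"
    and c: "constant_hessian_curvature B D' D0 g' c"
    and codim: "DIM('n) = DIM('m) + 1"
    and f: "statistical_immersion A D g B D' g' f"
  shows "2 * k + c \<ge> 0 \<and>
    (c > 0 \<longrightarrow>
      (\<forall>U \<xi>. open U \<and> connected U \<and> unit_normal_field A B g' f U \<xi> \<longrightarrow>
        (\<forall>p\<in>U. \<forall>v\<in>tangent_space A p.
           shape_operator A B D0 f \<xi> p v = (1/2 * sqrt (2 * k + c)) *\<^sub>T v) \<or>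
        (\<forall>p\<in>U. \<forall>v\<in>tangent_space A p.
           shape_operator A B D0 f \<xi> p v = (- (1/2 * sqrt (2 * k + c))) *\<^sub>T v)))"
proof -
  interpret statistical_hypersurface A B f D g D' D0 g' k c
    using M N D0 c f
    by unfold_locales
      (auto simp: trivial_statistical_manifold_def hessian_manifold_def statistical_manifold_def
        statistical_immersion_def immersion_def)
  show ?thesis
    using curvature_inequality[OF dim codim] shape_operator_connected[OF dim codim] by blast
qed

end
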